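(* Let $\mathbf{f}\in (L^2(\Omega))^3$, let $\mathbf{u}\in\mathbf{V}$ be the exact solution of the Stokes equation, i.e. $(\nabla\mathbf{u},\nabla\mathbf{v})=(\mathbf{f},\mathbf{v})$ for all $\mathbf{v}\in\mathbf{V}$, and let $\mathbf{u}_h=P_h\mathbf{u}$. Then $$\|\mathbf{u}-\mathbf{u}_h\|\le C_h\|\nabla\mathbf{u}-\nabla\mathbf{u}_h\|,\qquad \|\nabla\mathbf{u}-\nabla\mathbf{u}_h\|\le C_h\|\mathbf{f}\|,$$ where $$C_h:=\sqrt{C_{0,h}^2+\kappa_h^2}.$$
   Context: $\Omega\subset\mathbb{R}^3$ is a bounded Lipschitz polyhedral domain and $\mathcal{T}^h$ is a regular tetrahedral subdivision of $\Omega$. $(\cdot,\cdot)$ and $\|\cdot\|$ denote the $L^2(\Omega)$ inner product and norm (componentwise for vector and tensor fields). $\mathbf{V}=\{\mathbf{v}\in (H_0^1(\Omega))^3 : \mathrm{div}\,\mathbf{v}=0\}$. $H(\mathrm{div};\Omega)=\{p\in (L^2(\Omega))^3 : \mathrm{div}\,p\in L^2(\Omega)\}$. For a tensor field $\mathbf{p}=(p_1,p_2,p_3)$ with $p_i\in H(\mathrm{div};\Omega)$, $\mathrm{div}\,\mathbf{p}:=(\mathrm{div}\,p_1,\mathrm{div}\,p_2,\mathrm{div}\,p_3)$; $\nabla\mathbf{u}=(\nabla u_1,\nabla u_2,\nabla u_3)$. Finite element spaces: $P^m(K)$ is the set of polynomials of degree up to $m$ on $K\in\mathcal{T}^h$.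 The degrees are integers $k\ge 3$ and $d=m=k-1$. - $X_h$: the space of (discontinuous) piecewise polynomials of degree up to $d$ on $\mathcal{T}^h$; $\mathbf{X}_h=(X_h)^3$. - $U_h$: the space of functions in $H^1(\Omega)$ that are piecewise polynomials of degree up to $k$ on $\mathcal{T}^h$; $U_{h,0}=\{u_h\in U_h : u_h=0\text{ on }\partial\Omega\}$; $\mathbf{U}_{h,0}=(U_{h,0})^3$. - $\mathbf{V}_h=\{\mathbf{v}_h\in\mathbf{U}_{h,0} : \mathrm{div}\,\mathbf{v}_h=0\}\subset\mathbf{V}$. - $RT_h=\{p_h\in H(\mathrm{div};\Omega) : p_h|_K=\mathbf{a}_K+b_K\mathbf{x},\ \mathbf{a}_K\in(P^m(K))^3,\ b_K\in P^m(K),\ \forall K\in\mathcal{T}^h\}$ (Raviart–Thomas space); $\mathbf{RT}_h=(RT_h)^3$. $P_h:\mathbf{V}\to\mathbf{V}_h$ is the projection defined by $(\nabla(\mathbf{v}-P_h\mathbf{v}),\nabla\mathbf{v}_h)=0$ for all $\mathbf{v}_h\in\mathbf{V}_h$. $\pi_h:(L^2(\Omega))^3\to\mathbf{X}_h$ is the $L^2$-orthogonal projection. $C_{0,h}$ is a constant such that $\|\mathbf{w}-\pi_h\mathbf{w}\|\le C_{0,h}\|\nabla\mathbf{w}\|$ for all $\mathbf{w}\in\mathbf{V}$. The quantity $\kappa_h$ is $$\kappa_h=\max_{\mathbf{f}_h\in\mathbf{X}_h,\ \mathbf{f}_h\ne0}\ \min_{\mathbf{p}_h\in\mathbf{RT}_h,\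 \mathbf{v}_h\in\mathbf{V}_h}\frac{\|\mathbf{p}_h-\nabla\mathbf{v}_h\|}{\|\mathbf{f}_h\|},$$ where the minimization over $\mathbf{p}_h$ is subject to the condition that $\mathrm{div}\,\mathbf{p}_h+\nabla\phi_h+\mathbf{f}_h=0$ for some $\phi_h\in U_h$. *)

theory Defs
  imports "HOL-Analysis.Analysis"
begin

section \<open>Polyhedral domains and tetrahedral meshes\<close>

text \<open>Near every boundary point the domain is, for a suitable axis \<open>e\<close>, the part of a ball
  below the graph of a Lipschitz function defined on the plane orthogonal to \<open>e\<close>.\<close>

definition lipschitz_boundary :: "(real^3) set \<Rightarrow> bool" where
  "lipschitz_boundary \<Omega> \<longleftrightarrow>
     (\<forall>z\<in>frontier \<Omega>. \<exists>r>0. \<exists>e L. \<exists>\<gamma> :: real^3 \<Rightarrow> real.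
        norm e = 1 \<and> L-lipschitz_on {y. y \<bullet> e = 0} \<gamma> \<and>
        \<Omega> \<inter> ball z r = {x \<in> ball z r. x \<bullet> e < \<gamma> (x - (x \<bullet> e) *\<^sub>R e)})"

definition lipschitz_polyhedral_domain :: "(real^3) set \<Rightarrow> bool" where
  "lipschitz_polyhedral_domain \<Omega> \<longleftrightarrow>
     \<Omega> \<noteq> {} \<and> open \<Omega> \<and> connected \<Omega> \<and> bounded \<Omega> \<and> lipschitz_boundary \<Omega> \<and>
     (\<exists>\<P>. finite \<P> \<and> (\<forall>P\<in>\<P>. polytope P) \<and> closure \<Omega> = \<Union>\<P>)"

text \<open>The library's \<^const>\<open>triangulation\<close> makes the mesh face-to-face: two cells meet in a common
  (possibly empty) face.\<close>

definition tetrahedral_mesh :: "(real^3) set \<Rightarrow> (real^3) set set \<Rightarrow> bool" where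
  "tetrahedral_mesh \<Omega> \<T> \<longleftrightarrow>
     triangulation \<T> \<and> (\<forall>K\<in>\<T>. 3 simplex K) \<and> \<Union>\<T> = closure \<Omega>"

section \<open>Square integrable functions\<close>

text \<open>Elements of the function spaces are represented by functions on the whole space, of which only
  the almost everywhere values on \<open>\<Omega>\<close> matter. On \<open>real^3\<close> and \<open>real^3^3\<close> the inner product is the
  componentwise (Frobenius) one.\<close>

definition L2 :: "(real^3) set \<Rightarrow> (real^3 \<Rightarrow> 'b::euclidean_space) set" where
  "L2 \<Omega> = {f \<in> borel_measurable (lebesgue_on \<Omega>).
             integrable (lebesgue_on \<Omega>) (\<lambda>x. (norm (f x))\<^sup>2)}"

definition l2_inner ::
    "(real^3) set \<Rightarrow> (real^3 \<Rightarrow> 'b::euclidean_space) \<Rightarrow> (real^3 \<Rightarrow> 'b) \<Rightarrow> real" where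
  "l2_inner \<Omega> f g = (LINT x|lebesgue_on \<Omega>. f x \<bullet> g x)"

definition l2_norm :: "(real^3) set \<Rightarrow> (real^3 \<Rightarrow> 'b::euclidean_space) \<Rightarrow> real" where
  "l2_norm \<Omega> f = sqrt (l2_inner \<Omega> f f)"

section \<open>Test functions and weak derivatives\<close>

definition partial_deriv :: "3 \<Rightarrow> (real^3 \<Rightarrow> real) \<Rightarrow> real^3 \<Rightarrow> real" where
  "partial_deriv i \<phi> x = frechet_derivative \<phi> (at x) (axis i 1)"

definition grad :: "(real^3 \<Rightarrow> real) \<Rightarrow> real^3 \<Rightarrow> real^3" where
  "grad \<phi> x = (\<chi> i. partial_deriv i \<phi> x)"

primrec times_differentiable :: "nat \<Rightarrow> (real^3 \<Rightarrow> real) \<Rightarrow> bool" where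
  "times_differentiable 0 \<phi> \<longleftrightarrow> continuous_on UNIV \<phi>"
| "times_differentiable (Suc n) \<phi> \<longleftrightarrow>
     (\<forall>x. \<phi> differentiable (at x)) \<and> (\<forall>i. times_differentiable n (partial_deriv i \<phi>))"

definition test_functions :: "(real^3) set \<Rightarrow> (real^3 \<Rightarrow> real) set" where
  "test_functions \<Omega> =
     {\<phi>. (\<forall>n. times_differentiable n \<phi>) \<and>
         compact (closure {x. \<phi> x \<noteq> 0}) \<and> closure {x. \<phi> x \<noteq> 0} \<subseteq> \<Omega>}"

definition is_weak_gradient ::
    "(real^3) set \<Rightarrow> (real^3 \<Rightarrow> real) \<Rightarrow> (real^3 \<Rightarrow> real^3) \<Rightarrow> bool" where
  "is_weak_gradient \<Omega> u g \<longleftrightarrow>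
     (\<forall>\<phi>\<in>test_functions \<Omega>. \<forall>i.
        l2_inner \<Omega> u (partial_deriv i \<phi>) = - l2_inner \<Omega> (\<lambda>x. g x $ i) \<phi>)"

definition is_weak_divergence ::
    "(real^3) set \<Rightarrow> (real^3 \<Rightarrow> real^3) \<Rightarrow> (real^3 \<Rightarrow> real) \<Rightarrow> bool" where
  "is_weak_divergence \<Omega> p q \<longleftrightarrow>
     (\<forall>\<phi>\<in>test_functions \<Omega>. l2_inner \<Omega> p (grad \<phi>) = - l2_inner \<Omega> q \<phi>)"

definition H1 :: "(real^3) set \<Rightarrow> (real^3 \<Rightarrow> real) set" where
  "H1 \<Omega> = {u \<in> L2 \<Omega>. \<exists>g\<in>L2 \<Omega>. is_weak_gradient \<Omega> u g}"

definition Hdiv :: "(real^3) set \<Rightarrow> (real^3 \<Rightarrow> real^3) set" where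
  "Hdiv \<Omega> = {p \<in> L2 \<Omega>. \<exists>q\<in>L2 \<Omega>. is_weak_divergence \<Omega> p q}"

text \<open>Weak derivatives are unique up to null sets, so the choices below are immaterial.\<close>

definition wgrad :: "(real^3) set \<Rightarrow> (real^3 \<Rightarrow> real) \<Rightarrow> real^3 \<Rightarrow> real^3" where
  "wgrad \<Omega> u = (SOME g. g \<in> L2 \<Omega> \<and> is_weak_gradient \<Omega> u g)"

definition wdiv :: "(real^3) set \<Rightarrow> (real^3 \<Rightarrow> real^3) \<Rightarrow> real^3 \<Rightarrow> real" where
  "wdiv \<Omega> p = (SOME q. q \<in> L2 \<Omega> \<and> is_weak_divergence \<Omega> p q)"

text \<open>Gradient of a vector field and divergence of a tensor field, row by row.\<close>

definition vgrad :: "(real^3) set \<Rightarrow> (real^3 \<Rightarrow> real^3) \<Rightarrow> real^3 \<Rightarrow> real^3^3" where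
  "vgrad \<Omega> v x = (\<chi> i. wgrad \<Omega> (\<lambda>y. v y $ i) x)"

definition tdiv :: "(real^3) set \<Rightarrow> (real^3 \<Rightarrow> real^3^3) \<Rightarrow> real^3 \<Rightarrow> real^3" where
  "tdiv \<Omega> p x = (\<chi> i. wdiv \<Omega> (\<lambda>y. p y $ i) x)"

definition H10 :: "(real^3) set \<Rightarrow> (real^3 \<Rightarrow> real) set" where
  "H10 \<Omega> = {u \<in> H1 \<Omega>. \<forall>\<epsilon>>0. \<exists>\<phi>\<in>test_functions \<Omega>.
               l2_norm \<Omega> (\<lambda>x. u x - \<phi> x) < \<epsilon> \<and> l2_norm \<Omega> (\<lambda>x. wgrad \<Omega> u x - grad \<phi> x) < \<epsilon>}"

definition V_space :: "(real^3) set \<Rightarrow> (real^3 \<Rightarrow> real^3) set" where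
  "V_space \<Omega> = {v. (\<forall>i. (\<lambda>x. v x $ i) \<in> H10 \<Omega>) \<and> (AE x in lebesgue_on \<Omega>. wdiv \<Omega> v x = 0)}"

section \<open>Finite element spaces\<close>

text \<open>Polynomials in three variables of total degree at most \<open>m\<close>; \<open>\<alpha>\<close> ranges over the
  (finitely many) multi-indices of order at most \<open>m\<close>.\<close>

definition polys :: "nat \<Rightarrow> (real^3 \<Rightarrow> real) set" where
  "polys m = {p. \<exists>c :: (3 \<Rightarrow> nat) \<Rightarrow> real.
      p = (\<lambda>x. \<Sum>\<alpha> | (\<Sum>i\<in>UNIV. \<alpha> i) \<le> m. c \<alpha> * (\<Prod>i\<in>UNIV. (x $ i) ^ \<alpha> i))}"

definition X_h :: "(real^3) set set \<Rightarrow> nat \<Rightarrow> (real^3 \<Rightarrow> real) set" where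
  "X_h \<T> d = {f. \<forall>K\<in>\<T>. \<exists>p\<in>polys d. AE x in lebesgue_on K. f x = p x}"

definition X_h_vec :: "(real^3) set set \<Rightarrow> nat \<Rightarrow> (real^3 \<Rightarrow> real^3) set" where
  "X_h_vec \<T> d = {f. \<forall>i. (\<lambda>x. f x $ i) \<in> X_h \<T> d}"

definition U_h :: "(real^3) set \<Rightarrow> (real^3) set set \<Rightarrow> nat \<Rightarrow> (real^3 \<Rightarrow> real) set" where
  "U_h \<Omega> \<T> k = H1 \<Omega> \<inter> X_h \<T> k"

text \<open>On a face-to-face mesh of a Lipschitz domain a piecewise polynomial in \<open>H1\<close> has a
  representative that is continuous up to the boundary; its boundary values are meant.\<close>

definition U_h0 :: "(real^3) set \<Rightarrow> (real^3) set set \<Rightarrow> nat \<Rightarrow> (real^3 \<Rightarrow> real) set" where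
  "U_h0 \<Omega> \<T> k = {u \<in> U_h \<Omega> \<T> k. \<exists>g. continuous_on (closure \<Omega>) g \<and>
      (AE x in lebesgue_on \<Omega>. u x = g x) \<and> (\<forall>x\<in>frontier \<Omega>. g x = 0)}"

definition V_h :: "(real^3) set \<Rightarrow> (real^3) set set \<Rightarrow> nat \<Rightarrow> (real^3 \<Rightarrow> real^3) set" where
  "V_h \<Omega> \<T> k = {v. (\<forall>i. (\<lambda>x. v x $ i) \<in> U_h0 \<Omega> \<T> k) \<and>
                   (AE x in lebesgue_on \<Omega>. wdiv \<Omega> v x = 0)}"

definition RT_h :: "(real^3) set \<Rightarrow> (real^3) set set \<Rightarrow> nat \<Rightarrow> (real^3 \<Rightarrow> real^3) set" where
  "RT_h \<Omega> \<T> m = {p \<in> Hdiv \<Omega>. \<forall>K\<in>\<T>. \<exists>a b. (\<forall>i. (\<lambda>x. a x $ i) \<in> polys m) \<and> b \<in> polys m \<and>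
      (AE x in lebesgue_on K. p x = a x + b x *\<^sub>R x)}"

definition RT_h_tensor :: "(real^3) set \<Rightarrow> (real^3) set set \<Rightarrow> nat \<Rightarrow> (real^3 \<Rightarrow> real^3^3) set" where
  "RT_h_tensor \<Omega> \<T> m = {p. \<forall>i. (\<lambda>x. p x $ i) \<in> RT_h \<Omega> \<T> m}"

section \<open>Projections, the Stokes problem and the error constant\<close>

definition is_V_projection ::
    "(real^3) set \<Rightarrow> (real^3) set set \<Rightarrow> nat \<Rightarrow> (real^3 \<Rightarrow> real^3) \<Rightarrow> (real^3 \<Rightarrow> real^3) \<Rightarrow> bool" where
  "is_V_projection \<Omega> \<T> k v w \<longleftrightarrow> w \<in> V_h \<Omega> \<T> k \<and>
     (\<forall>v\<^sub>h\<in>V_h \<Omega> \<T> k. l2_inner \<Omega> (vgrad \<Omega> (\<lambda>x. v x - w x)) (vgrad \<Omega> v\<^sub>h) = 0)"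

definition is_L2_projection ::
    "(real^3) set \<Rightarrow> (real^3) set set \<Rightarrow> nat \<Rightarrow> (real^3 \<Rightarrow> real^3) \<Rightarrow> (real^3 \<Rightarrow> real^3) \<Rightarrow> bool" where
  "is_L2_projection \<Omega> \<T> d f w \<longleftrightarrow> w \<in> X_h_vec \<T> d \<and>
     (\<forall>g\<in>X_h_vec \<T> d. l2_inner \<Omega> (\<lambda>x. f x - w x) g = 0)"

definition is_stokes_solution ::
    "(real^3) set \<Rightarrow> (real^3 \<Rightarrow> real^3) \<Rightarrow> (real^3 \<Rightarrow> real^3) \<Rightarrow> bool" where
  "is_stokes_solution \<Omega> f u \<longleftrightarrow> u \<in> V_space \<Omega> \<and>
     (\<forall>v\<in>V_space \<Omega>. l2_inner \<Omega> (vgrad \<Omega> u) (vgrad \<Omega> v) = l2_inner \<Omega> f v)"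

text \<open>Pairs \<open>(p, v)\<close> admissible in the minimization for the datum \<open>f\<close>.\<close>

definition kappa_admissible ::
    "(real^3) set \<Rightarrow> (real^3) set set \<Rightarrow> nat \<Rightarrow> nat \<Rightarrow> (real^3 \<Rightarrow> real^3) \<Rightarrow>
     ((real^3 \<Rightarrow> real^3^3) \<times> (real^3 \<Rightarrow> real^3)) set" where
  "kappa_admissible \<Omega> \<T> k m f =
     {p \<in> RT_h_tensor \<Omega> \<T> m. \<exists>\<phi>\<in>U_h \<Omega> \<T> k.
        AE x in lebesgue_on \<Omega>. tdiv \<Omega> p x + wgrad \<Omega> \<phi> x + f x = 0} \<times> V_h \<Omega> \<T> k"

text \<open>The max-min is taken in the extended nonnegative reals (minimum over the empty set
  \<open>= \<infinity>\<close>, unbounded supremum \<open>= \<infinity>\<close>), where it needs no well-definedness hypothesis; whenever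
  maximum and minima exist, this is their real value.\<close>

definition kappa_h :: "(real^3) set \<Rightarrow> (real^3) set set \<Rightarrow> nat \<Rightarrow> nat \<Rightarrow> nat \<Rightarrow> ennreal" where
  "kappa_h \<Omega> \<T> k d m =
     (SUP f \<in> {f \<in> X_h_vec \<T> d. \<not> (AE x in lebesgue_on \<Omega>. f x = 0)}.
      INF (p, v) \<in> kappa_admissible \<Omega> \<T> k m f.
        ennreal (l2_norm \<Omega> (\<lambda>x. p x - vgrad \<Omega> v x) / l2_norm \<Omega> f))"

definition sqrt_ennreal :: "ennreal \<Rightarrow> ennreal" where
  "sqrt_ennreal x = (if x = \<infinity> then \<infinity> else ennreal (sqrt (enn2real x)))"

definition C_h :: "(real^3) set \<Rightarrow> (real^3) set set \<Rightarrow> nat \<Rightarrow> nat \<Rightarrow> nat \<Rightarrow> real \<Rightarrow> ennreal" where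
  "C_h \<Omega> \<T> k d m C\<^sub>0 = sqrt_ennreal (ennreal (C\<^sub>0\<^sup>2) + (kappa_h \<Omega> \<T> k d m)\<^sup>2)"

end

theory Submission
  imports Defs "HOL-Computational_Algebra.Polynomial"
begin

text \<open>Write \<open>e = u - u\<^sub>h\<close>. Both estimates are instances of one inequality (\<open>duality_estimate\<close>),
  \<open>(g, e) \<le> sqrt (C\<^sub>0\<^sup>2 + \<kappa>\<^sup>2) \<cdot> \<parallel>g\<parallel> \<cdot> \<parallel>\<nabla>e\<parallel>\<close> for every square integrable \<open>g\<close>.
Since \<open>u\<^sub>h\<close> lies in \<open>V_h\<close>, to which \<open>\<nabla>e\<close> is orthogonal, and \<open>e\<close> is an admissible test field in the Stokes
equation, \<open>\<parallel>\<nabla>e\<parallel>\<^sup>2 = (\<nabla>u, \<nabla>e) = (f, e)\<close>; so \<open>g = f\<close> bounds the energy error by the datum, and \<open>g = e\<close> bounds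
the error by the energy error.

For the inequality split \<open>(g, e) = (g - \<pi>g, e - \<pi>e) + (\<pi>g, e)\<close> with the \<open>L2\<close> projection \<open>\<pi>\<close> onto piecewise
polynomials. The first term is at most \<open>\<parallel>g - \<pi>g\<parallel> \<cdot> C\<^sub>0 \<cdot> \<parallel>\<nabla>e\<parallel>\<close>. For the second take a pair \<open>(p, v)\<close> that competes
in the minimization defining \<open>\<kappa>\<close> for the datum \<open>\<pi>g\<close>, so \<open>div p + \<nabla>\<phi> + \<pi>g = 0\<close>. As \<open>e\<close> vanishes on the boundary and
is divergence free, \<open>(\<nabla>\<phi>, e) = 0\<close> and integration by parts gives \<open>(\<pi>g, e) = (p, \<nabla>e)\<close>
(\<open>kappa_admissible_duality\<close>); subtracting \<open>(\<nabla>v, \<nabla>e) = 0\<close> turns this into \<open>(p - \<nabla>v, \<nabla>e)\<close>, whose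
infimum over the pairs is at most \<open>\<kappa> \<cdot> \<parallel>\<pi>g\<parallel> \<cdot> \<parallel>\<nabla>e\<parallel>\<close>. The two bounds are combined by the theorem of Pythagoras,
\<open>\<parallel>g - \<pi>g\<parallel>\<^sup>2 + \<parallel>\<pi>g\<parallel>\<^sup>2 = \<parallel>g\<parallel>\<^sup>2\<close>, and the Cauchy-Schwarz inequality in the plane.

Most of the work lies in the facts on Sobolev spaces behind these few lines.
The operators \<open>wgrad\<close> and \<open>wdiv\<close> choose some weak derivative, so already the linearity of \<open>\<nabla>\<close> needs the uniqueness of weak
derivatives, i.e. a square integrable function orthogonal to all test functions vanishes
(\<open>orthogonal_to_tests_imp_0\<close>).
The space \<open>V_space\<close> asks for approximability by test functions, whereas the finite element space \<open>V_h\<close> prescribes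
boundary values of a continuous representative; the inclusion of the second in the first
(\<open>U_h0_subset_H10\<close>) is proved by truncating the small values of a mollified function.
Finally \<open>\<kappa>\<close> is an extended number; when it is infinite the estimates still say that \<open>\<nabla>e = 0\<close> forces \<open>e = 0\<close>, which is the
Poincare inequality, and that \<open>f = 0\<close> forces \<open>\<nabla>e = 0\<close>.\<close>

section \<open>Square integrable functions\<close>

lemma L2_measurable: "f \<in> L2 \<Omega> \<Longrightarrow> f \<in> borel_measurable (lebesgue_on \<Omega>)"
  by (simp add: L2_def)

lemma integrable_L2_inner:
  assumes "f \<in> L2 \<Omega>" "g \<in> L2 \<Omega>"
  shows "integrable (lebesgue_on \<Omega>) (\<lambda>x. f x \<bullet> g x)"
proof (rule Bochner_Integration.integrable_bound)
  show "integrable (lebesgue_on \<Omega>) (\<lambda>x. (norm (f x))\<^sup>2 + (norm (g x))\<^sup>2)"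
    using assms by (simp add: L2_def)
  show "(\<lambda>x. f x \<bullet> g x) \<in> borel_measurable (lebesgue_on \<Omega>)"
    using assms by (intro borel_measurable_inner L2_measurable)
  have "norm (f x \<bullet> g x) \<le> norm ((norm (f x))\<^sup>2 + (norm (g x))\<^sup>2)" for x
  proof -
    have "\<bar>f x \<bullet> g x\<bar> \<le> norm (f x) * norm (g x)"
      by (rule Cauchy_Schwarz_ineq2)
    also have "\<dots> \<le> (norm (f x))\<^sup>2 + (norm (g x))\<^sup>2"
    proof -
      have "2 * (norm (f x) * norm (g x)) \<le> (norm (f x))\<^sup>2 + (norm (g x))\<^sup>2"
        using sum_squares_bound[of "norm (f x)" "norm (g x)"] by (simp add: mult.assoc)
      moreover have "0 \<le> norm (f x) * norm (g x)" by simp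
      ultimately show ?thesis by linarith
    qed
    finally show ?thesis by simp
  qed
  then show "AE x in lebesgue_on \<Omega>. norm (f x \<bullet> g x) \<le> norm ((norm (f x))\<^sup>2 + (norm (g x))\<^sup>2)"
    by simp
qed

lemma integrable_L2_mult:
  fixes f g :: "real^3 \<Rightarrow> real"
  assumes "f \<in> L2 \<Omega>" "g \<in> L2 \<Omega>"
  shows "integrable (lebesgue_on \<Omega>) (\<lambda>x. f x * g x)"
  using integrable_L2_inner[OF assms] by simp

lemma L2_scale:
  assumes "f \<in> L2 \<Omega>"
  shows "(\<lambda>x. c *\<^sub>R f x) \<in> L2 \<Omega>"
  using assms by (auto simp: L2_def power_mult_distrib)

lemma L2_add:
  assumes "f \<in> L2 \<Omega>" "g \<in> L2 \<Omega>"
  shows "(\<lambda>x. f x + g x) \<in> L2 \<Omega>"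
proof -
  have "(\<lambda>x. (norm (f x + g x))\<^sup>2) = (\<lambda>x. (norm (f x))\<^sup>2 + 2 * (f x \<bullet> g x) + (norm (g x))\<^sup>2)"
    by (simp add: fun_eq_iff power2_norm_eq_inner algebra_simps inner_commute)
  moreover have "integrable (lebesgue_on \<Omega>) (\<lambda>x. (norm (f x))\<^sup>2 + 2 * (f x \<bullet> g x) + (norm (g x))\<^sup>2)"
    using assms integrable_L2_inner[OF assms] by (auto simp: L2_def)
  ultimately show ?thesis
    using borel_measurable_add[OF assms[THEN L2_measurable]] by (simp add: L2_def)
qed

lemma L2_diff:
  assumes "f \<in> L2 \<Omega>" "g \<in> L2 \<Omega>"
  shows "(\<lambda>x. f x - g x) \<in> L2 \<Omega>"
  using L2_add[OF assms(1) L2_scale[OF assms(2), of "-1"]] by simp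

lemma L2_sum:
  assumes "finite I" "\<And>i. i \<in> I \<Longrightarrow> f i \<in> L2 \<Omega>"
  shows "(\<lambda>x. \<Sum>i\<in>I. f i x) \<in> L2 \<Omega>"
  using assms
proof (induction I rule: finite_induct)
  case empty
  show ?case by (simp add: L2_def)
next
  case (insert i I)
  then show ?case using L2_add[of "f i" \<Omega> "\<lambda>x. \<Sum>i\<in>I. f i x"] by simp
qed

lemma L2_component:
  fixes f :: "real^3 \<Rightarrow> 'b::euclidean_space^3"
  assumes "f \<in> L2 \<Omega>"
  shows "(\<lambda>x. f x $ i) \<in> L2 \<Omega>"
proof -
  have m: "(\<lambda>x. f x $ i) \<in> borel_measurable (lebesgue_on \<Omega>)"
    using borel_measurable_continuous_onI[OF continuous_on_component[OF continuous_on_id], of i]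
      L2_measurable[OF assms] by (rule measurable_compose_rev) 
  moreover have "integrable (lebesgue_on \<Omega>) (\<lambda>x. (norm (f x $ i))\<^sup>2)"
  proof (rule Bochner_Integration.integrable_bound)
    show "integrable (lebesgue_on \<Omega>) (\<lambda>x. (norm (f x))\<^sup>2)"
      using assms by (simp add: L2_def)
    show "(\<lambda>x. (norm (f x $ i))\<^sup>2) \<in> borel_measurable (lebesgue_on \<Omega>)"
      using m by measurable
    show "AE x in lebesgue_on \<Omega>. norm ((norm (f x $ i))\<^sup>2) \<le> norm ((norm (f x))\<^sup>2)"
      by (simp add: Finite_Cartesian_Product.norm_nth_le power_mono)
  qed
  ultimately show ?thesis by (simp add: L2_def)
qed

lemma L2_axis:
  fixes f :: "real^3 \<Rightarrow> 'b::euclidean_space" and i :: 3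
  assumes "f \<in> L2 \<Omega>"
  shows "(\<lambda>x. axis i (f x)) \<in> L2 \<Omega>"
proof -
  have "bounded_linear (axis i :: 'b \<Rightarrow> 'b^3)"
    by (rule linear_conv_bounded_linear[THEN iffD1], rule linearI) 
       (auto simp: axis_def vec_eq_iff)
  then have "(axis i :: 'b \<Rightarrow> 'b^3) \<in> borel_measurable borel"
    by (intro borel_measurable_continuous_onI linear_continuous_on)
  then have "(\<lambda>x. axis i (f x)) \<in> borel_measurable (lebesgue_on \<Omega>)"
    using L2_measurable[OF assms] by (rule measurable_compose_rev)
  moreover have "norm (axis i y) = norm y" for y :: 'b
    by (simp add: norm_eq_sqrt_inner inner_axis)
  ultimately show ?thesis using assms by (simp add: L2_def)
qed

lemma L2_vec:
  fixes f :: "real^3 \<Rightarrow> 'b::euclidean_space^3"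
  assumes "\<And>i. (\<lambda>x. f x $ i) \<in> L2 \<Omega>"
  shows "f \<in> L2 \<Omega>"
proof -
  have "f = (\<lambda>x. \<Sum>i\<in>UNIV. axis i (f x $ i))"
    by (simp add: fun_eq_iff vec_eq_iff axis_def)
  moreover have "(\<lambda>x. \<Sum>i\<in>UNIV. axis i (f x $ i)) \<in> L2 \<Omega>"
    by (intro L2_sum L2_axis assms) simp
  ultimately show ?thesis by simp
qed

lemma l2_inner_commute: "l2_inner \<Omega> f g = l2_inner \<Omega> g f"
  by (simp add: l2_inner_def inner_commute)

lemma l2_inner_add_left:
  assumes "f \<in> L2 \<Omega>" "g \<in> L2 \<Omega>" "h \<in> L2 \<Omega>"
  shows "l2_inner \<Omega> (\<lambda>x. f x + g x) h = l2_inner \<Omega> f h + l2_inner \<Omega> g h"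
  using assms by (simp add: l2_inner_def inner_add_left integrable_L2_inner)

lemma l2_inner_diff_left:
  assumes "f \<in> L2 \<Omega>" "g \<in> L2 \<Omega>" "h \<in> L2 \<Omega>"
  shows "l2_inner \<Omega> (\<lambda>x. f x - g x) h = l2_inner \<Omega> f h - l2_inner \<Omega> g h"
  using assms by (simp add: l2_inner_def inner_diff_left integrable_L2_inner)

lemma l2_inner_diff_right:
  assumes "f \<in> L2 \<Omega>" "g \<in> L2 \<Omega>" "h \<in> L2 \<Omega>"
  shows "l2_inner \<Omega> h (\<lambda>x. f x - g x) = l2_inner \<Omega> h f - l2_inner \<Omega> h g"
  using l2_inner_diff_left[OF assms] by (simp add: l2_inner_commute)

lemma l2_inner_scale_left: "l2_inner \<Omega> (\<lambda>x. c *\<^sub>R f x) h = c * l2_inner \<Omega> f h"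
  by (simp add: l2_inner_def)

lemma l2_inner_cong_AE:
  assumes "f \<in> L2 \<Omega>" "f' \<in> L2 \<Omega>" "g \<in> L2 \<Omega>" "g' \<in> L2 \<Omega>"
    and "AE x in lebesgue_on \<Omega>. f x = f' x" "AE x in lebesgue_on \<Omega>. g x = g' x"
  shows "l2_inner \<Omega> f g = l2_inner \<Omega> f' g'"
  unfolding l2_inner_def
  using assms by (intro integral_cong_AE borel_measurable_inner L2_measurable) auto

lemma l2_inner_components:
  fixes f g :: "real^3 \<Rightarrow> 'b::euclidean_space^3"
  assumes "f \<in> L2 \<Omega>" "g \<in> L2 \<Omega>"
  shows "l2_inner \<Omega> f g = (\<Sum>i\<in>UNIV. l2_inner \<Omega> (\<lambda>x. f x $ i) (\<lambda>x. g x $ i))"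
  unfolding l2_inner_def inner_vec_def
  by (intro Bochner_Integration.integral_sum integrable_L2_inner L2_component assms)

lemma l2_inner_self_nonneg: "0 \<le> l2_inner \<Omega> f f"
  by (simp add: l2_inner_def)

lemma l2_norm_nonneg: "0 \<le> l2_norm \<Omega> f"
  by (simp add: l2_norm_def l2_inner_self_nonneg)

lemma l2_norm_square: "(l2_norm \<Omega> f)\<^sup>2 = l2_inner \<Omega> f f"
  by (simp add: l2_norm_def l2_inner_self_nonneg)

lemma l2_norm_cong_AE:
  assumes "f \<in> L2 \<Omega>" "g \<in> L2 \<Omega>" "AE x in lebesgue_on \<Omega>. f x = g x"
  shows "l2_norm \<Omega> f = l2_norm \<Omega> g"
  unfolding l2_norm_def using l2_inner_cong_AE[OF assms(1,2,1,2,3,3)] by simp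

lemma l2_norm_scale: "l2_norm \<Omega> (\<lambda>x. c *\<^sub>R f x) = \<bar>c\<bar> * l2_norm \<Omega> f"
  by (simp add: l2_norm_def l2_inner_def real_sqrt_mult flip: mult.assoc power2_eq_square)

text \<open>Members of \<open>L2\<close> are functions, not classes, so the norm is only a seminorm; this is the bridge from vanishing norms
to statements almost everywhere.\<close>

lemma l2_norm_eq_0_iff:
  assumes "f \<in> L2 \<Omega>"
  shows "l2_norm \<Omega> f = 0 \<longleftrightarrow> (AE x in lebesgue_on \<Omega>. f x = 0)"
proof -
  have "l2_norm \<Omega> f = 0 \<longleftrightarrow> (LINT x|lebesgue_on \<Omega>. f x \<bullet> f x) = 0"
    by (simp add: l2_norm_def l2_inner_def)
  also have "\<dots> \<longleftrightarrow> (AE x in lebesgue_on \<Omega>. f x \<bullet> f x = 0)"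
    by (rule integral_nonneg_eq_0_iff_AE) (simp_all add: integrable_L2_inner assms)
  finally show ?thesis by simp
qed

lemma l2_inner_Cauchy_Schwarz:
  assumes f: "f \<in> L2 \<Omega>" and g: "g \<in> L2 \<Omega>"
  shows "\<bar>l2_inner \<Omega> f g\<bar> \<le> l2_norm \<Omega> f * l2_norm \<Omega> g"
proof -
  let ?a = "l2_inner \<Omega> f f" and ?b = "l2_inner \<Omega> f g" and ?c = "l2_inner \<Omega> g g"
  have quad: "0 \<le> ?a - 2 * t * ?b + t\<^sup>2 * ?c" for t
  proof -
    have "0 \<le> l2_inner \<Omega> (\<lambda>x. f x - t *\<^sub>R g x) (\<lambda>x. f x - t *\<^sub>R g x)"
      by (rule l2_inner_self_nonneg)
    also have "\<dots> = (LINT x|lebesgue_on \<Omega>. f x \<bullet> f x - 2 * t * (f x \<bullet> g x) + t\<^sup>2 * (g x \<bullet> g x))"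
      unfolding l2_inner_def
      by (intro Bochner_Integration.integral_cong) 
         (auto simp: algebra_simps inner_commute power2_eq_square)
    also have "\<dots> = ?a - 2 * t * ?b + t\<^sup>2 * ?c"
      by (simp add: l2_inner_def integrable_L2_inner f g)
    finally show ?thesis .
  qed
  have "?b\<^sup>2 \<le> ?a * ?c"
  proof (cases "?c = 0")
    case True
    \<comment> \<open>The quadratic in \<open>t\<close> degenerates to the affine function \<open>?a - 2 * t * ?b\<close>, which a nonzero slope
      would make negative somewhere.\<close>
    have "?b = 0"
    proof (rule ccontr)
      assume "?b \<noteq> 0"
      then show False
        using quad[of "(?a + 1) / (2 * ?b)"] True by (simp add: field_simps)
    qed
    then show ?thesis using True by simp
  next
    case False
    then have "?c > 0" using l2_inner_self_nonneg[of \<Omega> g] by simp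
    have "0 \<le> ?c * (?a - 2 * (?b / ?c) * ?b + (?b / ?c)\<^sup>2 * ?c)"
      using \<open>?c > 0\<close> quad[of "?b / ?c"] by (intro mult_nonneg_nonneg) (simp_all del: times_divide_eq_right)
    also have "\<dots> = ?a * ?c - ?b\<^sup>2"
      using False by (simp add: field_simps power2_eq_square)
    finally show ?thesis by simp
  qed
  then have "\<bar>?b\<bar> \<le> sqrt (?a * ?c)"
    by (simp add: real_le_rsqrt)
  then show ?thesis
    by (simp add: l2_norm_def real_sqrt_mult)
qed

lemma l2_norm_triangle:
  assumes f: "f \<in> L2 \<Omega>" and g: "g \<in> L2 \<Omega>"
  shows "l2_norm \<Omega> (\<lambda>x. f x + g x) \<le> l2_norm \<Omega> f + l2_norm \<Omega> g"
proof (rule power2_le_imp_le)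
  have "(l2_norm \<Omega> (\<lambda>x. f x + g x))\<^sup>2 = l2_inner \<Omega> f f + 2 * l2_inner \<Omega> f g + l2_inner \<Omega> g g"
    unfolding l2_norm_square
    using f g l2_inner_add_left[OF f g L2_add[OF f g]]
      l2_inner_add_left[OF f g f] l2_inner_add_left[OF f g g]
    by (simp add: l2_inner_commute)
  also have "\<dots> \<le> (l2_norm \<Omega> f + l2_norm \<Omega> g)\<^sup>2"
    using l2_inner_Cauchy_Schwarz[OF f g] by (simp add: power2_sum l2_norm_square)
  finally show "(l2_norm \<Omega> (\<lambda>x. f x + g x))\<^sup>2 \<le> (l2_norm \<Omega> f + l2_norm \<Omega> g)\<^sup>2" .
  show "0 \<le> l2_norm \<Omega> f + l2_norm \<Omega> g" by (simp add: l2_norm_nonneg)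
qed

text \<open>On a set of finite measure the square of a bounded function is dominated by a constant.\<close>

lemma L2_bounded:
  assumes "\<Omega> \<in> lmeasurable" "f \<in> borel_measurable (lebesgue_on \<Omega>)"
    and "AE x in lebesgue_on \<Omega>. norm (f x) \<le> B"
  shows "f \<in> L2 \<Omega>"
proof -
  interpret finite_measure "lebesgue_on \<Omega>"
    by (rule finite_measure_lebesgue_on) (fact assms)
  have "integrable (lebesgue_on \<Omega>) (\<lambda>x. (norm (f x))\<^sup>2)"
  proof (rule integrable_const_bound[where B="B\<^sup>2"])
    show "AE x in lebesgue_on \<Omega>. norm ((norm (f x))\<^sup>2) \<le> B\<^sup>2"
      using assms(3) by eventually_elim (simp add: power_mono)
    show "(\<lambda>x. (norm (f x))\<^sup>2) \<in> borel_measurable (lebesgue_on \<Omega>)"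
      using assms(2) by measurable
  qed
  then show ?thesis using assms(2) by (simp add: L2_def)
qed

text \<open>On a set of finite measure \<open>\<bar>f\<bar>\<close> is dominated by the integrable function \<open>1 + \<bar>f\<bar>\<^sup>2\<close>.\<close>

lemma L2_integrable:
  assumes "\<Omega> \<in> lmeasurable" "f \<in> L2 \<Omega>"
  shows "integrable (lebesgue_on \<Omega>) f"
proof (rule Bochner_Integration.integrable_bound)
  interpret finite_measure "lebesgue_on \<Omega>"
    by (rule finite_measure_lebesgue_on) (fact assms)
  show "integrable (lebesgue_on \<Omega>) (\<lambda>x. 1 + (norm (f x))\<^sup>2)"
    using assms by (simp add: L2_def)
  show "f \<in> borel_measurable (lebesgue_on \<Omega>)" using assms by (simp add: L2_def)
  have "norm (f x) \<le> norm (1 + (norm (f x))\<^sup>2)" for x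
  proof -
    have "2 * norm (f x) \<le> 1 + (norm (f x))\<^sup>2"
      using sum_squares_bound[of 1 "norm (f x)"] by simp
    then show ?thesis using norm_ge_zero[of "f x"] by (simp del: norm_ge_zero)
  qed
  then show "AE x in lebesgue_on \<Omega>. norm (f x) \<le> norm (1 + (norm (f x))\<^sup>2)" by simp
qed

section \<open>Calculus of smooth functions\<close>

definition smooth :: "(real^3 \<Rightarrow> real) \<Rightarrow> bool" where
  "smooth \<phi> \<longleftrightarrow> (\<forall>n. times_differentiable n \<phi>)"

lemma partial_deriv_eq:
  assumes "(\<phi> has_derivative D) (at x)"
  shows "partial_deriv i \<phi> x = D (axis i 1)"
  using frechet_derivative_at[OF assms] by (simp add: partial_deriv_def)

text \<open>Reduces the recursive clause, which is phrased with \<^const>\<open>frechet_derivative\<close>, to any derivative computed by the usual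
differentiation rules.\<close>

lemma times_differentiable_SucI:
  assumes "\<And>x. (\<phi> has_derivative D x) (at x)"
    and "\<And>i. times_differentiable n (\<lambda>x. D x (axis i 1))"
  shows "times_differentiable (Suc n) \<phi>"
proof -
  have "partial_deriv i \<phi> = (\<lambda>x. D x (axis i 1))" for i
    using partial_deriv_eq[OF assms(1)] by (simp add: fun_eq_iff)
  then show ?thesis
    using assms by (auto simp: differentiable_def)
qed

lemma times_differentiable_Suc_D: "times_differentiable (Suc n) \<phi> \<Longrightarrow> times_differentiable n \<phi>"
proof (induction n arbitrary: \<phi>)
  case 0
  then show ?case
    by (auto intro!: continuous_at_imp_continuous_on differentiable_imp_continuous_within)
next
  case (Suc n)
  then show ?case by (metis times_differentiable.simps(2))
qed

lemma times_differentiable_has_derivative: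
  assumes "times_differentiable (Suc n) \<phi>"
  shows "(\<phi> has_derivative frechet_derivative \<phi> (at x)) (at x)"
  using assms by (simp add: frechet_derivative_works)

lemma times_differentiable_const: "times_differentiable n (\<lambda>x. c)"
proof (induction n arbitrary: c)
  case (Suc n)
  show ?case
    by (rule times_differentiable_SucI[where D="\<lambda>x h. 0"]) (auto intro: Suc)
qed simp

lemma times_differentiable_coordinate: "times_differentiable n (\<lambda>x. x $ i)"
proof (cases n)
  case (Suc k)
  show ?thesis unfolding Suc
    by (rule times_differentiable_SucI[where D="\<lambda>x h. h $ i"])
       (auto intro!: times_differentiable_const bounded_linear_imp_has_derivative)
qed (simp add: continuous_on_component)

lemma times_differentiable_add:
  "times_differentiable n f \<Longrightarrow> times_differentiable n g \<Longrightarrow> times_differentiable n (\<lambda>x. f x + g x)"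
proof (induction n arbitrary: f g)
  case (Suc n)
  show ?case
  proof (rule times_differentiable_SucI)
    show "((\<lambda>x. f x + g x) has_derivative (\<lambda>h. frechet_derivative f (at x) h + frechet_derivative g (at x) h)) (at x)" for x
      by (intro has_derivative_add times_differentiable_has_derivative[of n] Suc.prems)
    show "times_differentiable n (\<lambda>x. frechet_derivative f (at x) (axis i 1) + frechet_derivative g (at x) (axis i 1))" for i
      using Suc.IH[of "partial_deriv i f" "partial_deriv i g"] Suc.prems
      by (simp add: partial_deriv_def[abs_def])
  qed
qed (auto intro: continuous_on_add)

lemma times_differentiable_mult:
  "times_differentiable n f \<Longrightarrow> times_differentiable n g \<Longrightarrow> times_differentiable n (\<lambda>x. f x * g x)"
proof (induction n arbitrary: f g)
  case (Suc n)
  show ?case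
  proof (rule times_differentiable_SucI)
    show "((\<lambda>x. f x * g x) has_derivative (\<lambda>h. f x * frechet_derivative g (at x) h + frechet_derivative f (at x) h * g x)) (at x)" for x
      by (intro has_derivative_mult times_differentiable_has_derivative[of n] Suc.prems)
    show "times_differentiable n (\<lambda>x. f x * frechet_derivative g (at x) (axis i 1) + frechet_derivative f (at x) (axis i 1) * g x)" for i
      using Suc.IH[of f "partial_deriv i g"] Suc.IH[of "partial_deriv i f" g] Suc.prems
        times_differentiable_Suc_D[OF Suc.prems(1)] times_differentiable_Suc_D[OF Suc.prems(2)]
      by (intro times_differentiable_add) (simp_all add: partial_deriv_def[abs_def])
  qed
qed (auto intro: continuous_on_mult)

lemma smooth_const: "smooth (\<lambda>x. c)"
  and smooth_coordinate: "smooth (\<lambda>x. x $ i)"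
  by (simp_all add: smooth_def times_differentiable_const times_differentiable_coordinate)

lemma smooth_add: "smooth f \<Longrightarrow> smooth g \<Longrightarrow> smooth (\<lambda>x. f x + g x)"
  and smooth_mult: "smooth f \<Longrightarrow> smooth g \<Longrightarrow> smooth (\<lambda>x. f x * g x)"
  by (simp_all add: smooth_def times_differentiable_add times_differentiable_mult)

lemma smooth_diff: "smooth f \<Longrightarrow> smooth g \<Longrightarrow> smooth (\<lambda>x. f x - g x)"
  using smooth_add[OF _ smooth_mult[OF smooth_const[of "-1"]], of f g] by simp

lemma smooth_power: "smooth f \<Longrightarrow> smooth (\<lambda>x. f x ^ n)"
  by (induction n) (auto intro: smooth_const smooth_mult)

lemma smooth_sum: "finite I \<Longrightarrow> (\<And>i. i \<in> I \<Longrightarrow> smooth (f i)) \<Longrightarrow> smooth (\<lambda>x. \<Sum>i\<in>I. f i x)"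
  by (induction I rule: finite_induct) (auto intro: smooth_const smooth_add)

lemma smooth_prod: "finite I \<Longrightarrow> (\<And>i. i \<in> I \<Longrightarrow> smooth (f i)) \<Longrightarrow> smooth (\<lambda>x. \<Prod>i\<in>I. f i x)"
  by (induction I rule: finite_induct) (auto intro: smooth_const smooth_mult)

lemma smooth_inner_self: "smooth (\<lambda>x. (x - a) \<bullet> (x - a))"
  unfolding inner_vec_def
  by (simp, intro smooth_sum smooth_mult smooth_diff smooth_const smooth_coordinate) simp_all

lemma finite_multi_indices: "finite {\<alpha> :: 3 \<Rightarrow> nat. (\<Sum>i\<in>UNIV. \<alpha> i) \<le> m}"
proof (rule finite_subset)
  show "{\<alpha> :: 3 \<Rightarrow> nat. (\<Sum>i\<in>UNIV. \<alpha> i) \<le> m} \<subseteq> PiE UNIV (\<lambda>_. {..m})"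
  proof
    fix \<alpha> :: "3 \<Rightarrow> nat" assume "\<alpha> \<in> {\<alpha>. (\<Sum>i\<in>UNIV. \<alpha> i) \<le> m}"
    then have "\<alpha> i \<le> m" for i
      using member_le_sum[of i UNIV \<alpha>] by simp
    then show "\<alpha> \<in> PiE UNIV (\<lambda>_. {..m})" by (simp add: PiE_iff)
  qed
qed (simp add: finite_PiE)

lemma smooth_polys:
  assumes "p \<in> polys m"
  shows "smooth p"
proof -
  from assms obtain c :: "(3 \<Rightarrow> nat) \<Rightarrow> real" where
    p: "p = (\<lambda>x. \<Sum>\<alpha> | (\<Sum>i\<in>UNIV. \<alpha> i) \<le> m. c \<alpha> * (\<Prod>i\<in>UNIV. (x $ i) ^ \<alpha> i))"
    by (auto simp: polys_def)
  show ?thesis unfolding p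
    by (intro smooth_sum smooth_mult smooth_const smooth_prod smooth_power smooth_coordinate
        finite_multi_indices finite)
qed

lemma smooth_continuous: "smooth f \<Longrightarrow> continuous_on S f"
  by (metis continuous_on_subset smooth_def subset_UNIV times_differentiable.simps(1))

lemma smooth_has_derivative: "smooth f \<Longrightarrow> (f has_derivative frechet_derivative f (at x)) (at x)"
  using times_differentiable_has_derivative smooth_def by blast

lemma smooth_partial_deriv: "smooth f \<Longrightarrow> smooth (partial_deriv i f)"
  unfolding smooth_def by (metis times_differentiable.simps(2))

lemma partial_deriv_mult:
  assumes "smooth f" "smooth g"
  shows "partial_deriv i (\<lambda>x. f x * g x) = (\<lambda>x. f x * partial_deriv i g x + partial_deriv i f x * g x)"
proof
  fix x
  have "((\<lambda>x. f x * g x) has_derivative (\<lambda>h. f x * frechet_derivative g (at x) h + frechet_derivative f (at x) h * g x)) (at x)"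
    by (intro has_derivative_mult smooth_has_derivative assms)
  then show "partial_deriv i (\<lambda>x. f x * g x) x = f x * partial_deriv i g x + partial_deriv i f x * g x"
    by (simp add: partial_deriv_eq) (simp add: partial_deriv_def)
qed

lemma partial_deriv_coordinate: "partial_deriv i (\<lambda>x. x $ i) = (\<lambda>x. 1)"
proof
  fix x :: "real^3"
  have "((\<lambda>x. x $ i) has_derivative (\<lambda>h. h $ i)) (at x)"
    by (intro bounded_linear_imp_has_derivative bounded_linear_vec_nth)
  then show "partial_deriv i (\<lambda>x. x $ i) x = 1"
    by (simp add: partial_deriv_eq)
qed

lemma partial_deriv_reflect:
  assumes "smooth f"
  shows "partial_deriv i (\<lambda>y. f (x - y)) = (\<lambda>y. - partial_deriv i f (x - y))"
proof
  fix y
  have "((\<lambda>y. f (x - y)) has_derivative (\<lambda>h. frechet_derivative f (at (x - y)) (0 - h))) (at y)"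
    by (rule has_derivative_compose[OF _ smooth_has_derivative[OF assms]])
       (intro derivative_intros)
  moreover have "linear (frechet_derivative f (at (x - y)))"
    using smooth_has_derivative[OF assms] has_derivative_linear by blast
  ultimately show "partial_deriv i (\<lambda>y. f (x - y)) y = - partial_deriv i f (x - y)"
    by (simp add: partial_deriv_eq) (simp add: partial_deriv_def linear_neg)
qed

lemma smooth_reflect: "smooth f \<Longrightarrow> smooth (\<lambda>y. f (x - y))"
proof -
  have "smooth f \<Longrightarrow> times_differentiable n (\<lambda>y. f (x - y))" for n
  proof (induction n arbitrary: f)
    case 0
    have "continuous_on UNIV f" using 0 by (rule smooth_continuous)
    then show ?case
      by (auto intro!: continuous_intros continuous_on_compose2[of UNIV f])
  next
    case (Suc n)
    have "((\<lambda>y. f (x - y)) has_derivative (\<lambda>h. frechet_derivative f (at (x - y)) (0 - h))) (at y)" for y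
      by (rule has_derivative_compose[OF _ smooth_has_derivative[OF Suc.prems]])
         (intro derivative_intros)
    then have "(\<lambda>y. f (x - y)) differentiable (at y)" for y
      by (auto simp: differentiable_def)
    moreover have "times_differentiable n (\<lambda>y. (-1) * partial_deriv i f (x - y))" for i
      by (intro times_differentiable_mult times_differentiable_const Suc smooth_partial_deriv)
    ultimately show ?case
      by (simp add: partial_deriv_reflect[OF Suc.prems])
  qed
  then show "smooth f \<Longrightarrow> smooth (\<lambda>y. f (x - y))" by (simp add: smooth_def)
qed

section \<open>Smooth functions that vanish on half-lines\<close>

text \<open>The functions \<open>p (1/t) exp (-1/t)\<close>, extended by \<open>0\<close> to \<open>t \<le> 0\<close>, for polynomials \<open>p\<close>. Admitting all \<open>p\<close> makes
the family closed under differentiation, so that smoothness follows by induction on the order. The case \<open>p = 1\<close> serves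
twice: for the kernel of the mollification and for the truncation of small values.\<close>

definition flat_exp :: "real poly \<Rightarrow> real \<Rightarrow> real" where
  "flat_exp p t = (if t \<le> 0 then 0 else poly p (1 / t) * exp (- (1 / t)))"

lemma flat_exp_tendsto_0:
  fixes p :: "real poly"
  shows "((\<lambda>t. poly p (1 / t) * exp (- (1 / t))) \<longlongrightarrow> 0) (at_right 0)"
proof -
  have "((\<lambda>x. poly p x * exp (- x)) \<longlongrightarrow> 0) at_top"
  proof (induction p)
    case 0 then show ?case by simp
  next
    case (pCons a p)
    show ?case
    proof -
      have e: "((\<lambda>x::real. exp (-x)) \<longlongrightarrow> 0) at_top" using tendsto_power_div_exp_0[of 0] by (simp add: exp_minus divide_inverse)
      have "((\<lambda>x. x ^ n * exp (- x)) \<longlongrightarrow> (0::real)) at_top" for n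
        using tendsto_power_div_exp_0[of n] by (simp add: exp_minus divide_inverse)
      then have "((\<lambda>x. \<Sum>i\<le>degree (pCons a p). coeff (pCons a p) i * (x ^ i * exp (- x))) \<longlongrightarrow> (\<Sum>i\<le>degree (pCons a p). coeff (pCons a p) i * 0)) at_top"
        by (intro tendsto_sum tendsto_mult tendsto_const)
      then show ?thesis
        by (simp add: poly_altdef sum_distrib_right mult.assoc del: coeff_pCons degree_pCons_eq_if)
    qed
  qed
  then have "filterlim ((\<lambda>x. poly p x * exp (- x)) \<circ> inverse) (nhds 0) (at_right 0)"
    unfolding comp_def by (rule filterlim_compose) (rule filterlim_inverse_at_top_right)
  then show ?thesis by (simp add: comp_def divide_inverse)
qed

text \<open>For positive \<open>t\<close> the chain rule replaces \<open>p\<close> by \<open>X\<^sup>2 (p - p')\<close>. At \<open>0\<close> the right difference quotient is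
\<open>(1/t) p (1/t) exp (-1/t)\<close>, again a member of the family with limit \<open>0\<close>.\<close>

lemma flat_exp_has_derivative:
  "(flat_exp p has_real_derivative flat_exp (monom 1 2 * (p - pderiv p)) t) (at t)"
proof -
  consider "t < 0" | "t > 0" | "t = 0" by linarith
  then show ?thesis
  proof cases
    case 1
    have "((\<lambda>_. 0::real) has_real_derivative 0) (at t)" by simp
    then have "(flat_exp p has_real_derivative 0) (at t)"
      by (rule has_field_derivative_transform_within_open[where S="{..<0}"])
         (use 1 in \<open>auto simp: flat_exp_def\<close>)
    then show ?thesis using 1 by (simp add: flat_exp_def)
  next
    case 2
    have "((\<lambda>t. poly p (1 / t) * exp (- (1 / t))) has_real_derivative
        poly (monom 1 2 * (p - pderiv p)) (1 / t) * exp (- (1 / t))) (at t)"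
      using 2 by (auto intro!: derivative_eq_intros DERIV_chain2[OF poly_DERIV] 
          simp: poly_monom field_simps power2_eq_square)
    then have "(flat_exp p has_real_derivative poly (monom 1 2 * (p - pderiv p)) (1 / t) * exp (- (1 / t))) (at t)"
      by (rule has_field_derivative_transform_within_open[where S="{0<..}"])
         (use 2 in \<open>auto simp: flat_exp_def\<close>)
    then show ?thesis using 2 by (simp add: flat_exp_def)
  next
    case 3
    have "((\<lambda>y. (flat_exp p y - flat_exp p 0) / (y - 0)) \<longlongrightarrow> 0) (at_left 0)"
      by (rule tendsto_eventually) (auto simp: flat_exp_def eventually_at_filter)
    moreover have "((\<lambda>y. (flat_exp p y - flat_exp p 0) / (y - 0)) \<longlongrightarrow> 0) (at_right 0)"
    proof (rule Lim_transform_eventually[OF flat_exp_tendsto_0[of "monom 1 1 * p"]])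
      show "\<forall>\<^sub>F y in at_right 0. poly (monom 1 1 * p) (1 / y) * exp (- (1 / y)) =
          (flat_exp p y - flat_exp p 0) / (y - 0)"
        by (auto simp: flat_exp_def eventually_at_filter poly_monom)
    qed
    ultimately have "((\<lambda>y. (flat_exp p y - flat_exp p 0) / (y - 0)) \<longlongrightarrow> 0) (at 0)"
      by (simp add: filterlim_split_at)
    then show ?thesis
      using 3 by (simp add: has_field_derivative_iff flat_exp_def)
  qed
qed

lemma flat_exp_compose_has_derivative:
  assumes "smooth \<psi>"
  shows "((\<lambda>x. flat_exp p (\<psi> x)) has_derivative
      (\<lambda>h. flat_exp (monom 1 2 * (p - pderiv p)) (\<psi> x) * frechet_derivative \<psi> (at x) h)) (at x)"
  using has_derivative_compose[OF smooth_has_derivative[OF assms], of "flat_exp p" "(*) (flat_exp (monom 1 2 * (p - pderiv p)) (\<psi> x))" x]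
    flat_exp_has_derivative[of p "\<psi> x"]
  by (simp add: has_field_derivative_def)

lemma smooth_flat_exp:
  assumes "smooth \<psi>"
  shows "smooth (\<lambda>x. flat_exp p (\<psi> x))"
proof -
  have "times_differentiable n (\<lambda>x. flat_exp p (\<psi> x))" for n
  proof (induction n arbitrary: p)
    case 0
    have "continuous_on UNIV (flat_exp p)"
      using flat_exp_has_derivative[of p] by (intro continuous_at_imp_continuous_on) (blast intro: DERIV_isCont)
    then show ?case
      using continuous_on_compose2[of UNIV "flat_exp p" UNIV \<psi>] smooth_continuous[OF assms] by simp
  next
    case (Suc n)
    show ?case
    proof (rule times_differentiable_SucI[OF flat_exp_compose_has_derivative[OF assms]])
      fix i
      have "times_differentiable n (\<lambda>x. flat_exp (monom 1 2 * (p - pderiv p)) (\<psi> x) * partial_deriv i \<psi> x)"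
        using smooth_partial_deriv[OF assms] by (intro times_differentiable_mult Suc) (simp add: smooth_def)
      then show "times_differentiable n (\<lambda>x. flat_exp (monom 1 2 * (p - pderiv p)) (\<psi> x) * frechet_derivative \<psi> (at x) (axis i 1))"
        by (simp add: partial_deriv_def)
    qed
  qed
  then show ?thesis by (simp add: smooth_def)
qed

section \<open>Convolution with a smooth kernel\<close>

lemma smooth_has_derivative_partial:
  assumes "smooth f"
  shows "(f has_derivative (\<lambda>h. \<Sum>i\<in>UNIV. partial_deriv i f x * h $ i)) (at x)"
proof -
  have lin: "linear (frechet_derivative f (at x))"
    using smooth_has_derivative[OF assms] has_derivative_linear by blast
  have "frechet_derivative f (at x) h = (\<Sum>i\<in>UNIV. partial_deriv i f x * h $ i)" for h
  proof -
    have "h = (\<Sum>i\<in>UNIV. h $ i *\<^sub>R axis i 1)"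
      by (simp add: vec_eq_iff axis_def if_distrib[where f="(*) _"] cong: if_cong)
    then have "frechet_derivative f (at x) h = frechet_derivative f (at x) (\<Sum>i\<in>UNIV. h $ i *\<^sub>R axis i 1)"
      by simp
    also have "\<dots> = (\<Sum>i\<in>UNIV. h $ i * frechet_derivative f (at x) (axis i 1))"
      using lin by (simp add: linear_sum linear_scale)
    finally show ?thesis by (simp add: partial_deriv_def mult.commute)
  qed
  then have "frechet_derivative f (at x) = (\<lambda>h. \<Sum>i\<in>UNIV. partial_deriv i f x * h $ i)"
    by blast
  then show ?thesis using smooth_has_derivative[OF assms, of x] by simp
qed

text \<open>Only continuous functions are convolved, over a box; so the Leibniz rule for integrals with a
continuous integrand applies. The derivative is assembled from the partial derivatives as a bounded linear
map because that rule is stated for such maps.\<close>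

lemma convolution_has_derivative:
  assumes \<eta>: "smooth \<eta>" and g: "continuous_on UNIV g"
  shows "((\<lambda>x. integral (cbox a b) (\<lambda>y. g y * \<eta> (x - y))) has_derivative
      (\<lambda>h. \<Sum>i\<in>UNIV. integral (cbox a b) (\<lambda>y. g y * partial_deriv i \<eta> (x - y)) * h $ i)) (at x)"
proof -
  define D :: "real^3 \<Rightarrow> ((real^3) \<Rightarrow>\<^sub>L real)"
    where "D x = (\<Sum>i\<in>UNIV. partial_deriv i \<eta> x *\<^sub>R blinfun_inner_left (axis i 1))" for x
  have D_apply: "D x h = (\<Sum>i\<in>UNIV. partial_deriv i \<eta> x * h $ i)" for x h
    by (simp add: D_def blinfun.sum_left blinfun.scaleR_left inner_axis)
  have cont: "continuous_on UNIV (partial_deriv i \<eta>)" for i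
    by (intro smooth_continuous smooth_partial_deriv \<eta>)
  have contg: "continuous_on S (\<lambda>z. g (snd z))" for S :: "((real^3) \<times> (real^3)) set"
    by (rule continuous_on_compose2[OF g]) (auto intro!: continuous_intros)
  have contd: "continuous_on S (\<lambda>z. partial_deriv i \<eta> (fst z - snd z))" for S :: "((real^3) \<times> (real^3)) set" and i
    by (rule continuous_on_compose2[OF cont]) (auto intro!: continuous_intros)
  have conte: "continuous_on UNIV (\<lambda>y. f (x - y))" if "continuous_on UNIV f" for f :: "real^3 \<Rightarrow> real" and x
    by (rule continuous_on_compose2[OF that]) (auto intro!: continuous_intros)
  have "((\<lambda>x. integral (cbox a b) (\<lambda>y. g y * \<eta> (x - y))) has_derivative
      integral (cbox a b) (\<lambda>y. g y *\<^sub>R D (x - y))) (at x within UNIV)"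
  proof (rule leibniz_rule)
    fix x y :: "real^3"
    have "((\<lambda>x. \<eta> (x - y)) has_derivative (\<lambda>h. D (x - y) (h - 0))) (at x)"
      by (rule has_derivative_compose[OF _ smooth_has_derivative_partial[OF \<eta>, folded D_apply]])
         (intro derivative_intros)
    then have "((\<lambda>x. \<eta> (x - y)) has_derivative blinfun_apply (D (x - y))) (at x)"
      by simp
    then have "((\<lambda>x. g y * \<eta> (x - y)) has_derivative (\<lambda>h. g y * D (x - y) h)) (at x)"
      by (rule has_derivative_mult_right)
    then show "((\<lambda>x. g y * \<eta> (x - y)) has_derivative blinfun_apply (g y *\<^sub>R D (x - y))) (at x within UNIV)"
      by (simp add: scaleR_blinfun.rep_eq)
  next
    fix x :: "real^3"
    show "(\<lambda>y. g y * \<eta> (x - y)) integrable_on cbox a b"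
      by (intro integrable_continuous continuous_on_subset[OF continuous_on_mult[OF g conte]] 
          smooth_continuous \<eta>) auto
  next
    show "continuous_on (UNIV \<times> cbox a b) (\<lambda>(x, y). g y *\<^sub>R D (x - y))"
      unfolding D_def split_beta by (intro continuous_intros contg contd)
  qed auto
  moreover have "blinfun_apply (integral (cbox a b) (\<lambda>y. g y *\<^sub>R D (x - y))) h =
     (\<Sum>i\<in>UNIV. integral (cbox a b) (\<lambda>y. g y * partial_deriv i \<eta> (x - y)) * h $ i)" for h
  proof -
    have int: "(\<lambda>y. g y * partial_deriv i \<eta> (x - y)) integrable_on cbox a b" for i
      by (intro integrable_continuous continuous_on_subset[OF continuous_on_mult[OF g conte[OF cont]]]) auto
    have "(\<lambda>y. g y *\<^sub>R D (x - y)) integrable_on cbox a b"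
      unfolding D_def
      by (intro integrable_continuous continuous_intros continuous_on_subset[OF g] 
          continuous_on_subset[OF conte[OF cont]]) auto
    then have "blinfun_apply (integral (cbox a b) (\<lambda>y. g y *\<^sub>R D (x - y))) h =
        integral (cbox a b) (\<lambda>y. blinfun_apply (g y *\<^sub>R D (x - y)) h)"
      using integral_linear[of "\<lambda>y. g y *\<^sub>R D (x - y)" "cbox a b" "\<lambda>T. blinfun_apply T h"]
      by (simp add: comp_def bounded_linear_blinfun_apply blinfun.bounded_linear_left)
    also have "\<dots> = integral (cbox a b) (\<lambda>y. \<Sum>i\<in>UNIV. (g y * partial_deriv i \<eta> (x - y)) * h $ i)"
      by (simp add: blinfun.scaleR_left D_apply sum_distrib_left mult.assoc)
    also have "\<dots> = (\<Sum>i\<in>UNIV. integral (cbox a b) (\<lambda>y. (g y * partial_deriv i \<eta> (x - y)) * h $ i))"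
      by (intro integral_sum integrable_on_mult_left int) auto
    finally show ?thesis by simp
  qed
  ultimately show ?thesis
    by (auto intro: has_derivative_eq_rhs)
qed

text \<open>The partial derivatives are convolutions with \<open>\<partial>\<^sub>i\<eta>\<close>, which is again smooth; hence induction over all kernels.\<close>

lemma smooth_convolution:
  assumes g: "continuous_on UNIV g" and \<eta>: "smooth \<eta>"
  shows "smooth (\<lambda>x. integral (cbox a b) (\<lambda>y. g y * \<eta> (x - y)))"
proof -
  have "times_differentiable n (\<lambda>x. integral (cbox a b) (\<lambda>y. g y * \<eta> (x - y)))" if "smooth \<eta>" for n \<eta>
    using that
  proof (induction n arbitrary: \<eta>)
    case 0
    have "continuous (at x) (\<lambda>x. integral (cbox a b) (\<lambda>y. g y * \<eta> (x - y)))" for x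
      using convolution_has_derivative[OF 0 g] has_derivative_continuous by blast
    then show ?case by (simp add: continuous_at_imp_continuous_on)
  next
    case (Suc n)
    show ?case
    proof (rule times_differentiable_SucI[OF convolution_has_derivative[OF Suc.prems g]])
      fix i :: 3
      have "(\<Sum>j\<in>UNIV. integral (cbox a b) (\<lambda>y. g y * partial_deriv j \<eta> (x - y)) * axis i 1 $ j) =
         integral (cbox a b) (\<lambda>y. g y * partial_deriv i \<eta> (x - y))" for x
        by (simp add: axis_def if_distrib[of "\<lambda>z. _ * z"] cong: if_cong)
      then show "times_differentiable n (\<lambda>x. \<Sum>j\<in>UNIV. integral (cbox a b) (\<lambda>y. g y * partial_deriv j \<eta> (x - y)) * axis i 1 $ j)"
        using Suc.IH[OF smooth_partial_deriv[OF Suc.prems]] by simp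
    qed
  qed
  then show ?thesis using \<eta> by (simp add: smooth_def)
qed

lemma partial_deriv_convolution:
  assumes g: "continuous_on UNIV g" and \<eta>: "smooth \<eta>"
  shows "partial_deriv i (\<lambda>x. integral (cbox a b) (\<lambda>y. g y * \<eta> (x - y))) x =
    integral (cbox a b) (\<lambda>y. g y * partial_deriv i \<eta> (x - y))"
  unfolding partial_deriv_eq[OF convolution_has_derivative[OF \<eta> g]]
  by (simp add: axis_def if_distrib[of "\<lambda>z. _ * z"] cong: if_cong)

section \<open>Test functions and integration by parts\<close>

lemma test_functionsI:
  assumes "smooth \<phi>" "compact C" "C \<subseteq> \<Omega>" "\<And>x. x \<notin> C \<Longrightarrow> \<phi> x = 0"
  shows "\<phi> \<in> test_functions \<Omega>"
proof -
  have sub: "closure {x. \<phi> x \<noteq> 0} \<subseteq> C"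
    using assms by (intro closure_minimal compact_imp_closed) auto
  then have "compact (closure {x. \<phi> x \<noteq> 0})"
    using compact_Int_closed[OF \<open>compact C\<close>, of "closure {x. \<phi> x \<noteq> 0}"] by (simp add: Int_absorb1)
  then show ?thesis using assms sub by (auto simp: test_functions_def smooth_def)
qed

lemma test_functionsD:
  assumes "\<phi> \<in> test_functions \<Omega>"
  shows "smooth \<phi>" "compact (closure {x. \<phi> x \<noteq> 0})" "closure {x. \<phi> x \<noteq> 0} \<subseteq> \<Omega>"
    and "x \<notin> closure {x. \<phi> x \<noteq> 0} \<Longrightarrow> \<phi> x = 0"
  using assms closure_subset[of "{x. \<phi> x \<noteq> 0}"] by (auto simp: test_functions_def smooth_def)

lemma test_functions_mono: "\<Omega>' \<subseteq> \<Omega> \<Longrightarrow> test_functions \<Omega>' \<subseteq> test_functions \<Omega>"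
  by (auto simp: test_functions_def)

lemma smooth_test_function: "\<phi> \<in> test_functions \<Omega> \<Longrightarrow> smooth \<phi>"
  by (simp add: test_functions_def smooth_def)

lemma partial_deriv_zero_outside:
  assumes "closed C" "\<And>x. x \<notin> C \<Longrightarrow> \<phi> x = 0" "x \<notin> C"
  shows "partial_deriv i \<phi> x = 0"
proof -
  have "((\<lambda>x. 0) has_derivative (\<lambda>h. 0)) (at x)" by simp
  then have "(\<phi> has_derivative (\<lambda>h. 0)) (at x)"
  proof (rule has_derivative_transform_within_open)
    show "open (- C)" using assms(1) by (rule open_Compl)
    show "x \<in> - C" using assms(3) by simp
    show "0 = \<phi> y" if "y \<in> - C" for y using assms(2)[of y] that by simp
  qed
  from partial_deriv_eq[OF this] show ?thesis .
qed

lemma partial_deriv_test_functions: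
  assumes "\<phi> \<in> test_functions \<Omega>"
  shows "partial_deriv i \<phi> \<in> test_functions \<Omega>"
proof -
  note C = test_functionsD[OF assms]
  have "partial_deriv i \<phi> x = 0" if "x \<notin> closure {x. \<phi> x \<noteq> 0}" for x
    by (rule partial_deriv_zero_outside[where C="closure {x. \<phi> x \<noteq> 0}", OF closed_closure C(4) that])
  then show ?thesis
    by (rule test_functionsI[OF smooth_partial_deriv[OF C(1)] C(2,3)])
qed

lemma mult_test_functions:
  assumes "smooth f" "\<phi> \<in> test_functions \<Omega>"
  shows "(\<lambda>x. f x * \<phi> x) \<in> test_functions \<Omega>"
proof -
  note C = test_functionsD[OF assms(2)]
  show ?thesis
    by (rule test_functionsI[OF smooth_mult[OF assms(1) C(1)] C(2,3)]) (subst C(4), simp_all)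
qed

lemma continuous_lebesgue_measurable:
  fixes f :: "real^3 \<Rightarrow> real"
  assumes "continuous_on UNIV f"
  shows "f \<in> borel_measurable (lebesgue_on S)"
  using borel_measurable_continuous_onI[OF assms]
  by (intro measurable_restrict_space1 measurable_completion) simp

lemma compact_support_bounded:
  fixes f :: "real^3 \<Rightarrow> real"
  assumes "continuous_on UNIV f" "compact C" "\<And>x. x \<notin> C \<Longrightarrow> f x = 0"
  shows "\<exists>B>0. \<forall>x. \<bar>f x\<bar> \<le> B"
proof -
  have "bounded (f ` C)"
    using assms by (meson compact_continuous_image compact_imp_bounded continuous_on_subset subset_UNIV)
  then obtain B where "B > 0" "\<And>x. x \<in> C \<Longrightarrow> \<bar>f x\<bar> \<le> B"
    by (auto simp: bounded_pos)
  then show ?thesis using assms(3) by (metis abs_zero less_imp_le)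
qed

lemma compact_support_integrable:
  fixes f :: "real^3 \<Rightarrow> real"
  assumes "continuous_on UNIV f" "compact C" "\<And>x. x \<notin> C \<Longrightarrow> f x = 0"
  shows "integrable lebesgue f"
proof -
  obtain B where "B > 0" "\<And>x. \<bar>f x\<bar> \<le> B" using compact_support_bounded[OF assms] by blast
  moreover have "C \<in> lmeasurable" using assms(2) by (rule lmeasurable_compact)
  ultimately show ?thesis
    using continuous_lebesgue_measurable[OF assms(1), of UNIV] assms(3)
    by (intro integrableI_bounded_set[where A=C and B=B]) (auto simp: fmeasurable_def lebesgue_on_UNIV_eq)
qed

lemma test_function_L2:
  assumes "S \<in> lmeasurable" "\<phi> \<in> test_functions \<Omega>"
  shows "\<phi> \<in> L2 S"
proof -
  note C = test_functionsD[OF assms(2)]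
  obtain B where "\<And>x. \<bar>\<phi> x\<bar> \<le> B"
    using compact_support_bounded[OF smooth_continuous[OF C(1)] C(2,4)] by blast
  then show ?thesis
    by (intro L2_bounded[where B=B] assms continuous_lebesgue_measurable smooth_continuous C) simp
qed

lemma grad_test_function_L2:
  assumes "S \<in> lmeasurable" "\<phi> \<in> test_functions \<Omega>"
  shows "grad \<phi> \<in> L2 S"
  by (rule L2_vec)
     (simp add: grad_def test_function_L2[OF assms(1) partial_deriv_test_functions[OF assms(2)]])

lemma lebesgue_on_integral_eq:
  fixes f :: "real^3 \<Rightarrow> real"
  assumes "S \<in> sets lebesgue" "\<And>x. x \<notin> S \<Longrightarrow> f x = 0"
  shows "(LINT x|lebesgue_on S. f x) = (LINT x|lebesgue. f x)"
proof -
  have "(LINT x|lebesgue_on S. f x) = (LINT x|lebesgue. indicator S x *\<^sub>R f x)"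
    using assms(1) by (intro integral_restrict_space) simp
  also have "(\<lambda>x. indicator S x *\<^sub>R f x) = f"
    using assms(2) by (auto simp: indicator_def fun_eq_iff)
  finally show ?thesis .
qed

lemma integrable_lebesgue_on_eq:
  fixes f :: "real^3 \<Rightarrow> real"
  assumes "S \<in> sets lebesgue" "\<And>x. x \<notin> S \<Longrightarrow> f x = 0"
  shows "integrable (lebesgue_on S) f \<longleftrightarrow> integrable lebesgue f"
proof -
  have "(\<lambda>x. indicator S x *\<^sub>R f x) = f"
    using assms(2) by (auto simp: indicator_def fun_eq_iff)
  then show ?thesis
    using integrable_restrict_space[of S lebesgue f] assms(1) by simp
qed

lemma lebesgue_integral_translation:
  fixes f :: "real^3 \<Rightarrow> real"
  assumes "continuous_on UNIV f"
  shows "(LINT x|lebesgue. f (c + x)) = (LINT x|lebesgue. f x)"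
proof -
  have m: "f \<in> borel_measurable borel" by (rule borel_measurable_continuous_onI[OF assms])
  have "(LINT x|lebesgue. f x) = (LINT x|lborel. f x)"
    using m by (intro integral_completion) simp
  also have "\<dots> = (LINT x|distr lborel borel ((+) c). f x)"
    by (simp add: lborel_distr_plus)
  also have "\<dots> = (LINT x|lborel. f (c + x))"
    using m by (intro integral_distr) simp_all
  also have "\<dots> = (LINT x|lebesgue. f (c + x))"
    using m by (intro integral_completion[symmetric]) simp
  finally show ?thesis by simp
qed

text \<open>By translation invariance of Lebesgue measure every difference quotient of \<open>\<psi>\<close> in direction \<open>i\<close> has
integral \<open>0\<close>. By the mean value theorem the difference quotients are bounded uniformly, and they vanish outside a
fixed ball, so that dominated convergence carries the identity over to the derivative.\<close>

lemma integral_partial_deriv_eq_0: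
  assumes \<psi>: "smooth \<psi>" and C: "compact C" "\<And>x. x \<notin> C \<Longrightarrow> \<psi> x = 0"
  shows "(LINT x|lebesgue. partial_deriv i \<psi> x) = 0"
proof -
  let ?e = "axis i 1 :: real^3"
  define t :: "nat \<Rightarrow> real" where "t n = inverse (real (Suc n))" for n
  have t: "0 < t n" "t n \<le> 1" for n by (auto simp: t_def field_simps)
  have t0: "t \<longlonglongrightarrow> 0" unfolding t_def by (rule LIMSEQ_inverse_real_of_nat)
  have cont: "continuous_on UNIV \<psi>" using \<psi> by (rule smooth_continuous)
  have der: "((\<lambda>s. \<psi> (x + s *\<^sub>R ?e)) has_real_derivative partial_deriv i \<psi> (x + s *\<^sub>R ?e)) (at s)" for x s
  proof -
    have "((\<lambda>s. \<psi> (x + s *\<^sub>R ?e)) has_derivative (\<lambda>h. frechet_derivative \<psi> (at (x + s *\<^sub>R ?e)) (0 + h *\<^sub>R ?e))) (at s)"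
      by (rule has_derivative_compose[OF _ smooth_has_derivative[OF \<psi>]]) (intro derivative_intros)
    moreover have "linear (frechet_derivative \<psi> (at (x + s *\<^sub>R ?e)))"
      using smooth_has_derivative[OF \<psi>] has_derivative_linear by blast
    then have "(\<lambda>h. frechet_derivative \<psi> (at (x + s *\<^sub>R ?e)) (0 + h *\<^sub>R ?e)) = (*) (partial_deriv i \<psi> (x + s *\<^sub>R ?e))"
      by (simp add: fun_eq_iff partial_deriv_def linear_scale)
    ultimately show ?thesis
      unfolding has_field_derivative_def by simp
  qed
  define d where "d n x = (\<psi> (t n *\<^sub>R ?e + x) - \<psi> x) / t n" for n x
  have z: "partial_deriv i \<psi> x = 0" if "x \<notin> C" for x
    by (rule partial_deriv_zero_outside[where C=C, OF compact_imp_closed[OF C(1)] C(2) that])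
  obtain B where "B > 0" and B: "\<And>x. \<bar>partial_deriv i \<psi> x\<bar> \<le> B"
    using compact_support_bounded[OF smooth_continuous[OF smooth_partial_deriv[OF \<psi>]] C(1) z] by blast
  obtain R where R: "\<And>x. x \<in> C \<Longrightarrow> norm x \<le> R" using compact_imp_bounded[OF C(1)] by (auto simp: bounded_iff)
  let ?K = "cball (0::real^3) (R + 1)"
  have dB: "\<bar>d n x\<bar> \<le> B" for n x
  proof -
    obtain s where "\<psi> (x + t n *\<^sub>R ?e) - \<psi> (x + 0 *\<^sub>R ?e) = (t n - 0) * partial_deriv i \<psi> (x + s *\<^sub>R ?e)"
      using MVT2[of 0 "t n" "\<lambda>s. \<psi> (x + s *\<^sub>R ?e)" "\<lambda>s. partial_deriv i \<psi> (x + s *\<^sub>R ?e)", OF t(1) der] by blast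
    then have "d n x = partial_deriv i \<psi> (x + s *\<^sub>R ?e)"
      using t[of n] by (simp add: d_def add.commute)
    then show ?thesis using B by simp
  qed
  have d0: "d n x = 0" if "x \<notin> ?K" for n x
  proof -
    have x: "norm x > R + 1" using that by simp
    have "norm x \<le> norm (t n *\<^sub>R ?e + x) + norm (t n *\<^sub>R ?e)"
      using norm_triangle_ineq4[of "t n *\<^sub>R ?e + x" "t n *\<^sub>R ?e"] by simp
    moreover have "norm (t n *\<^sub>R ?e) \<le> 1" using t[of n] by (simp add: norm_axis_1)
    ultimately have "t n *\<^sub>R ?e + x \<notin> C" using x R[of "t n *\<^sub>R ?e + x"] by force
    moreover have "x \<notin> C" using x R[of x] by auto
    ultimately show ?thesis using C(2) by (simp add: d_def)
  qed
  have cshift: "continuous_on UNIV (\<lambda>x. \<psi> (c + x))" for c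
    by (rule continuous_on_compose2[OF cont]) (auto intro!: continuous_intros)
  have contd: "continuous_on UNIV (d n)" for n
    unfolding d_def using t[of n] by (intro continuous_intros cshift cont) auto
  have "(LINT x|lebesgue. d n x) = 0" for n
  proof -
    have i1: "integrable lebesgue \<psi>" by (rule compact_support_integrable[OF cont C])
    have i2: "integrable lebesgue (\<lambda>x. \<psi> (t n *\<^sub>R ?e + x))"
    proof (rule compact_support_integrable[OF cshift, of "(\<lambda>x. x - t n *\<^sub>R ?e) ` C"])
      show "compact ((\<lambda>x. x - t n *\<^sub>R ?e) ` C)"
        using C(1) by (intro compact_continuous_image continuous_intros)
      show "\<psi> (t n *\<^sub>R ?e + x) = 0" if "x \<notin> (\<lambda>x. x - t n *\<^sub>R ?e) ` C" for x
        using that C(2)[of "t n *\<^sub>R ?e + x"] by force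
    qed
    show ?thesis
      using i1 i2 lebesgue_integral_translation[OF cont, of "t n *\<^sub>R ?e"] by (simp add: d_def)
  qed
  moreover have "(\<lambda>n. LINT x|lebesgue. d n x) \<longlonglongrightarrow> (LINT x|lebesgue. partial_deriv i \<psi> x)"
  proof (rule integral_dominated_convergence[where w="\<lambda>x. B * indicator ?K x"])
    show "partial_deriv i \<psi> \<in> borel_measurable lebesgue" "d n \<in> borel_measurable lebesgue" for n
      using continuous_lebesgue_measurable[of _ UNIV] contd smooth_continuous[OF smooth_partial_deriv[OF \<psi>]] 
      by (auto simp: lebesgue_on_UNIV_eq)
    show "integrable lebesgue (\<lambda>x. B * indicator ?K x)"
      using lmeasurable_cball by (intro integrable_mult_right integrable_real_indicator) (auto simp: fmeasurable_def)
    show "AE x in lebesgue. (\<lambda>n. d n x) \<longlonglongrightarrow> partial_deriv i \<psi> x"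
    proof (rule AE_I2)
      fix x
      have "((\<lambda>h. (\<psi> (x + h *\<^sub>R ?e) - \<psi> x) / h) \<longlongrightarrow> partial_deriv i \<psi> x) (at 0)"
        using der[of x 0] by (simp add: DERIV_def)
      moreover have "filterlim t (at 0) sequentially"
        using t0 t by (auto simp: filterlim_at intro!: always_eventually) (metis less_irrefl)
      ultimately show "(\<lambda>n. d n x) \<longlonglongrightarrow> partial_deriv i \<psi> x"
        using filterlim_compose[of "\<lambda>h. (\<psi> (x + h *\<^sub>R ?e) - \<psi> x) / h"] by (fastforce simp: d_def add.commute)
    qed
    show "AE x in lebesgue. norm (d n x) \<le> B * indicator ?K x" for n
    proof (rule AE_I2)
      show "norm (d n x) \<le> B * indicator ?K x" for x
        using dB[of n x] d0[of x n] by (auto simp: indicator_def)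
    qed
  qed
  ultimately show ?thesis by (simp add: LIMSEQ_const_iff)
qed

text \<open>Integrate the product rule for \<open>f \<cdot> \<phi>\<close>, which has compact support in \<open>\<Omega>\<close>. Hence no boundary
term arises.\<close>

lemma smooth_times_test_partial:
  assumes \<Omega>: "open \<Omega>" "bounded \<Omega>" and f: "smooth f" and \<phi>: "\<phi> \<in> test_functions \<Omega>"
  shows "l2_inner \<Omega> f (partial_deriv i \<phi>) = - l2_inner \<Omega> (partial_deriv i f) \<phi>"
proof -
  have S: "\<Omega> \<in> lmeasurable" using \<Omega> by (intro lmeasurable_open)
  have t: "(\<lambda>x. f x * \<phi> x) \<in> test_functions \<Omega>" "(\<lambda>x. f x * partial_deriv i \<phi> x) \<in> test_functions \<Omega>"
    "(\<lambda>x. partial_deriv i f x * \<phi> x) \<in> test_functions \<Omega>"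
    using f \<phi> by (auto intro!: mult_test_functions smooth_partial_deriv partial_deriv_test_functions)
  note C = test_functionsD[OF t(1)]
  have "0 = (LINT x|lebesgue. partial_deriv i (\<lambda>x. f x * \<phi> x) x)"
    using integral_partial_deriv_eq_0[OF C(1,2,4)] by simp
  also have "\<dots> = (LINT x|lebesgue_on \<Omega>. partial_deriv i (\<lambda>x. f x * \<phi> x) x)"
  proof (rule lebesgue_on_integral_eq[symmetric])
    show "\<Omega> \<in> sets lebesgue" using S by auto
    show "partial_deriv i (\<lambda>x. f x * \<phi> x) x = 0" if "x \<notin> \<Omega>" for x
    proof (rule partial_deriv_zero_outside[where C="closure {x. f x * \<phi> x \<noteq> 0}", OF closed_closure C(4)])
      show "x \<notin> closure {x. f x * \<phi> x \<noteq> 0}" using C(3) that by (rule contra_subsetD)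
    qed
  qed
  also have "\<dots> = (LINT x|lebesgue_on \<Omega>. f x * partial_deriv i \<phi> x + partial_deriv i f x * \<phi> x)"
    using f \<phi> by (simp add: partial_deriv_mult smooth_test_function)
  also have "\<dots> = (LINT x|lebesgue_on \<Omega>. f x * partial_deriv i \<phi> x) + (LINT x|lebesgue_on \<Omega>. partial_deriv i f x * \<phi> x)"
    by (intro Bochner_Integration.integral_add L2_integrable[OF S] test_function_L2[OF S t(2)] test_function_L2[OF S t(3)])
  finally show ?thesis by (simp add: l2_inner_def)
qed

section \<open>Mollification\<close>

definition bump :: "real \<Rightarrow> real^3 \<Rightarrow> real" where
  "bump \<delta> z = flat_exp 1 (\<delta>\<^sup>2 - z \<bullet> z)"

definition mollifier :: "real \<Rightarrow> real^3 \<Rightarrow> real" where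
  "mollifier \<delta> z = bump \<delta> z / (LINT y|lebesgue. bump \<delta> y)"

text \<open>The integrals run over the whole space; functions given on \<open>\<Omega>\<close> are extended by \<open>0\<close> before they are mollified.\<close>

definition mollify :: "real \<Rightarrow> (real^3 \<Rightarrow> real) \<Rightarrow> real^3 \<Rightarrow> real" where
  "mollify \<delta> g x = (LINT y|lebesgue. g y * mollifier \<delta> (x - y))"

lemma smooth_bump: "smooth (bump \<delta>)"
  unfolding bump_def[abs_def]
  using smooth_inner_self[of 0] by (intro smooth_flat_exp smooth_diff smooth_const) simp

lemma bump_nonneg: "0 \<le> bump \<delta> z"
  by (simp add: bump_def flat_exp_def)

lemma bump_eq_0: 
  assumes "\<delta> > 0"
  shows "bump \<delta> z = 0 \<longleftrightarrow> \<delta> \<le> norm z"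
proof -
  have "\<delta>\<^sup>2 - z \<bullet> z \<le> 0 \<longleftrightarrow> \<delta>\<^sup>2 \<le> (norm z)\<^sup>2" by (simp add: power2_norm_eq_inner)
  also have "\<dots> \<longleftrightarrow> \<delta> \<le> norm z"
    using assms by (simp add: abs_le_square_iff[symmetric])
  finally show ?thesis by (simp add: bump_def flat_exp_def)
qed

lemma bump_integrable: "\<delta> > 0 \<Longrightarrow> integrable lebesgue (bump \<delta>)"
  by (rule compact_support_integrable[of _ "cball 0 \<delta>"]) 
     (auto simp: bump_eq_0 intro: smooth_continuous smooth_bump)

lemma bump_integral_pos:
  assumes "\<delta> > 0"
  shows "0 < (LINT y|lebesgue. bump \<delta> y)"
proof -
  have "(LINT y|lebesgue. bump \<delta> y) \<noteq> 0"
  proof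
    assume "(LINT y|lebesgue. bump \<delta> y) = 0"
    then have "AE y in lebesgue. bump \<delta> y = 0"
      using integral_nonneg_eq_0_iff_AE[OF bump_integrable[OF assms]] by (simp add: bump_nonneg)
    then have "AE y in lebesgue. y \<notin> ball (0::real^3) \<delta>"
      by eventually_elim (simp add: bump_eq_0 assms)
    then have "ball (0::real^3) \<delta> \<in> null_sets lebesgue"
      by (subst AE_iff_null_sets) auto
    then show False
      using open_not_negligible[of "ball (0::real^3) \<delta>"] assms by (simp add: negligible_iff_null_sets)
  qed
  moreover have "0 \<le> (LINT y|lebesgue. bump \<delta> y)"
    by (intro integral_nonneg_AE) (simp add: bump_nonneg)
  ultimately show ?thesis by simp
qed

lemma smooth_mollifier: "smooth (mollifier \<delta>)"
  using smooth_mult[OF smooth_bump smooth_const, of \<delta> "1 / (LINT y|lebesgue. bump \<delta> y)"]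
  by (simp add: mollifier_def[abs_def])

lemma mollifier_nonneg: "\<delta> > 0 \<Longrightarrow> 0 \<le> mollifier \<delta> z"
  using bump_integral_pos[of \<delta>] by (simp add: mollifier_def bump_nonneg)

lemma mollifier_eq_0: "\<delta> > 0 \<Longrightarrow> \<delta> \<le> norm z \<Longrightarrow> mollifier \<delta> z = 0"
  by (simp add: mollifier_def bump_eq_0)

lemma mollifier_reflect: "mollifier \<delta> (x - y) = mollifier \<delta> (y - x)"
  by (simp add: mollifier_def bump_def inner_diff_left inner_diff_right inner_commute add.commute)

lemma mollifier_reflect_integrable: 
  assumes "\<delta> > 0" shows "integrable lebesgue (\<lambda>y. mollifier \<delta> (x - y))"
  by (rule compact_support_integrable[of _ "cball x \<delta>"])
     (use assms in \<open>auto intro!: smooth_continuous smooth_reflect smooth_mollifier mollifier_eq_0 simp: dist_norm\<close>)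

lemma mollifier_integral: 
  assumes "\<delta> > 0" shows "(LINT y|lebesgue. mollifier \<delta> (x - y)) = 1"
proof -
  have "(LINT y|lebesgue. mollifier \<delta> (x - y)) = (LINT y|lebesgue. mollifier \<delta> (- x + y))"
    by (subst mollifier_reflect) (simp add: add.commute)
  also have "\<dots> = (LINT y|lebesgue. mollifier \<delta> y)"
    by (intro lebesgue_integral_translation smooth_continuous smooth_mollifier)
  also have "\<dots> = 1"
    using bump_integral_pos[OF assms] by (simp add: mollifier_def[abs_def])
  finally show ?thesis .
qed

text \<open>Mollification is an average over the ball of radius \<open>\<delta>\<close> with weights of total mass one, so it cannot leave the interval in
which almost all values on that ball lie. With \<open>c = f x\<close> this gives convergence at points of continuity, with
\<open>c = 0\<close> it gives bounds.\<close>

lemma mollify_near: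
  assumes \<delta>: "\<delta> > 0" and m: "f \<in> borel_measurable lebesgue"
    and near: "AE y in lebesgue. dist x y < \<delta> \<longrightarrow> \<bar>f y - c\<bar> \<le> e"
  shows "integrable lebesgue (\<lambda>y. f y * mollifier \<delta> (x - y))" "\<bar>mollify \<delta> f x - c\<bar> \<le> e"
proof -
  have mm: "(\<lambda>y. mollifier \<delta> (x - y)) \<in> borel_measurable lebesgue"
    using mollifier_reflect_integrable[OF \<delta>] by (rule borel_measurable_integrable)
  have bound: "AE y in lebesgue. norm ((f y - c) * mollifier \<delta> (x - y)) \<le> e * mollifier \<delta> (x - y)"
    using near
  proof eventually_elim
    case (elim y)
    then show ?case
      using mollifier_eq_0[OF \<delta>, of "x - y"] mollifier_nonneg[OF \<delta>, of "x - y"]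
      by (cases "dist x y < \<delta>") (auto simp: abs_mult dist_norm intro!: mult_right_mono)
  qed
  have i1: "integrable lebesgue (\<lambda>y. (f y - c) * mollifier \<delta> (x - y))"
  proof (rule Bochner_Integration.integrable_bound)
    show "integrable lebesgue (\<lambda>y. e * mollifier \<delta> (x - y))"
      by (intro integrable_mult_right mollifier_reflect_integrable \<delta>)
    show "(\<lambda>y. (f y - c) * mollifier \<delta> (x - y)) \<in> borel_measurable lebesgue"
      using m mm by measurable
    show "AE y in lebesgue. norm ((f y - c) * mollifier \<delta> (x - y)) \<le> norm (e * mollifier \<delta> (x - y))"
      using bound by eventually_elim simp
  qed
  have i2: "integrable lebesgue (\<lambda>y. c * mollifier \<delta> (x - y))"
    by (intro integrable_mult_right mollifier_reflect_integrable \<delta>)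
  have eq: "(\<lambda>y. f y * mollifier \<delta> (x - y)) = (\<lambda>y. (f y - c) * mollifier \<delta> (x - y) + c * mollifier \<delta> (x - y))"
    by (simp add: fun_eq_iff algebra_simps)
  show "integrable lebesgue (\<lambda>y. f y * mollifier \<delta> (x - y))"
    unfolding eq using i1 i2 by (rule Bochner_Integration.integrable_add)
  have "mollify \<delta> f x - c = (LINT y|lebesgue. (f y - c) * mollifier \<delta> (x - y))"
    unfolding mollify_def eq using i1 i2 mollifier_integral[OF \<delta>, of x] by simp
  also have "\<bar>\<dots>\<bar> \<le> (LINT y|lebesgue. e * mollifier \<delta> (x - y))"
  proof -
    have "\<bar>LINT y|lebesgue. (f y - c) * mollifier \<delta> (x - y)\<bar> \<le> (LINT y|lebesgue. norm ((f y - c) * mollifier \<delta> (x - y)))"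
      using integral_norm_bound[of lebesgue "\<lambda>y. (f y - c) * mollifier \<delta> (x - y)"] by simp
    also have "\<dots> \<le> (LINT y|lebesgue. e * mollifier \<delta> (x - y))"
      by (intro integral_mono_AE integrable_norm i1 integrable_mult_right mollifier_reflect_integrable \<delta> bound)
    finally show ?thesis .
  qed
  also have "\<dots> = e" using mollifier_integral[OF \<delta>, of x] by simp
  finally show "\<bar>mollify \<delta> f x - c\<bar> \<le> e" .
qed

lemma mollify_eq_0:
  assumes "\<delta> > 0" "\<And>y. dist x y < \<delta> \<Longrightarrow> g y = 0"
  shows "mollify \<delta> g x = 0"
proof -
  have "(\<lambda>y. g y * mollifier \<delta> (x - y)) = (\<lambda>y. 0)"
  proof
    show "g y * mollifier \<delta> (x - y) = 0" for y
      using assms mollifier_eq_0[of \<delta> "x - y"] by (cases "dist x y < \<delta>") (auto simp: dist_norm)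
  qed
  then show ?thesis by (simp add: mollify_def)
qed

lemma mollify_smooth:
  assumes g: "continuous_on UNIV g" and C: "compact C" "\<And>x. x \<notin> C \<Longrightarrow> g x = 0"
  shows "smooth (mollify \<delta> g)"
    and "partial_deriv i (mollify \<delta> g) x = (LINT y|lebesgue. g y * partial_deriv i (mollifier \<delta>) (x - y))"
proof -
  obtain a b where ab: "C \<subseteq> cbox a b"
    using bounded_subset_cbox_symmetric[OF compact_imp_bounded[OF C(1)]] by metis
  have eq: "(LINT y|lebesgue. g y * \<eta> (x - y)) = integral (cbox a b) (\<lambda>y. g y * \<eta> (x - y))"
    if "smooth \<eta>" for \<eta> x
  proof -
    have c: "continuous_on UNIV (\<lambda>y. g y * \<eta> (x - y))"
      by (intro continuous_on_mult g smooth_continuous smooth_reflect that)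
    have z: "g y * \<eta> (x - y) = 0" if "y \<notin> cbox a b" for y using C(2) ab that by auto
    have "integrable lebesgue (\<lambda>y. g y * \<eta> (x - y))"
      by (rule compact_support_integrable[OF c compact_cbox z])
    then have "integrable (lebesgue_on (cbox a b)) (\<lambda>y. g y * \<eta> (x - y))"
      using integrable_lebesgue_on_eq[of "cbox a b" "\<lambda>y. g y * \<eta> (x - y)", OF _ z] by simp
    then have "(LINT y|lebesgue_on (cbox a b). g y * \<eta> (x - y)) = integral (cbox a b) (\<lambda>y. g y * \<eta> (x - y))"
      by (intro lebesgue_integral_eq_integral) auto
    then show ?thesis
      by (subst (asm) lebesgue_on_integral_eq) (auto simp: z)
  qed
  have eq': "mollify \<delta> g = (\<lambda>x. integral (cbox a b) (\<lambda>y. g y * mollifier \<delta> (x - y)))"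
    by (simp add: mollify_def fun_eq_iff eq smooth_mollifier)
  show "smooth (mollify \<delta> g)"
    unfolding eq' by (intro smooth_convolution g smooth_mollifier)
  show "partial_deriv i (mollify \<delta> g) x = (LINT y|lebesgue. g y * partial_deriv i (mollifier \<delta>) (x - y))"
    unfolding eq' by (simp add: partial_deriv_convolution g smooth_mollifier eq smooth_partial_deriv)
qed

lemma compact_support_uniform:
  fixes g :: "real^3 \<Rightarrow> real"
  assumes g: "continuous_on UNIV g" and C: "compact C" "\<And>x. x \<notin> C \<Longrightarrow> g x = 0" and e: "e > 0"
  obtains d where "d > 0" "\<And>x y. dist x y < d \<Longrightarrow> \<bar>g x - g y\<bar> \<le> e"
proof -
  obtain R where R: "\<And>x. x \<in> C \<Longrightarrow> norm x \<le> R" using compact_imp_bounded[OF C(1)] by (auto simp: bounded_iff)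
  have "uniformly_continuous_on (cball 0 (R + 1)) g"
    by (intro compact_uniformly_continuous continuous_on_subset[OF g]) auto
  then obtain d where d: "d > 0" "\<And>x y. x \<in> cball 0 (R + 1) \<Longrightarrow> y \<in> cball 0 (R + 1) \<Longrightarrow> dist y x < d \<Longrightarrow> dist (g y) (g x) < e"
    using e unfolding uniformly_continuous_on_def by metis
  show thesis
  proof (rule that[of "min d 1"])
    show "min d 1 > 0" using d by simp
    fix x y :: "real^3" assume xy: "dist x y < min d 1"
    have n: "norm x \<le> norm y + dist x y" "norm y \<le> norm x + dist x y"
      using norm_triangle_sub[of x y] norm_triangle_sub[of y x] by (simp_all add: dist_norm norm_minus_commute)
    show "\<bar>g x - g y\<bar> \<le> e"
    proof (cases "x \<in> C \<or> y \<in> C")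
      case True
      then have "x \<in> cball 0 (R + 1)" "y \<in> cball 0 (R + 1)" using R n xy by fastforce+
      then show ?thesis using d(2)[of x y] xy by (auto simp: dist_norm norm_minus_commute abs_minus_commute)
    next
      case False
      then show ?thesis using C(2) e by simp
    qed
  qed
qed

text \<open>Mollify with a radius below both the distance of \<open>C\<close> from the complement of \<open>\<Omega>\<close> and the modulus of uniform continuity
of \<open>g\<close>.\<close>

lemma continuous_approx_test_function:
  assumes g: "continuous_on UNIV g" and C: "compact C" "C \<subseteq> \<Omega>" "\<And>x. x \<notin> C \<Longrightarrow> g x = 0"
    and "open \<Omega>" and e: "e > 0"
  obtains \<phi> where "\<phi> \<in> test_functions \<Omega>" "\<And>x. \<bar>\<phi> x - g x\<bar> \<le> e"
proof -
  obtain r where r: "r > 0" "(\<Union>x\<in>C. cball x r) \<subseteq> \<Omega>"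
    using compact_subset_open_imp_cball_epsilon_subset[OF C(1) \<open>open \<Omega>\<close> C(2)] by blast
  obtain d where d: "d > 0" "\<And>x y. dist x y < d \<Longrightarrow> \<bar>g x - g y\<bar> \<le> e"
    using compact_support_uniform[OF g C(1,3) e] by blast
  define \<delta> where "\<delta> = min d r"
  have \<delta>: "\<delta> > 0" "\<delta> \<le> d" "\<delta> \<le> r" using r d by (auto simp: \<delta>_def)
  have gm: "g \<in> borel_measurable lebesgue"
    using continuous_lebesgue_measurable[OF g, of UNIV] by (simp add: lebesgue_on_UNIV_eq)
  have K: "compact (\<Union>x\<in>C. cball x r)"
    by (rule compact_minkowski_sum_cball) (fact C)
  show thesis
  proof
    show "mollify \<delta> g \<in> test_functions \<Omega>"
    proof (rule test_functionsI[OF mollify_smooth(1)[OF g C(1,3)] K r(2)])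
      fix x assume x: "x \<notin> (\<Union>x\<in>C. cball x r)"
      show "mollify \<delta> g x = 0"
      proof (rule mollify_eq_0[OF \<delta>(1)])
        fix y assume "dist x y < \<delta>"
        then have "y \<notin> C" using x \<delta> by (force simp: dist_commute)
        then show "g y = 0" by (rule C(3))
      qed
    qed
    show "\<bar>mollify \<delta> g x - g x\<bar> \<le> e" for x
    proof (rule mollify_near(2)[OF \<delta>(1) gm], intro AE_I2 impI)
      fix y assume "dist x y < \<delta>"
      then show "\<bar>g y - g x\<bar> \<le> e" using d(2)[of y x] \<delta> by (simp add: dist_commute)
    qed
  qed
qed

section \<open>Uniqueness of weak derivatives\<close>

text \<open>The indicator of a compact set is the bounded pointwise limit of continuous functions supported near the set,
and each of these is uniformly close to a test function; dominated convergence applies.\<close>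

lemma orthogonal_to_tests_imp_compact_integral_0:
  assumes \<Omega>: "open \<Omega>" "bounded \<Omega>" and q: "q \<in> L2 \<Omega>"
    and orth: "\<And>\<phi>. \<phi> \<in> test_functions \<Omega> \<Longrightarrow> l2_inner \<Omega> q \<phi> = 0"
    and C: "compact C" "C \<subseteq> \<Omega>"
  shows "(LINT x|lebesgue_on \<Omega>. q x * indicator C x) = 0"
proof (cases "C = {}")
  case False
  have S: "\<Omega> \<in> lmeasurable" using \<Omega> by (intro lmeasurable_open)
  have qm: "q \<in> borel_measurable (lebesgue_on \<Omega>)" using q by (rule L2_measurable)
  obtain r where r: "r > 0" "(\<Union>x\<in>C. cball x r) \<subseteq> \<Omega>"
    using compact_subset_open_imp_cball_epsilon_subset[OF C(1) \<open>open \<Omega>\<close> C(2)] by blast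
  have K: "compact (\<Union>x\<in>C. cball x r)"
    by (rule compact_minkowski_sum_cball) (fact C)
  \<comment> \<open>A spike that is \<open>1\<close> on \<open>C\<close> and vanishes at distance \<open>r / (n + 1)\<close>, hence has support in \<open>\<Omega>\<close> already for \<open>n = 0\<close>.\<close>
  define c where "c n x = max 0 (1 - infdist x C * (real (Suc n) / r))" for n x
  have cont: "continuous_on UNIV (c n)" for n
    unfolding c_def by (intro continuous_intros continuous_on_max)
  have zero: "c n x = 0" if x: "x \<notin> (\<Union>x\<in>C. cball x r)" for n x
  proof -
    obtain y where y: "y \<in> C" "infdist x C = dist x y"
      using infdist_attains_inf[OF compact_imp_closed[OF C(1)] False] by blast
    then have "r \<le> infdist x C" using x by (force simp: dist_commute)
    then have "1 \<le> infdist x C / r" using r by simp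
    also have "\<dots> \<le> infdist x C * (real (Suc n) / r)"
      using r infdist_nonneg[of x C] by (simp add: divide_right_mono mult_left_le mult_le_cancel_left1)
    finally show ?thesis by (simp add: c_def)
  qed
  have "\<exists>\<phi>. \<phi> \<in> test_functions \<Omega> \<and> (\<forall>x. \<bar>\<phi> x - c n x\<bar> \<le> inverse (real (Suc n)))" for n
    by (rule continuous_approx_test_function[OF cont K r(2) zero \<open>open \<Omega>\<close>, of "inverse (real (Suc n))"]) auto
  then obtain \<phi> where \<phi>: "\<And>n. \<phi> n \<in> test_functions \<Omega>" "\<And>n x. \<bar>\<phi> n x - c n x\<bar> \<le> inverse (real (Suc n))"
    by metis
  have clim: "(\<lambda>n. c n x) \<longlonglongrightarrow> indicator C x" for x
  proof (cases "x \<in> C")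
    case True
    then show ?thesis by (simp add: c_def)
  next
    case F: False
    then have pos: "infdist x C > 0"
      using in_closed_iff_infdist_zero[OF compact_imp_closed[OF C(1)] False] infdist_nonneg[of x C] by force
    have "eventually (\<lambda>n. c n x = 0) sequentially"
    proof -
      obtain N where N: "r / infdist x C < real N" using reals_Archimedean2 by blast
      have "c n x = 0" if "n \<ge> N" for n
      proof -
        have "r / infdist x C \<le> real (Suc n)" using N that by simp
        then have "r \<le> infdist x C * real (Suc n)" using pos by (simp add: field_simps)
        then show ?thesis using r by (simp add: c_def field_simps)
      qed
      then show ?thesis by (auto simp: eventually_sequentially)
    qed
    then show ?thesis using F by (simp add: tendsto_eventually)
  qed
  have lim: "(\<lambda>n. \<phi> n x) \<longlonglongrightarrow> indicator C x" for x
  proof -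
    have "(\<lambda>n. \<phi> n x - c n x) \<longlonglongrightarrow> 0"
      by (rule Lim_null_comparison[OF _ LIMSEQ_inverse_real_of_nat]) (use \<phi>(2) in simp)
    from tendsto_add[OF this clim[of x]] show ?thesis by simp
  qed
  have bd: "\<bar>\<phi> n x\<bar> \<le> 2" for n x
  proof -
    have "\<bar>c n x\<bar> \<le> 1" using r infdist_nonneg[of x C] by (simp add: c_def)
    moreover have "inverse (real (Suc n)) \<le> 1" by (simp add: field_simps)
    ultimately show ?thesis using \<phi>(2)[of n x] by linarith
  qed
  have "(\<lambda>n. LINT x|lebesgue_on \<Omega>. q x * \<phi> n x) \<longlonglongrightarrow> (LINT x|lebesgue_on \<Omega>. q x * indicator C x)"
  proof (rule integral_dominated_convergence[where w="\<lambda>x. 2 * \<bar>q x\<bar>"])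
    have "C \<in> sets lebesgue" using C(1) lmeasurable_compact by blast
    then have "(indicator C :: real^3 \<Rightarrow> real) \<in> borel_measurable (lebesgue_on \<Omega>)"
      by (intro measurable_restrict_space1) simp
    then show "(\<lambda>x. q x * indicator C x) \<in> borel_measurable (lebesgue_on \<Omega>)"
      using qm by (intro borel_measurable_times)
    show "(\<lambda>x. q x * \<phi> n x) \<in> borel_measurable (lebesgue_on \<Omega>)" for n
      by (rule borel_measurable_times[OF qm continuous_lebesgue_measurable[OF smooth_continuous[OF smooth_test_function[OF \<phi>(1)]]]])
    show "integrable (lebesgue_on \<Omega>) (\<lambda>x. 2 * \<bar>q x\<bar>)"
      using L2_integrable[OF S q] by simp
    show "AE x in lebesgue_on \<Omega>. (\<lambda>n. q x * \<phi> n x) \<longlonglongrightarrow> q x * indicator C x"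
      by (intro AE_I2 tendsto_mult tendsto_const lim)
    show "AE x in lebesgue_on \<Omega>. norm (q x * \<phi> n x) \<le> 2 * \<bar>q x\<bar>" for n
    proof (rule AE_I2)
      show "norm (q x * \<phi> n x) \<le> 2 * \<bar>q x\<bar>" for x
        using mult_left_mono[OF bd[of n x], of "\<bar>q x\<bar>"] by (simp add: abs_mult mult.commute)
    qed
  qed
  moreover have "(LINT x|lebesgue_on \<Omega>. q x * \<phi> n x) = 0" for n
    using orth[OF \<phi>(1)] by (simp add: l2_inner_def)
  ultimately show ?thesis by (simp add: LIMSEQ_const_iff)
qed simp

text \<open>If \<open>q\<close> were positive on a set of positive measure, inner regularity would provide a compact subset of positive
measure, and the integral of \<open>q\<close> over it would be positive.\<close>

lemma orthogonal_to_tests_imp_nonpos: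
  assumes \<Omega>: "open \<Omega>" "bounded \<Omega>" and q: "q \<in> L2 \<Omega>"
    and orth: "\<And>\<phi>. \<phi> \<in> test_functions \<Omega> \<Longrightarrow> l2_inner \<Omega> q \<phi> = 0"
  shows "AE x in lebesgue_on \<Omega>. q x \<le> 0"
proof -
  have L: "\<Omega> \<in> lmeasurable" using \<Omega> by (intro lmeasurable_open)
  then have Ls: "\<Omega> \<in> sets lebesgue" by blast
  have qm: "q \<in> borel_measurable (lebesgue_on \<Omega>)" using q by (rule L2_measurable)
  define S where "S = {x \<in> \<Omega>. 0 < q x}"
  have "{x \<in> space (lebesgue_on \<Omega>). 0 < q x} \<in> sets (lebesgue_on \<Omega>)"
    using qm by measurable
  then have S: "S \<in> sets lebesgue" "S \<in> sets (lebesgue_on \<Omega>)"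
    using Ls by (auto simp: S_def sets_restrict_space_iff)
  have Sm: "S \<in> lmeasurable"
    using fmeasurableI2[OF L _ S(1)] by (auto simp: S_def)
  have "emeasure lebesgue S = 0"
  proof (rule ccontr)
    assume "emeasure lebesgue S \<noteq> 0"
    then have pos: "0 < measure lebesgue S" and eS: "emeasure lebesgue S = ennreal (measure lebesgue S)"
      using Sm emeasure_eq_measure2[OF Sm] by (auto simp: zero_less_measure_iff)
    obtain T where T: "closed T" "T \<subseteq> S" "S - T \<in> lmeasurable" "emeasure lebesgue (S - T) < ennreal (measure lebesgue S)"
      using sets_lebesgue_inner_closed[OF S(1) pos] by blast
    have "compact T"
      using T \<Omega>(2) by (auto simp: compact_eq_bounded_closed S_def intro: bounded_subset)
    have Ts: "T \<in> sets lebesgue" using \<open>compact T\<close> lmeasurable_compact by blast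
    have T\<Omega>: "T \<subseteq> \<Omega>" using T(2) by (auto simp: S_def)
    have "(LINT x|lebesgue_on \<Omega>. q x * indicator T x) = 0"
      by (rule orthogonal_to_tests_imp_compact_integral_0[OF \<Omega> q orth \<open>compact T\<close> T\<Omega>])
    moreover have "integrable (lebesgue_on \<Omega>) (\<lambda>x. q x * indicator T x)"
      using integrable_mult_indicator[of T "lebesgue_on \<Omega>" q] L2_integrable[OF L q] Ts T\<Omega> Ls
      by (simp add: sets_restrict_space_iff mult.commute)
    moreover have "AE x in lebesgue_on \<Omega>. 0 \<le> q x * indicator T x"
      using T(2) by (intro AE_I2) (auto simp: indicator_def S_def)
    ultimately have "AE x in lebesgue_on \<Omega>. q x * indicator T x = 0"
      using integral_nonneg_eq_0_iff_AE by blast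
    then have "AE x in lebesgue_on \<Omega>. x \<notin> T"
      by eventually_elim (use T(2) in \<open>auto simp: S_def indicator_def\<close>)
    then have "AE x in lebesgue. x \<in> \<Omega> \<longrightarrow> x \<notin> T"
      using Ls by (subst (asm) AE_restrict_space_iff) auto
    then have "AE x in lebesgue. x \<notin> T"
      by eventually_elim (use T\<Omega> in auto)
    then have "T \<in> null_sets lebesgue"
      using AE_iff_null_sets[OF Ts] by simp
    then have "emeasure lebesgue S = emeasure lebesgue (S - T)"
      using emeasure_Diff_null_set S(1) by metis
    then show False using T(4) eS by simp
  qed
  then have "S \<in> null_sets lebesgue" using S(1) by blast
  then have "AE x in lebesgue. x \<notin> S" by (rule AE_not_in)
  then have "AE x in lebesgue_on \<Omega>. x \<notin> S"
    using Ls by (subst AE_restrict_space_iff) auto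
  moreover have "AE x in lebesgue_on \<Omega>. x \<in> \<Omega>" using AE_space[of "lebesgue_on \<Omega>"] by simp
  ultimately show ?thesis
    by eventually_elim (auto simp: S_def)
qed

lemma orthogonal_to_tests_imp_0:
  assumes \<Omega>: "open \<Omega>" "bounded \<Omega>" and q: "q \<in> L2 \<Omega>"
    and orth: "\<And>\<phi>. \<phi> \<in> test_functions \<Omega> \<Longrightarrow> l2_inner \<Omega> q \<phi> = 0"
  shows "AE x in lebesgue_on \<Omega>. q x = 0"
proof -
  have "AE x in lebesgue_on \<Omega>. (-1) *\<^sub>R q x \<le> 0"
    by (rule orthogonal_to_tests_imp_nonpos[OF \<Omega> L2_scale[OF q]])
       (simp only: l2_inner_scale_left orth)
  moreover have "AE x in lebesgue_on \<Omega>. q x \<le> 0"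
    by (rule orthogonal_to_tests_imp_nonpos[OF \<Omega> q orth])
  ultimately show ?thesis by eventually_elim simp
qed

lemma weak_gradient_unique:
  assumes \<Omega>: "open \<Omega>" "bounded \<Omega>" and g: "g \<in> L2 \<Omega>" "g' \<in> L2 \<Omega>"
    and w: "is_weak_gradient \<Omega> u g" "is_weak_gradient \<Omega> u g'"
  shows "AE x in lebesgue_on \<Omega>. g x = g' x"
proof -
  have S: "\<Omega> \<in> lmeasurable" using \<Omega> by (intro lmeasurable_open)
  have "AE x in lebesgue_on \<Omega>. g x $ i - g' x $ i = 0" for i
  proof (rule orthogonal_to_tests_imp_0[OF \<Omega> L2_diff[OF g[THEN L2_component]]])
    fix \<phi> assume \<phi>: "\<phi> \<in> test_functions \<Omega>"
    show "l2_inner \<Omega> (\<lambda>x. g x $ i - g' x $ i) \<phi> = 0"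
      using w \<phi> l2_inner_diff_left[OF g[THEN L2_component] test_function_L2[OF S \<phi>], of i i]
      by (simp add: is_weak_gradient_def)
  qed
  then have "AE x in lebesgue_on \<Omega>. \<forall>i. g x $ i - g' x $ i = 0"
    by (intro eventually_all_finite) 
  then show ?thesis by eventually_elim (simp add: vec_eq_iff)
qed

lemma weak_divergence_unique:
  assumes \<Omega>: "open \<Omega>" "bounded \<Omega>" and g: "q \<in> L2 \<Omega>" "q' \<in> L2 \<Omega>"
    and w: "is_weak_divergence \<Omega> p q" "is_weak_divergence \<Omega> p q'"
  shows "AE x in lebesgue_on \<Omega>. q x = q' x"
proof -
  have S: "\<Omega> \<in> lmeasurable" using \<Omega> by (intro lmeasurable_open)
  have "AE x in lebesgue_on \<Omega>. q x - q' x = 0"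
  proof (rule orthogonal_to_tests_imp_0[OF \<Omega> L2_diff[OF g]])
    fix \<phi> assume \<phi>: "\<phi> \<in> test_functions \<Omega>"
    show "l2_inner \<Omega> (\<lambda>x. q x - q' x) \<phi> = 0"
      using w \<phi> l2_inner_diff_left[OF g test_function_L2[OF S \<phi>]]
      by (simp add: is_weak_divergence_def)
  qed
  then show ?thesis by eventually_elim simp
qed

section \<open>Sobolev spaces\<close>

lemma H1_L2: "u \<in> H1 \<Omega> \<Longrightarrow> u \<in> L2 \<Omega>"
  by (simp add: H1_def)

lemma H10_H1: "u \<in> H10 \<Omega> \<Longrightarrow> u \<in> H1 \<Omega>"
  by (simp add: H10_def)

lemma
  assumes "u \<in> H1 \<Omega>"
  shows wgrad_L2: "wgrad \<Omega> u \<in> L2 \<Omega>" and wgrad_weak: "is_weak_gradient \<Omega> u (wgrad \<Omega> u)"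
proof -
  have "\<exists>g. g \<in> L2 \<Omega> \<and> is_weak_gradient \<Omega> u g" using assms by (auto simp: H1_def)
  from someI_ex[OF this] show "wgrad \<Omega> u \<in> L2 \<Omega>" "is_weak_gradient \<Omega> u (wgrad \<Omega> u)"
    by (simp_all add: wgrad_def)
qed

lemma
  assumes "p \<in> Hdiv \<Omega>"
  shows wdiv_L2: "wdiv \<Omega> p \<in> L2 \<Omega>" and wdiv_weak: "is_weak_divergence \<Omega> p (wdiv \<Omega> p)"
proof -
  have "\<exists>g. g \<in> L2 \<Omega> \<and> is_weak_divergence \<Omega> p g" using assms by (auto simp: Hdiv_def)
  from someI_ex[OF this] show "wdiv \<Omega> p \<in> L2 \<Omega>" "is_weak_divergence \<Omega> p (wdiv \<Omega> p)"
    by (simp_all add: wdiv_def)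
qed

text \<open>Identifies the chosen gradient \<^const>\<open>wgrad\<close>: whatever satisfies the defining identity agrees with it almost everywhere.\<close>

lemma wgrad_eqI:
  assumes "open \<Omega>" "bounded \<Omega>" "u \<in> L2 \<Omega>" "g \<in> L2 \<Omega>" "is_weak_gradient \<Omega> u g"
  shows "u \<in> H1 \<Omega>" "AE x in lebesgue_on \<Omega>. wgrad \<Omega> u x = g x"
proof -
  show H: "u \<in> H1 \<Omega>" using assms by (auto simp: H1_def)
  show "AE x in lebesgue_on \<Omega>. wgrad \<Omega> u x = g x"
    by (rule weak_gradient_unique[OF assms(1,2) wgrad_L2[OF H] assms(4) wgrad_weak[OF H] assms(5)])
qed

lemma wdiv_eqI:
  assumes "open \<Omega>" "bounded \<Omega>" "p \<in> L2 \<Omega>" "q \<in> L2 \<Omega>" "is_weak_divergence \<Omega> p q"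
  shows "p \<in> Hdiv \<Omega>" "AE x in lebesgue_on \<Omega>. wdiv \<Omega> p x = q x"
proof -
  show H: "p \<in> Hdiv \<Omega>" using assms by (auto simp: Hdiv_def)
  show "AE x in lebesgue_on \<Omega>. wdiv \<Omega> p x = q x"
    by (rule weak_divergence_unique[OF assms(1,2) wdiv_L2[OF H] assms(4) wdiv_weak[OF H] assms(5)])
qed

lemma H1_diff:
  assumes \<Omega>: "open \<Omega>" "bounded \<Omega>" and u: "u \<in> H1 \<Omega>" and v: "v \<in> H1 \<Omega>"
  shows "(\<lambda>x. u x - v x) \<in> H1 \<Omega>"
    and "AE x in lebesgue_on \<Omega>. wgrad \<Omega> (\<lambda>x. u x - v x) x = wgrad \<Omega> u x - wgrad \<Omega> v x"
proof -
  have S: "\<Omega> \<in> lmeasurable" using \<Omega> by (intro lmeasurable_open)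
  note L = H1_L2[OF u] H1_L2[OF v] wgrad_L2[OF u] wgrad_L2[OF v]
  have w: "is_weak_gradient \<Omega> (\<lambda>x. u x - v x) (\<lambda>x. wgrad \<Omega> u x - wgrad \<Omega> v x)"
    unfolding is_weak_gradient_def
  proof (intro ballI allI)
    fix \<phi> i assume \<phi>: "\<phi> \<in> test_functions \<Omega>"
    show "l2_inner \<Omega> (\<lambda>x. u x - v x) (partial_deriv i \<phi>) =
        - l2_inner \<Omega> (\<lambda>x. (wgrad \<Omega> u x - wgrad \<Omega> v x) $ i) \<phi>"
      using wgrad_weak[OF u] wgrad_weak[OF v] \<phi>
        l2_inner_diff_left[OF L(1,2) test_function_L2[OF S partial_deriv_test_functions[OF \<phi>]], of i]
        l2_inner_diff_left[OF L2_component[OF L(3)] L2_component[OF L(4)] test_function_L2[OF S \<phi>], of i i]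
      by (simp add: is_weak_gradient_def)
  qed
  show "(\<lambda>x. u x - v x) \<in> H1 \<Omega>"
    "AE x in lebesgue_on \<Omega>. wgrad \<Omega> (\<lambda>x. u x - v x) x = wgrad \<Omega> u x - wgrad \<Omega> v x"
    by (rule wgrad_eqI[OF \<Omega> L2_diff[OF L(1,2)] L2_diff[OF L(3,4)] w])+
qed

lemma test_functions_diff:
  assumes "\<phi> \<in> test_functions \<Omega>" "\<psi> \<in> test_functions \<Omega>"
  shows "(\<lambda>x. \<phi> x - \<psi> x) \<in> test_functions \<Omega>"
proof -
  note P = test_functionsD[OF assms(1)] and Q = test_functionsD[OF assms(2)]
  have z: "\<phi> x - \<psi> x = 0" if "x \<notin> closure {x. \<phi> x \<noteq> 0} \<union> closure {x. \<psi> x \<noteq> 0}" for x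
    using P(4)[of x] Q(4)[of x] that by simp
  show ?thesis
    by (rule test_functionsI[OF smooth_diff[OF P(1) Q(1)] compact_Un[OF P(2) Q(2)] Un_least[OF P(3) Q(3)] z])
qed

lemma grad_diff:
  assumes "smooth f" "smooth g"
  shows "grad (\<lambda>x. f x - g x) x = grad f x - grad g x"
proof -
  have "((\<lambda>x. f x - g x) has_derivative (\<lambda>h. frechet_derivative f (at x) h - frechet_derivative g (at x) h)) (at x)"
    by (intro has_derivative_diff smooth_has_derivative assms)
  from partial_deriv_eq[OF this] show ?thesis
    by (simp add: grad_def vec_eq_iff partial_deriv_def)
qed

text \<open>The difference of approximating test functions approximates the difference; the linearity of \<^const>\<open>wgrad\<close>
is available almost everywhere only.\<close>

lemma H10_diff:
  assumes \<Omega>: "open \<Omega>" "bounded \<Omega>" and u: "u \<in> H10 \<Omega>" and v: "v \<in> H10 \<Omega>"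
  shows "(\<lambda>x. u x - v x) \<in> H10 \<Omega>"
proof -
  have S: "\<Omega> \<in> lmeasurable" using \<Omega> by (intro lmeasurable_open)
  note H = H10_H1[OF u] H10_H1[OF v]
  note L = H1_L2[OF H(1)] H1_L2[OF H(2)] wgrad_L2[OF H(1)] wgrad_L2[OF H(2)]
  note D = H1_diff[OF \<Omega> H]
  have "\<exists>\<phi>\<in>test_functions \<Omega>. l2_norm \<Omega> (\<lambda>x. (u x - v x) - \<phi> x) < \<epsilon> \<and>
      l2_norm \<Omega> (\<lambda>x. wgrad \<Omega> (\<lambda>x. u x - v x) x - grad \<phi> x) < \<epsilon>" if "\<epsilon> > 0" for \<epsilon>
  proof -
    have "\<epsilon> / 2 > 0" using that by simp
    then obtain \<phi> \<psi> where \<phi>: "\<phi> \<in> test_functions \<Omega>" "l2_norm \<Omega> (\<lambda>x. u x - \<phi> x) < \<epsilon> / 2"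
        "l2_norm \<Omega> (\<lambda>x. wgrad \<Omega> u x - grad \<phi> x) < \<epsilon> / 2"
      and \<psi>: "\<psi> \<in> test_functions \<Omega>" "l2_norm \<Omega> (\<lambda>x. v x - \<psi> x) < \<epsilon> / 2"
        "l2_norm \<Omega> (\<lambda>x. wgrad \<Omega> v x - grad \<psi> x) < \<epsilon> / 2"
      using u v unfolding H10_def by blast
    note t = test_function_L2[OF S \<phi>(1)] test_function_L2[OF S \<psi>(1)]
      grad_test_function_L2[OF S \<phi>(1)] grad_test_function_L2[OF S \<psi>(1)]
    have tri: "l2_norm \<Omega> (\<lambda>x. a x - b x) < \<epsilon>" 
      if "a \<in> L2 \<Omega>" "b \<in> L2 \<Omega>" "l2_norm \<Omega> a < \<epsilon> / 2" "l2_norm \<Omega> b < \<epsilon> / 2"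
      for a b :: "real^3 \<Rightarrow> 'z::euclidean_space"
      using l2_norm_triangle[OF that(1) L2_scale[OF that(2), of "-1"]] l2_norm_scale[of \<Omega> "-1" b] that(3,4)
      by simp
    have "l2_norm \<Omega> (\<lambda>x. (u x - v x) - (\<phi> x - \<psi> x)) = l2_norm \<Omega> (\<lambda>x. (u x - \<phi> x) - (v x - \<psi> x))"
      by (simp add: algebra_simps)
    also have "\<dots> < \<epsilon>"
      by (intro tri L2_diff L t \<phi> \<psi>)
    finally have 1: "l2_norm \<Omega> (\<lambda>x. (u x - v x) - (\<phi> x - \<psi> x)) < \<epsilon>" .
    have gd: "grad (\<lambda>x. \<phi> x - \<psi> x) x = grad \<phi> x - grad \<psi> x" for x
      by (intro grad_diff smooth_test_function[OF \<phi>(1)] smooth_test_function[OF \<psi>(1)])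
    have "l2_norm \<Omega> (\<lambda>x. wgrad \<Omega> (\<lambda>x. u x - v x) x - grad (\<lambda>x. \<phi> x - \<psi> x) x) =
      l2_norm \<Omega> (\<lambda>x. (wgrad \<Omega> u x - grad \<phi> x) - (wgrad \<Omega> v x - grad \<psi> x))"
    proof (rule l2_norm_cong_AE)
      show "AE x in lebesgue_on \<Omega>. wgrad \<Omega> (\<lambda>x. u x - v x) x - grad (\<lambda>x. \<phi> x - \<psi> x) x =
          (wgrad \<Omega> u x - grad \<phi> x) - (wgrad \<Omega> v x - grad \<psi> x)"
        using D(2) by eventually_elim (simp add: gd)
      show "(\<lambda>x. wgrad \<Omega> (\<lambda>x. u x - v x) x - grad (\<lambda>x. \<phi> x - \<psi> x) x) \<in> L2 \<Omega>"
        unfolding gd by (intro L2_diff wgrad_L2 D t)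
      show "(\<lambda>x. (wgrad \<Omega> u x - grad \<phi> x) - (wgrad \<Omega> v x - grad \<psi> x)) \<in> L2 \<Omega>"
        by (intro L2_diff L t)
    qed
    also have "\<dots> < \<epsilon>"
      by (intro tri L2_diff L t \<phi> \<psi>)
    finally show ?thesis
      using 1 by (intro bexI[OF _ test_functions_diff[OF \<phi>(1) \<psi>(1)]] conjI)
  qed
  then show ?thesis using D by (simp add: H10_def)
qed

text \<open>Summing the identities that define the weak gradients of the components, the \<open>i\<close>-th one tested in direction \<open>i\<close>, gives the
identity that defines the weak divergence.\<close>

lemma wdiv_eq_trace:
  assumes \<Omega>: "open \<Omega>" "bounded \<Omega>" and v: "\<And>i. (\<lambda>x. v x $ i) \<in> H1 \<Omega>"
  shows "v \<in> Hdiv \<Omega>"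
    and "AE x in lebesgue_on \<Omega>. wdiv \<Omega> v x = (\<Sum>i\<in>UNIV. wgrad \<Omega> (\<lambda>y. v y $ i) x $ i)"
proof -
  let ?tr = "\<lambda>x. \<Sum>i\<in>UNIV. wgrad \<Omega> (\<lambda>y. v y $ i) x $ i"
  have S: "\<Omega> \<in> lmeasurable" using \<Omega> by (intro lmeasurable_open)
  have L: "v \<in> L2 \<Omega>" by (rule L2_vec[OF H1_L2[OF v]])
  have Lg: "(\<lambda>x. wgrad \<Omega> (\<lambda>y. v y $ i) x $ i) \<in> L2 \<Omega>" for i
    by (rule L2_component[OF wgrad_L2[OF v]])
  have Ls: "?tr \<in> L2 \<Omega>"
    by (intro L2_sum Lg) simp
  have w: "is_weak_divergence \<Omega> v ?tr"
    unfolding is_weak_divergence_def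
  proof
    fix \<phi> assume \<phi>: "\<phi> \<in> test_functions \<Omega>"
    have "l2_inner \<Omega> v (grad \<phi>) = (\<Sum>i\<in>UNIV. l2_inner \<Omega> (\<lambda>x. v x $ i) (partial_deriv i \<phi>))"
      using l2_inner_components[OF L grad_test_function_L2[OF S \<phi>]] by (simp add: grad_def)
    also have "\<dots> = (\<Sum>i\<in>UNIV. - l2_inner \<Omega> (\<lambda>x. wgrad \<Omega> (\<lambda>y. v y $ i) x $ i) \<phi>)"
      using wgrad_weak[OF v] \<phi> by (simp add: is_weak_gradient_def)
    also have "\<dots> = - (LINT x|lebesgue_on \<Omega>. (\<Sum>i\<in>UNIV. (wgrad \<Omega> (\<lambda>y. v y $ i) x $ i) * \<phi> x))"
      by (subst Bochner_Integration.integral_sum)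
         (simp_all add: sum_negf l2_inner_def integrable_L2_mult[OF Lg test_function_L2[OF S \<phi>]])
    finally show "l2_inner \<Omega> v (grad \<phi>) = - l2_inner \<Omega> ?tr \<phi>"
      by (simp add: l2_inner_def sum_distrib_right)
  qed
  show "v \<in> Hdiv \<Omega>" "AE x in lebesgue_on \<Omega>. wdiv \<Omega> v x = ?tr x"
    by (rule wdiv_eqI[OF \<Omega> L Ls w])+
qed

lemma nonpos_if_le_mult_eps:
  fixes a :: real
  assumes "\<And>\<epsilon>. \<epsilon> > 0 \<Longrightarrow> a \<le> M * \<epsilon>" "M \<ge> 0"
  shows "a \<le> 0"
proof (rule field_le_epsilon)
  fix e :: real assume "e > 0"
  have "a \<le> M * (e / (M + 1))" using assms(2) \<open>e > 0\<close> by (intro assms(1)) simp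
  also have "\<dots> \<le> e" using assms \<open>e > 0\<close> by (simp add: field_simps)
  finally show "a \<le> 0 + e" by simp
qed

text \<open>For a test function in place of \<open>e\<close> this is the definition of the weak divergence, and both sides are continuous
in the norm of \<open>H10\<close>.\<close>

lemma H10_integration_by_parts:
  assumes \<Omega>: "open \<Omega>" "bounded \<Omega>" and L: "p \<in> L2 \<Omega>" "q \<in> L2 \<Omega>"
    and w: "is_weak_divergence \<Omega> p q" and e: "e \<in> H10 \<Omega>"
  shows "l2_inner \<Omega> p (wgrad \<Omega> e) = - l2_inner \<Omega> q e"
proof -
  have S: "\<Omega> \<in> lmeasurable" using \<Omega> by (intro lmeasurable_open)
  note H = H10_H1[OF e]
  have "\<bar>l2_inner \<Omega> p (wgrad \<Omega> e) + l2_inner \<Omega> q e\<bar> \<le> (l2_norm \<Omega> p + l2_norm \<Omega> q) * \<epsilon>" if "\<epsilon> > 0" for \<epsilon>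
  proof -
    obtain \<phi> where \<phi>: "\<phi> \<in> test_functions \<Omega>" "l2_norm \<Omega> (\<lambda>x. e x - \<phi> x) < \<epsilon>"
        "l2_norm \<Omega> (\<lambda>x. wgrad \<Omega> e x - grad \<phi> x) < \<epsilon>"
      using e \<open>\<epsilon> > 0\<close> unfolding H10_def by blast
    note t = test_function_L2[OF S \<phi>(1)] grad_test_function_L2[OF S \<phi>(1)]
    have "l2_inner \<Omega> p (wgrad \<Omega> e) + l2_inner \<Omega> q e =
        l2_inner \<Omega> p (\<lambda>x. wgrad \<Omega> e x - grad \<phi> x) + l2_inner \<Omega> q (\<lambda>x. e x - \<phi> x)"
      using w \<phi>(1) l2_inner_diff_right[OF wgrad_L2[OF H] t(2) L(1)] l2_inner_diff_right[OF H1_L2[OF H] t(1) L(2)]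
      by (simp add: is_weak_divergence_def)
    also have "\<bar>\<dots>\<bar> \<le> l2_norm \<Omega> p * l2_norm \<Omega> (\<lambda>x. wgrad \<Omega> e x - grad \<phi> x) + l2_norm \<Omega> q * l2_norm \<Omega> (\<lambda>x. e x - \<phi> x)"
      using l2_inner_Cauchy_Schwarz[OF L(1) L2_diff[OF wgrad_L2[OF H] t(2)]]
        l2_inner_Cauchy_Schwarz[OF L(2) L2_diff[OF H1_L2[OF H] t(1)]] by linarith
    also have "\<dots> \<le> l2_norm \<Omega> p * \<epsilon> + l2_norm \<Omega> q * \<epsilon>"
      by (intro add_mono mult_left_mono) (use \<phi> l2_norm_nonneg in auto)
    finally show ?thesis by (simp add: distrib_right)
  qed
  then have "\<bar>l2_inner \<Omega> p (wgrad \<Omega> e) + l2_inner \<Omega> q e\<bar> \<le> 0"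
    by (rule nonpos_if_le_mult_eps) (simp_all add: l2_norm_nonneg)
  then show ?thesis by simp
qed

text \<open>Lets a single partial derivative be treated as a divergence, so that \<open>H10_integration_by_parts\<close> also moves
derivatives from a function in \<open>H1\<close> to a function in \<open>H10\<close>.\<close>

lemma is_weak_divergence_axis:
  assumes \<Omega>: "open \<Omega>" "bounded \<Omega>" and u: "u \<in> H1 \<Omega>"
  shows "is_weak_divergence \<Omega> (\<lambda>x. axis i (u x)) (\<lambda>x. wgrad \<Omega> u x $ i)"
  using wgrad_weak[OF u]
  by (simp add: is_weak_divergence_def is_weak_gradient_def l2_inner_def inner_axis' grad_def)

section \<open>The Poincare inequality\<close>

text \<open>Since \<open>\<partial>\<^sub>1 x\<^sub>1 = 1\<close>, integration by parts gives \<open>\<parallel>\<phi>\<parallel>\<^sup>2 = -2 (x\<^sub>1 \<phi>, \<partial>\<^sub>1\<phi>) \<le> 2 R \<parallel>\<phi>\<parallel> \<parallel>\<partial>\<^sub>1\<phi>\<parallel>\<close>; divide by \<open>\<parallel>\<phi>\<parallel>\<close>.\<close>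

lemma test_function_Poincare:
  assumes \<Omega>: "open \<Omega>" "bounded \<Omega>" and R: "\<And>x. x \<in> \<Omega> \<Longrightarrow> norm x \<le> R" "R \<ge> 0"
    and \<phi>: "\<phi> \<in> test_functions \<Omega>"
  shows "l2_norm \<Omega> \<phi> \<le> 2 * R * l2_norm \<Omega> (grad \<phi>)"
proof -
  have S: "\<Omega> \<in> lmeasurable" using \<Omega> by (intro lmeasurable_open)
  let ?i = "1 :: 3"
  let ?d = "partial_deriv ?i \<phi>"
  have s: "smooth (\<lambda>x. x $ ?i * \<phi> x)" "smooth \<phi>"
    using smooth_test_function[OF \<phi>] by (auto intro: smooth_mult smooth_coordinate)
  have tx: "(\<lambda>x. x $ ?i * \<phi> x) \<in> test_functions \<Omega>"
    by (rule mult_test_functions[OF smooth_coordinate \<phi>])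
  note td = partial_deriv_test_functions[OF \<phi>, of ?i]
  have tdx: "(\<lambda>x. x $ ?i * ?d x) \<in> test_functions \<Omega>"
    by (rule mult_test_functions[OF smooth_coordinate td])
  note L = test_function_L2[OF S \<phi>] test_function_L2[OF S tx] test_function_L2[OF S td] test_function_L2[OF S tdx]
  have "l2_inner \<Omega> (\<lambda>x. x $ ?i * \<phi> x) ?d = - l2_inner \<Omega> (\<lambda>x. x $ ?i * ?d x + \<phi> x) \<phi>"
    using smooth_times_test_partial[OF \<Omega> s(1) \<phi>, of ?i]
    by (simp add: partial_deriv_mult smooth_coordinate s(2) partial_deriv_coordinate)
  also have "\<dots> = - l2_inner \<Omega> (\<lambda>x. x $ ?i * ?d x) \<phi> - l2_inner \<Omega> \<phi> \<phi>"
    by (simp add: l2_inner_add_left[OF L(4) L(1) L(1)])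
  also have "l2_inner \<Omega> (\<lambda>x. x $ ?i * ?d x) \<phi> = l2_inner \<Omega> (\<lambda>x. x $ ?i * \<phi> x) ?d"
    by (simp add: l2_inner_def ac_simps)
  finally have "(l2_norm \<Omega> \<phi>)\<^sup>2 = - 2 * l2_inner \<Omega> (\<lambda>x. x $ ?i * \<phi> x) ?d"
    by (simp add: l2_norm_square)
  also have "\<dots> \<le> 2 * (l2_norm \<Omega> (\<lambda>x. x $ ?i * \<phi> x) * l2_norm \<Omega> ?d)"
    using l2_inner_Cauchy_Schwarz[OF L(2,3)] by linarith
  also have "\<dots> \<le> 2 * ((R * l2_norm \<Omega> \<phi>) * l2_norm \<Omega> (grad \<phi>))"
  proof (intro mult_left_mono mult_mono)
    show "l2_norm \<Omega> (\<lambda>x. x $ ?i * \<phi> x) \<le> R * l2_norm \<Omega> \<phi>"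
    proof (rule power2_le_imp_le)
      have "(l2_norm \<Omega> (\<lambda>x. x $ ?i * \<phi> x))\<^sup>2 \<le> (LINT x|lebesgue_on \<Omega>. R\<^sup>2 * (\<phi> x \<bullet> \<phi> x))"
        unfolding l2_norm_square l2_inner_def
      proof (rule integral_mono_AE)
        show "integrable (lebesgue_on \<Omega>) (\<lambda>x. (x $ ?i * \<phi> x) \<bullet> (x $ ?i * \<phi> x))"
          by (rule integrable_L2_inner[OF L(2,2)])
        show "integrable (lebesgue_on \<Omega>) (\<lambda>x. R\<^sup>2 * (\<phi> x \<bullet> \<phi> x))"
          by (intro integrable_mult_right integrable_L2_inner[OF L(1,1)])
        show "AE x in lebesgue_on \<Omega>. (x $ ?i * \<phi> x) \<bullet> (x $ ?i * \<phi> x) \<le> R\<^sup>2 * (\<phi> x \<bullet> \<phi> x)"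
        proof (rule AE_I2)
          fix x assume "x \<in> space (lebesgue_on \<Omega>)"
          then have "\<bar>x $ ?i\<bar> \<le> R"
            using R(1)[of x] component_le_norm_cart[of x ?i] by simp
          then have "(x $ ?i)\<^sup>2 \<le> R\<^sup>2" by (simp add: abs_le_square_iff[symmetric] R(2))
          then have "(x $ ?i)\<^sup>2 * (\<phi> x)\<^sup>2 \<le> R\<^sup>2 * (\<phi> x)\<^sup>2"
            by (rule mult_right_mono) simp
          then show "(x $ ?i * \<phi> x) \<bullet> (x $ ?i * \<phi> x) \<le> R\<^sup>2 * (\<phi> x \<bullet> \<phi> x)"
            by (simp add: power2_eq_square ac_simps)
        qed
      qed
      then show "(l2_norm \<Omega> (\<lambda>x. x $ ?i * \<phi> x))\<^sup>2 \<le> (R * l2_norm \<Omega> \<phi>)\<^sup>2"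
        by (simp add: power_mult_distrib l2_norm_square) (simp add: l2_inner_def)
    qed (simp add: R(2) l2_norm_nonneg)
    have "(l2_norm \<Omega> ?d)\<^sup>2 \<le> (\<Sum>i\<in>UNIV. l2_inner \<Omega> (partial_deriv i \<phi>) (partial_deriv i \<phi>))"
      unfolding l2_norm_square
      by (rule member_le_sum[of ?i UNIV "\<lambda>i. l2_inner \<Omega> (partial_deriv i \<phi>) (partial_deriv i \<phi>)"])
         (auto simp: l2_inner_self_nonneg)
    also have "\<dots> = (l2_norm \<Omega> (grad \<phi>))\<^sup>2"
      using l2_inner_components[OF grad_test_function_L2[OF S \<phi>] grad_test_function_L2[OF S \<phi>]]
      by (simp add: l2_norm_square grad_def)
    finally show "l2_norm \<Omega> ?d \<le> l2_norm \<Omega> (grad \<phi>)"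
      by (rule power2_le_imp_le) (rule l2_norm_nonneg)
  qed (simp_all add: R(2) l2_norm_nonneg)
  finally have "l2_norm \<Omega> \<phi> * l2_norm \<Omega> \<phi> \<le> l2_norm \<Omega> \<phi> * (2 * R * l2_norm \<Omega> (grad \<phi>))"
    by (simp add: power2_eq_square ac_simps)
  then show ?thesis
    using R(2) l2_norm_nonneg[of \<Omega> \<phi>] l2_norm_nonneg[of \<Omega> "grad \<phi>"]
    by (cases "l2_norm \<Omega> \<phi> = 0") (simp_all add: mult_le_cancel_left)
qed

lemma H10_Poincare:
  assumes \<Omega>: "open \<Omega>" "bounded \<Omega>"
  obtains c where "c \<ge> 0" "\<And>e. e \<in> H10 \<Omega> \<Longrightarrow> l2_norm \<Omega> e \<le> c * l2_norm \<Omega> (wgrad \<Omega> e)"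
proof -
  have S: "\<Omega> \<in> lmeasurable" using \<Omega> by (intro lmeasurable_open)
  obtain R where R: "\<And>x. x \<in> \<Omega> \<Longrightarrow> norm x \<le> R" "R > 0"
    using \<Omega>(2) by (auto simp: bounded_pos)
  have "l2_norm \<Omega> e \<le> 2 * R * l2_norm \<Omega> (wgrad \<Omega> e)" if e: "e \<in> H10 \<Omega>" for e
  proof -
    note H = H10_H1[OF e]
    have "l2_norm \<Omega> e - 2 * R * l2_norm \<Omega> (wgrad \<Omega> e) \<le> (1 + 2 * R) * \<epsilon>" if "\<epsilon> > 0" for \<epsilon>
    proof -
      obtain \<phi> where \<phi>: "\<phi> \<in> test_functions \<Omega>" "l2_norm \<Omega> (\<lambda>x. e x - \<phi> x) < \<epsilon>"
          "l2_norm \<Omega> (\<lambda>x. wgrad \<Omega> e x - grad \<phi> x) < \<epsilon>"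
        using e \<open>\<epsilon> > 0\<close> unfolding H10_def by blast
      note t = test_function_L2[OF S \<phi>(1)] grad_test_function_L2[OF S \<phi>(1)]
      have "l2_norm \<Omega> e \<le> l2_norm \<Omega> (\<lambda>x. e x - \<phi> x) + l2_norm \<Omega> \<phi>"
        using l2_norm_triangle[OF L2_diff[OF H1_L2[OF H] t(1)] t(1)] by simp
      also have "\<dots> \<le> \<epsilon> + 2 * R * l2_norm \<Omega> (grad \<phi>)"
        using test_function_Poincare[OF \<Omega> R(1) _ \<phi>(1)] R(2) \<phi>(2) by simp
      finally have 1: "l2_norm \<Omega> e \<le> \<epsilon> + 2 * R * l2_norm \<Omega> (grad \<phi>)" .
      have "l2_norm \<Omega> (grad \<phi>) \<le> l2_norm \<Omega> (wgrad \<Omega> e) + l2_norm \<Omega> (\<lambda>x. (-1) *\<^sub>R (wgrad \<Omega> e x - grad \<phi> x))"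
        using l2_norm_triangle[OF wgrad_L2[OF H] L2_scale[OF L2_diff[OF wgrad_L2[OF H] t(2)], of "-1"]] by simp
      also have "\<dots> \<le> l2_norm \<Omega> (wgrad \<Omega> e) + \<epsilon>"
        using \<phi>(3) unfolding l2_norm_scale by simp
      finally have "2 * R * l2_norm \<Omega> (grad \<phi>) \<le> 2 * R * (l2_norm \<Omega> (wgrad \<Omega> e) + \<epsilon>)"
        using R(2) by (intro mult_left_mono) auto
      with 1 show ?thesis by (simp add: algebra_simps)
    qed
    from nonpos_if_le_mult_eps[OF this] R(2) show ?thesis by simp
  qed
  with R(2) show thesis by (intro that[of "2 * R"]) auto
qed

section \<open>The space of divergence-free fields\<close>

lemma vgrad_L2: "(\<And>i. (\<lambda>x. v x $ i) \<in> H1 \<Omega>) \<Longrightarrow> vgrad \<Omega> v \<in> L2 \<Omega>"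
  by (rule L2_vec) (simp add: vgrad_def wgrad_L2)

lemma V_space_H1: "v \<in> V_space \<Omega> \<Longrightarrow> (\<lambda>x. v x $ i) \<in> H1 \<Omega>"
  by (simp add: V_space_def H10_H1)

lemma V_space_L2: "v \<in> V_space \<Omega> \<Longrightarrow> v \<in> L2 \<Omega>"
  by (intro L2_vec H1_L2 V_space_H1)

lemma vgrad_diff:
  assumes \<Omega>: "open \<Omega>" "bounded \<Omega>" and u: "u \<in> V_space \<Omega>" and v: "v \<in> V_space \<Omega>"
  shows "AE x in lebesgue_on \<Omega>. vgrad \<Omega> (\<lambda>x. u x - v x) x = vgrad \<Omega> u x - vgrad \<Omega> v x"
proof -
  have "AE x in lebesgue_on \<Omega>. \<forall>i. wgrad \<Omega> (\<lambda>x. u x $ i - v x $ i) x = wgrad \<Omega> (\<lambda>x. u x $ i) x - wgrad \<Omega> (\<lambda>x. v x $ i) x"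
    by (intro eventually_all_finite allI H1_diff(2) \<Omega> V_space_H1 u v)
  then show ?thesis by eventually_elim (simp add: vgrad_def vec_eq_iff)
qed

lemma V_space_diff:
  assumes \<Omega>: "open \<Omega>" "bounded \<Omega>" and u: "u \<in> V_space \<Omega>" and v: "v \<in> V_space \<Omega>"
  shows "(\<lambda>x. u x - v x) \<in> V_space \<Omega>"
proof -
  have e: "(\<lambda>x. (u x - v x) $ i) \<in> H10 \<Omega>" for i
    using H10_diff[OF \<Omega>, of "\<lambda>x. u x $ i" "\<lambda>x. v x $ i"] u v by (simp add: V_space_def)
  have tr: "AE x in lebesgue_on \<Omega>. wdiv \<Omega> w x = (\<Sum>i\<in>UNIV. vgrad \<Omega> w x $ i $ i)"
    if "\<And>i. (\<lambda>x. w x $ i) \<in> H1 \<Omega>" for w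
    using wdiv_eq_trace(2)[OF \<Omega> that] by (simp add: vgrad_def)
  have "AE x in lebesgue_on \<Omega>. wdiv \<Omega> u x = 0" "AE x in lebesgue_on \<Omega>. wdiv \<Omega> v x = 0"
    using u v by (simp_all add: V_space_def)
  then have "AE x in lebesgue_on \<Omega>. wdiv \<Omega> (\<lambda>x. u x - v x) x = 0"
    using tr[of u, OF V_space_H1[OF u]] tr[of v, OF V_space_H1[OF v]] tr[of "\<lambda>x. u x - v x", OF H10_H1[OF e]] vgrad_diff[OF \<Omega> u v]
    by eventually_elim (simp add: sum_subtractf)
  then show ?thesis using e by (simp add: V_space_def)
qed

text \<open>Componentwise integration by parts turns \<open>(\<nabla>\<phi>, v)\<close> into \<open>-(\<phi>, div v)\<close>, because the trace of \<open>\<nabla>v\<close> is the weak divergence.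
This is how the pressure drops out of the estimates.\<close>

lemma gradient_orthogonal_V_space:
  assumes \<Omega>: "open \<Omega>" "bounded \<Omega>" and \<phi>: "\<phi> \<in> H1 \<Omega>" and v: "v \<in> V_space \<Omega>"
  shows "l2_inner \<Omega> (wgrad \<Omega> \<phi>) v = 0"
proof -
  have Lg: "(\<lambda>x. wgrad \<Omega> (\<lambda>y. v y $ i) x $ i) \<in> L2 \<Omega>" for i
    by (rule L2_component[OF wgrad_L2[OF V_space_H1[OF v]]])
  have v0: "(\<lambda>x. v x $ i) \<in> H10 \<Omega>" for i using v by (simp add: V_space_def)
  have parts: "l2_inner \<Omega> (\<lambda>x. wgrad \<Omega> \<phi> x $ i) (\<lambda>x. v x $ i) = - l2_inner \<Omega> \<phi> (\<lambda>x. wgrad \<Omega> (\<lambda>y. v y $ i) x $ i)" for i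
    using H10_integration_by_parts[OF \<Omega> L2_axis[OF H1_L2[OF \<phi>]] L2_component[OF wgrad_L2[OF \<phi>]]
        is_weak_divergence_axis[OF \<Omega> \<phi>] v0, of i i]
    by (simp add: l2_inner_def inner_axis')
  have "l2_inner \<Omega> (wgrad \<Omega> \<phi>) v = (\<Sum>i\<in>UNIV. l2_inner \<Omega> (\<lambda>x. wgrad \<Omega> \<phi> x $ i) (\<lambda>x. v x $ i))"
    by (rule l2_inner_components[OF wgrad_L2[OF \<phi>] V_space_L2[OF v]])
  also have "\<dots> = - (\<Sum>i\<in>UNIV. l2_inner \<Omega> \<phi> (\<lambda>x. wgrad \<Omega> (\<lambda>y. v y $ i) x $ i))"
    by (simp add: parts sum_negf)
  also have "\<dots> = - (LINT x|lebesgue_on \<Omega>. (\<Sum>i\<in>UNIV. \<phi> x * wgrad \<Omega> (\<lambda>y. v y $ i) x $ i))"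
    by (subst Bochner_Integration.integral_sum)
       (simp_all add: l2_inner_def integrable_L2_mult[OF H1_L2[OF \<phi>] Lg])
  also have "(LINT x|lebesgue_on \<Omega>. (\<Sum>i\<in>UNIV. \<phi> x * wgrad \<Omega> (\<lambda>y. v y $ i) x $ i)) = 0"
  proof (rule integral_eq_zero_AE)
    have "AE x in lebesgue_on \<Omega>. wdiv \<Omega> v x = 0" using v by (simp add: V_space_def)
    then show "AE x in lebesgue_on \<Omega>. (\<Sum>i\<in>UNIV. \<phi> x * wgrad \<Omega> (\<lambda>y. v y $ i) x $ i) = 0"
      using wdiv_eq_trace(2)[OF \<Omega> V_space_H1[OF v]]
      by eventually_elim (simp flip: sum_distrib_left)
  qed
  finally show ?thesis by simp
qed

lemma V_space_norm_eq_0: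
  assumes \<Omega>: "open \<Omega>" "bounded \<Omega>" and v: "v \<in> V_space \<Omega>" and g: "l2_norm \<Omega> (vgrad \<Omega> v) = 0"
  shows "l2_norm \<Omega> v = 0"
proof -
  have v0: "(\<lambda>x. v x $ i) \<in> H10 \<Omega>" for i using v by (simp add: V_space_def)
  obtain c where c: "\<And>e. e \<in> H10 \<Omega> \<Longrightarrow> l2_norm \<Omega> e \<le> c * l2_norm \<Omega> (wgrad \<Omega> e)"
    using H10_Poincare[OF \<Omega>] by metis
  have "AE x in lebesgue_on \<Omega>. vgrad \<Omega> v x = 0"
    using g l2_norm_eq_0_iff[OF vgrad_L2[OF V_space_H1[OF v]]] by simp
  then have "AE x in lebesgue_on \<Omega>. wgrad \<Omega> (\<lambda>y. v y $ i) x = 0" for i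
    by eventually_elim (simp add: vgrad_def vec_eq_iff)
  then have "l2_norm \<Omega> (wgrad \<Omega> (\<lambda>y. v y $ i)) = 0" for i
    using l2_norm_eq_0_iff[OF wgrad_L2[OF V_space_H1[OF v]], of i] by simp
  then have "l2_norm \<Omega> (\<lambda>y. v y $ i) = 0" for i
    using c[OF v0[of i]] l2_norm_nonneg[of \<Omega> "\<lambda>y. v y $ i"] by simp
  then have "AE x in lebesgue_on \<Omega>. v x $ i = 0" for i
    using l2_norm_eq_0_iff[OF H1_L2[OF V_space_H1[OF v]], of i] by simp
  then have "AE x in lebesgue_on \<Omega>. \<forall>i. v x $ i = 0"
    by (intro eventually_all_finite)
  then have "AE x in lebesgue_on \<Omega>. v x = 0"
    by eventually_elim (simp add: vec_eq_iff)
  then show ?thesis using l2_norm_eq_0_iff[OF V_space_L2[OF v]] by simp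
qed

section \<open>Gradients of piecewise polynomials\<close>

lemma mesh_finite: "tetrahedral_mesh \<Omega> \<T> \<Longrightarrow> finite \<T>"
  by (simp add: tetrahedral_mesh_def triangulation_def)

lemma mesh_cell:
  assumes "tetrahedral_mesh \<Omega> \<T>" "K \<in> \<T>"
  shows "compact K" "convex K" "aff_dim K = 3"
  using assms by (auto simp: tetrahedral_mesh_def compact_simplex convex_simplex aff_dim_simplex)

lemma mesh_covers: "tetrahedral_mesh \<Omega> \<T> \<Longrightarrow> \<Omega> \<subseteq> \<Union>\<T>"
  using closure_subset by (auto simp: tetrahedral_mesh_def)

text \<open>The cells cover \<open>\<Omega>\<close>, and the boundaries of the finitely many convex cells are null sets.\<close>

lemma AE_mesh_interior:
  assumes \<Omega>: "open \<Omega>" "bounded \<Omega>" and mesh: "tetrahedral_mesh \<Omega> \<T>"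
  shows "AE x in lebesgue_on \<Omega>. \<exists>K\<in>\<T>. x \<in> interior K"
proof -
  have S: "\<Omega> \<in> sets lebesgue" using lmeasurable_open[OF \<Omega>(2,1)] by blast
  have "AE x in lebesgue. x \<notin> frontier K" if "K \<in> \<T>" for K
    using negligible_convex_frontier[OF mesh_cell(2)[OF mesh that]]
    by (intro AE_not_in) (simp add: negligible_iff_null_sets)
  then have "AE x in lebesgue. \<forall>K\<in>\<T>. x \<notin> frontier K"
    using mesh_finite[OF mesh] by (intro AE_finite_allI)
  then have "AE x in lebesgue. x \<in> \<Omega> \<longrightarrow> (\<exists>K\<in>\<T>. x \<in> interior K)"
  proof eventually_elim
    case (elim x)
    show ?case
    proof
      assume "x \<in> \<Omega>"
      then obtain K where K: "K \<in> \<T>" "x \<in> K" using mesh_covers[OF mesh] by auto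
      then have "x \<in> closure K" using closure_subset by blast
      then have "x \<in> interior K" using elim K by (auto simp: frontier_def)
      then show "\<exists>K\<in>\<T>. x \<in> interior K" using K by blast
    qed
  qed
  then show ?thesis using S by (subst AE_restrict_space_iff) auto
qed

lemma L2_subset:
  assumes f: "f \<in> L2 \<Omega>" and S: "\<Omega> \<in> sets lebesgue" "\<Omega>' \<in> sets lebesgue" "\<Omega>' \<subseteq> \<Omega>"
  shows "f \<in> L2 \<Omega>'"
proof -
  have m: "f \<in> borel_measurable (lebesgue_on \<Omega>')"
    using measurable_restrict_mono[OF L2_measurable[OF f] S(3)] .
  have "integrable (lebesgue_on \<Omega>) (\<lambda>x. (norm (f x))\<^sup>2)" using f by (simp add: L2_def)
  then have "integrable lebesgue (\<lambda>x. indicator \<Omega> x *\<^sub>R (norm (f x))\<^sup>2)"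
    using S(1) by (subst (asm) integrable_restrict_space) auto
  then have "integrable lebesgue (\<lambda>x. indicator \<Omega>' x *\<^sub>R (indicator \<Omega> x *\<^sub>R (norm (f x))\<^sup>2))"
    by (rule integrable_mult_indicator[rotated]) (use S(2) in simp)
  also have "(\<lambda>x. indicator \<Omega>' x *\<^sub>R (indicator \<Omega> x *\<^sub>R (norm (f x))\<^sup>2)) = (\<lambda>x. indicator \<Omega>' x *\<^sub>R (norm (f x))\<^sup>2)"
    using S(3) by (auto simp: indicator_def fun_eq_iff)
  finally have "integrable (lebesgue_on \<Omega>') (\<lambda>x. (norm (f x))\<^sup>2)"
    using S(2) by (subst integrable_restrict_space) auto
  with m show ?thesis by (simp add: L2_def)
qed

lemma smooth_L2:
  assumes "S \<in> lmeasurable" "bounded S" "smooth f"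
  shows "f \<in> L2 S"
proof -
  obtain R where R: "\<And>x. x \<in> S \<Longrightarrow> norm x \<le> R" using assms(2) by (auto simp: bounded_iff)
  have "compact (f ` cball 0 R)"
    by (intro compact_continuous_image smooth_continuous assms) auto
  then obtain B where B: "\<And>x. x \<in> cball 0 R \<Longrightarrow> \<bar>f x\<bar> \<le> B"
    using compact_imp_bounded by (force simp: bounded_iff)
  show ?thesis
  proof (rule L2_bounded[OF assms(1) continuous_lebesgue_measurable[OF smooth_continuous[OF assms(3)]]])
    show "AE x in lebesgue_on S. norm (f x) \<le> B"
      using R B by (intro AE_I2) auto
  qed
qed

lemma l2_inner_support:
  fixes f g :: "real^3 \<Rightarrow> real"
  assumes "\<Omega> \<in> sets lebesgue" "\<Omega>' \<in> sets lebesgue" "\<Omega>' \<subseteq> \<Omega>" "\<And>x. x \<notin> \<Omega>' \<Longrightarrow> g x = 0"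
  shows "l2_inner \<Omega> f g = l2_inner \<Omega>' f g"
proof -
  have "f x * g x = 0" if "x \<notin> \<Omega>" for x using assms(3,4) that by auto
  then show ?thesis
    using lebesgue_on_integral_eq[OF assms(1), of "\<lambda>x. f x * g x"] lebesgue_on_integral_eq[OF assms(2), of "\<lambda>x. f x * g x"]
      assms(4) by (simp add: l2_inner_def)
qed

lemma test_function_zero_outside: "\<phi> \<in> test_functions \<Omega> \<Longrightarrow> x \<notin> \<Omega> \<Longrightarrow> \<phi> x = 0"
  using test_functionsD(3,4) by blast

text \<open>On \<open>\<Omega> \<inter> interior K\<close> both the restriction of the weak gradient and the classical gradient of \<open>p\<close> are weak
gradients of \<open>u\<close>, so they agree there by uniqueness.\<close>

lemma wgrad_piecewise_smooth:
  assumes \<Omega>: "open \<Omega>" "bounded \<Omega>" and u: "u \<in> H1 \<Omega>" and p: "smooth p"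
    and K: "K \<in> sets lebesgue" and eq: "AE x in lebesgue_on K. u x = p x"
  shows "AE x in lebesgue_on \<Omega>. x \<in> interior K \<longrightarrow> wgrad \<Omega> u x = grad p x"
proof -
  define \<Omega>' where "\<Omega>' = \<Omega> \<inter> interior K"
  have \<Omega>': "open \<Omega>'" "bounded \<Omega>'" "\<Omega>' \<subseteq> \<Omega>"
    using \<Omega> by (auto simp: \<Omega>'_def intro: bounded_subset)
  have L: "\<Omega> \<in> lmeasurable" "\<Omega>' \<in> lmeasurable" using \<Omega> \<Omega>' by (auto intro: lmeasurable_open)
  then have S: "\<Omega> \<in> sets lebesgue" "\<Omega>' \<in> sets lebesgue" by blast+
  have uL: "u \<in> L2 \<Omega>'" by (rule L2_subset[OF H1_L2[OF u] S \<Omega>'(3)])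
  have gL: "wgrad \<Omega> u \<in> L2 \<Omega>'" by (rule L2_subset[OF wgrad_L2[OF u] S \<Omega>'(3)])
  have pL: "grad p \<in> L2 \<Omega>'"
    by (rule L2_vec) (simp add: grad_def smooth_L2[OF L(2) \<Omega>'(2) smooth_partial_deriv[OF p]])
  have w1: "is_weak_gradient \<Omega>' u (wgrad \<Omega> u)"
    unfolding is_weak_gradient_def
  proof (intro ballI allI)
    fix \<phi> i assume \<phi>: "\<phi> \<in> test_functions \<Omega>'"
    then have \<phi>': "\<phi> \<in> test_functions \<Omega>" using test_functions_mono[OF \<Omega>'(3)] by blast
    have "l2_inner \<Omega>' u (partial_deriv i \<phi>) = l2_inner \<Omega> u (partial_deriv i \<phi>)"
      by (rule l2_inner_support[OF S \<Omega>'(3), symmetric])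
         (rule test_function_zero_outside[OF partial_deriv_test_functions[OF \<phi>]])
    also have "\<dots> = - l2_inner \<Omega> (\<lambda>x. wgrad \<Omega> u x $ i) \<phi>"
      using wgrad_weak[OF u] \<phi>' by (simp add: is_weak_gradient_def)
    also have "l2_inner \<Omega> (\<lambda>x. wgrad \<Omega> u x $ i) \<phi> = l2_inner \<Omega>' (\<lambda>x. wgrad \<Omega> u x $ i) \<phi>"
      by (rule l2_inner_support[OF S \<Omega>'(3)]) (rule test_function_zero_outside[OF \<phi>])
    finally show "l2_inner \<Omega>' u (partial_deriv i \<phi>) = - l2_inner \<Omega>' (\<lambda>x. wgrad \<Omega> u x $ i) \<phi>" .
  qed
  have "AE x in lebesgue. x \<in> K \<longrightarrow> u x = p x"
    using eq K by (subst (asm) AE_restrict_space_iff) auto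
  then have "AE x in lebesgue. x \<in> \<Omega>' \<longrightarrow> u x = p x"
    by eventually_elim (use interior_subset in \<open>auto simp: \<Omega>'_def\<close>)
  then have eq': "AE x in lebesgue_on \<Omega>'. u x = p x"
    using S by (subst AE_restrict_space_iff) auto
  have w2: "is_weak_gradient \<Omega>' u (grad p)"
    unfolding is_weak_gradient_def
  proof (intro ballI allI)
    fix \<phi> i assume \<phi>: "\<phi> \<in> test_functions \<Omega>'"
    note t = test_function_L2[OF L(2) partial_deriv_test_functions[OF \<phi>], of i]
    have "l2_inner \<Omega>' u (partial_deriv i \<phi>) = l2_inner \<Omega>' p (partial_deriv i \<phi>)"
      by (rule l2_inner_cong_AE[OF uL smooth_L2[OF L(2) \<Omega>'(2) p] t t eq']) simp
    also have "\<dots> = - l2_inner \<Omega>' (\<lambda>x. grad p x $ i) \<phi>"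
      using smooth_times_test_partial[OF \<Omega>'(1,2) p \<phi>] by (simp add: grad_def)
    finally show "l2_inner \<Omega>' u (partial_deriv i \<phi>) = - l2_inner \<Omega>' (\<lambda>x. grad p x $ i) \<phi>" .
  qed
  have "AE x in lebesgue_on \<Omega>'. wgrad \<Omega> u x = grad p x"
    by (rule weak_gradient_unique[OF \<Omega>'(1,2) gL pL w1 w2])
  then have "AE x in lebesgue. x \<in> \<Omega>' \<longrightarrow> wgrad \<Omega> u x = grad p x"
    using S by (subst (asm) AE_restrict_space_iff) auto
  then have "AE x in lebesgue. x \<in> \<Omega> \<longrightarrow> x \<in> interior K \<longrightarrow> wgrad \<Omega> u x = grad p x"
    by eventually_elim (auto simp: \<Omega>'_def)
  then show ?thesis using S by (subst AE_restrict_space_iff) auto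
qed

section \<open>Functions with zero boundary values\<close>

lemma l2_norm_dominated_limit:
  fixes f :: "real^3 \<Rightarrow> 'b::euclidean_space"
  assumes S: "S \<in> lmeasurable" and m: "f \<in> borel_measurable (lebesgue_on S)" "\<And>n. s n \<in> borel_measurable (lebesgue_on S)"
    and bd: "\<And>n. AE x in lebesgue_on S. norm (s n x) \<le> B"
    and lim: "AE x in lebesgue_on S. (\<lambda>n. s n x) \<longlonglongrightarrow> f x"
  shows "f \<in> L2 S" "(\<lambda>n. l2_norm S (\<lambda>x. f x - s n x)) \<longlonglongrightarrow> 0"
proof -
  interpret finite_measure "lebesgue_on S"
    by (rule finite_measure_lebesgue_on) (fact S)
  have "AE x in lebesgue_on S. \<forall>n. norm (s n x) \<le> B"
    using bd by (subst AE_all_countable) auto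
  with lim have fB: "AE x in lebesgue_on S. norm (f x) \<le> B"
  proof eventually_elim
    case (elim x)
    then show ?case by (intro LIMSEQ_le_const2[OF tendsto_norm[OF elim(1)]]) auto
  qed
  show "f \<in> L2 S" by (rule L2_bounded[OF S m(1) fB])
  have "(\<lambda>n. LINT x|lebesgue_on S. (f x - s n x) \<bullet> (f x - s n x)) \<longlonglongrightarrow> (LINT x|lebesgue_on S. 0)"
  proof (rule integral_dominated_convergence[where w="\<lambda>x. (2 * B)\<^sup>2"])
    show "(\<lambda>x. (f x - s n x) \<bullet> (f x - s n x)) \<in> borel_measurable (lebesgue_on S)" for n
      using m(1) m(2)[of n] by measurable
    show "AE x in lebesgue_on S. (\<lambda>n. (f x - s n x) \<bullet> (f x - s n x)) \<longlonglongrightarrow> 0"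
      using lim
    proof eventually_elim
      case (elim x)
      have "(\<lambda>n. (f x - s n x) \<bullet> (f x - s n x)) \<longlonglongrightarrow> (f x - f x) \<bullet> (f x - f x)"
        by (intro tendsto_inner tendsto_diff tendsto_const elim)
      then show ?case by simp
    qed
    show "AE x in lebesgue_on S. norm ((f x - s n x) \<bullet> (f x - s n x)) \<le> (2 * B)\<^sup>2" for n
      using fB bd[of n]
    proof eventually_elim
      case (elim x)
      have "norm (f x - s n x) \<le> 2 * B" using norm_triangle_ineq4[of "f x" "s n x"] elim by simp
      then have "(norm (f x - s n x))\<^sup>2 \<le> (2 * B)\<^sup>2" by (rule power_mono) simp
      then show ?case by (simp add: power2_norm_eq_inner)
    qed
  qed simp_all
  then have "(\<lambda>n. sqrt (LINT x|lebesgue_on S. (f x - s n x) \<bullet> (f x - s n x))) \<longlonglongrightarrow> sqrt 0"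
    by (intro tendsto_real_sqrt) simp
  then show "(\<lambda>n. l2_norm S (\<lambda>x. f x - s n x)) \<longlonglongrightarrow> 0"
    by (simp add: l2_norm_def l2_inner_def)
qed

lemma l2_inner_tendsto:
  assumes "f \<in> L2 S" "\<And>n. s n \<in> L2 S" "h \<in> L2 S" and lim: "(\<lambda>n. l2_norm S (\<lambda>x. f x - s n x)) \<longlonglongrightarrow> 0"
  shows "(\<lambda>n. l2_inner S (s n) h) \<longlonglongrightarrow> l2_inner S f h"
proof -
  have "(\<lambda>n. l2_inner S f h - l2_inner S (s n) h) \<longlonglongrightarrow> 0"
  proof (rule Lim_null_comparison)
    show "\<forall>\<^sub>F n in sequentially. norm (l2_inner S f h - l2_inner S (s n) h) \<le> l2_norm S (\<lambda>x. f x - s n x) * l2_norm S h"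
      using l2_inner_Cauchy_Schwarz[OF L2_diff[OF assms(1,2)] assms(3)] l2_inner_diff_left[OF assms(1,2,3)] by simp
    show "(\<lambda>n. l2_norm S (\<lambda>x. f x - s n x) * l2_norm S h) \<longlonglongrightarrow> 0"
      using tendsto_mult_right[OF lim, of "l2_norm S h"] by simp
  qed
  from tendsto_diff[OF tendsto_const[of "l2_inner S f h"] this] show ?thesis by simp
qed

text \<open>An approximating sequence shows membership in \<open>H10\<close> even when the limit \<open>h\<close> of the gradients is not
known to be a gradient of \<open>u\<close>: the weak formulation passes to the limit, and uniqueness then identifies \<open>h\<close>.\<close>

lemma H10_sequentialI:
  assumes \<Omega>: "open \<Omega>" "bounded \<Omega>" and u: "u \<in> L2 \<Omega>" and h: "h \<in> L2 \<Omega>"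
    and \<phi>: "\<And>n. \<phi> n \<in> test_functions \<Omega>"
    and lim: "(\<lambda>n. l2_norm \<Omega> (\<lambda>x. u x - \<phi> n x)) \<longlonglongrightarrow> 0" "(\<lambda>n. l2_norm \<Omega> (\<lambda>x. h x - grad (\<phi> n) x)) \<longlonglongrightarrow> 0"
  shows "u \<in> H10 \<Omega>"
proof -
  have S: "\<Omega> \<in> lmeasurable" using \<Omega> by (intro lmeasurable_open)
  note t = test_function_L2[OF S \<phi>] grad_test_function_L2[OF S \<phi>]
  have w: "is_weak_gradient \<Omega> u h"
    unfolding is_weak_gradient_def
  proof (intro ballI allI)
    fix \<psi> i assume \<psi>: "\<psi> \<in> test_functions \<Omega>"
    note t\<psi> = test_function_L2[OF S \<psi>] test_function_L2[OF S partial_deriv_test_functions[OF \<psi>], of i]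
    have 1: "(\<lambda>n. l2_inner \<Omega> (\<phi> n) (partial_deriv i \<psi>)) \<longlonglongrightarrow> l2_inner \<Omega> u (partial_deriv i \<psi>)"
      by (rule l2_inner_tendsto[OF u t(1) t\<psi>(2) lim(1)])
    have axis: "l2_inner \<Omega> v (\<lambda>x. axis i (\<psi> x)) = l2_inner \<Omega> (\<lambda>x. v x $ i) \<psi>" for v
      by (simp add: l2_inner_def inner_axis)
    have "(\<lambda>n. l2_inner \<Omega> (grad (\<phi> n)) (\<lambda>x. axis i (\<psi> x))) \<longlonglongrightarrow> l2_inner \<Omega> h (\<lambda>x. axis i (\<psi> x))"
      by (rule l2_inner_tendsto[OF h t(2) L2_axis[OF t\<psi>(1)] lim(2)])
    then have "(\<lambda>n. - l2_inner \<Omega> (partial_deriv i (\<phi> n)) \<psi>) \<longlonglongrightarrow> - l2_inner \<Omega> (\<lambda>x. h x $ i) \<psi>"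
      unfolding axis by (intro tendsto_minus) (simp add: grad_def)
    then have 2: "(\<lambda>n. l2_inner \<Omega> (\<phi> n) (partial_deriv i \<psi>)) \<longlonglongrightarrow> - l2_inner \<Omega> (\<lambda>x. h x $ i) \<psi>"
      using smooth_times_test_partial[OF \<Omega> smooth_test_function[OF \<phi>] \<psi>] by simp
    show "l2_inner \<Omega> u (partial_deriv i \<psi>) = - l2_inner \<Omega> (\<lambda>x. h x $ i) \<psi>"
      by (rule LIMSEQ_unique[OF 1 2])
  qed
  note H = wgrad_eqI[OF \<Omega> u h w]
  have eq: "l2_norm \<Omega> (\<lambda>x. wgrad \<Omega> u x - grad (\<phi> n) x) = l2_norm \<Omega> (\<lambda>x. h x - grad (\<phi> n) x)" for n
  proof (rule l2_norm_cong_AE[OF L2_diff[OF wgrad_L2[OF H(1)] t(2)] L2_diff[OF h t(2)]])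
    show "AE x in lebesgue_on \<Omega>. wgrad \<Omega> u x - grad (\<phi> n) x = h x - grad (\<phi> n) x"
      using H(2) by eventually_elim simp
  qed
  have "\<exists>\<phi>\<in>test_functions \<Omega>. l2_norm \<Omega> (\<lambda>x. u x - \<phi> x) < \<epsilon> \<and> l2_norm \<Omega> (\<lambda>x. wgrad \<Omega> u x - grad \<phi> x) < \<epsilon>"
    if "\<epsilon> > 0" for \<epsilon>
  proof -
    have "\<forall>\<^sub>F n in sequentially. l2_norm \<Omega> (\<lambda>x. u x - \<phi> n x) < \<epsilon> \<and> l2_norm \<Omega> (\<lambda>x. h x - grad (\<phi> n) x) < \<epsilon>"
      using order_tendstoD(2)[OF lim(1) that] order_tendstoD(2)[OF lim(2) that] by eventually_elim simp
    then obtain n where "l2_norm \<Omega> (\<lambda>x. u x - \<phi> n x) < \<epsilon>" "l2_norm \<Omega> (\<lambda>x. h x - grad (\<phi> n) x) < \<epsilon>"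
      by (auto simp: eventually_sequentially)
    then show ?thesis using eq \<phi> by (intro bexI[of _ "\<phi> n"]) auto
  qed
  then show ?thesis using H(1) by (simp add: H10_def)
qed

text \<open>The function \<open>t \<mapsto> t \<cdot> flat_exp 1 (N t\<^sup>2 - 1)\<close> vanishes for \<open>\<bar>t\<bar> \<le> 1 / sqrt N\<close>
and approaches the identity as \<open>N\<close> grows. Its derivative at \<open>t\<close> depends on \<open>s = N t\<^sup>2\<close> only and is
given here; it is bounded independently of \<open>N\<close>.\<close>

definition truncation_slope :: "real \<Rightarrow> real" where
  "truncation_slope s = flat_exp 1 (s - 1) + 2 * s * flat_exp (monom 1 2) (s - 1)"

lemma partial_deriv_truncation:
  assumes w: "smooth w"
  shows "partial_deriv i (\<lambda>x. w x * flat_exp 1 (N * (w x)\<^sup>2 - 1)) x = truncation_slope (N * (w x)\<^sup>2) * partial_deriv i w x"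
proof -
  let ?D = "frechet_derivative w (at x)"
  have w': "(w has_derivative ?D) (at x)" by (rule smooth_has_derivative[OF w])
  have a: "((\<lambda>x. N * (w x)\<^sup>2 - 1) has_derivative (\<lambda>h. N * (2 * w x * ?D h))) (at x)"
    by (rule derivative_eq_intros w' refl)+ (auto simp: fun_eq_iff algebra_simps)
  have "((flat_exp 1) has_derivative (*) (flat_exp (monom 1 2) (N * (w x)\<^sup>2 - 1))) (at (N * (w x)\<^sup>2 - 1))"
    using flat_exp_has_derivative[of 1 "N * (w x)\<^sup>2 - 1"] by (simp add: has_field_derivative_def)
  from partial_deriv_eq[OF has_derivative_mult[OF w' has_derivative_compose[OF a this]]]
  show ?thesis
    by (simp add: truncation_slope_def partial_deriv_def algebra_simps power2_eq_square)
qed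

lemma flat_exp_bounds: "0 \<le> flat_exp 1 t" "flat_exp 1 t \<le> 1"
  by (auto simp: flat_exp_def)

lemma truncation_slope_bound: "\<bar>truncation_slope s\<bar> \<le> 5"
proof (cases "s \<le> 1")
  case True
  then show ?thesis by (simp add: truncation_slope_def flat_exp_def)
next
  case False
  \<comment> \<open>In terms of \<open>a\<close> the slope is \<open>exp (-a) + 2 (a\<^sup>2 + a) exp (-a)\<close>, and \<open>exp a\<close> dominates \<open>1 + a + a\<^sup>2/2\<close>.\<close>
  define a where "a = 1 / (s - 1)"
  have a: "a > 0" "s = 1 + 1 / a" using False by (auto simp: a_def)
  have "truncation_slope s = exp (- a) + 2 * ((a\<^sup>2 + a) * exp (- a))"
  proof -
    have "s * a\<^sup>2 = a\<^sup>2 + a" using a by (simp add: field_simps power2_eq_square)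
    then show ?thesis
      using False by (simp add: truncation_slope_def flat_exp_def a_def[symmetric] poly_monom mult.assoc[symmetric])
  qed
  moreover have "(a\<^sup>2 + a) * exp (- a) \<le> 2"
  proof -
    have "1 + a + a\<^sup>2 / 2 \<le> exp a" using exp_lower_Taylor_quadratic[of a] a by simp
    then have "a\<^sup>2 + a \<le> 2 * exp a" using a by linarith
    then show ?thesis by (simp add: exp_minus field_simps)
  qed
  moreover have "exp (- a) \<le> 1" using a by simp
  moreover have "0 \<le> (a\<^sup>2 + a) * exp (- a)" using a by simp
  moreover have "0 \<le> exp (- a)" by simp
  ultimately show ?thesis by linarith
qed

lemma truncation_slope_eq_0: "s \<le> 1 \<Longrightarrow> truncation_slope s = 0"
  by (simp add: truncation_slope_def flat_exp_def)

lemma inverse_shift_tendsto: "((\<lambda>s::real. 1 / (s - 1)) \<longlongrightarrow> 0) at_top"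
proof -
  have "filterlim (\<lambda>s::real. s - 1) at_top at_top"
    using filterlim_tendsto_add_at_top[OF tendsto_const[of "-1"] filterlim_ident] by simp
  from tendsto_inverse_0_at_top[OF this] show ?thesis by (simp add: divide_inverse)
qed

lemma flat_exp_tendsto_1: "((\<lambda>s. flat_exp 1 (s - 1)) \<longlongrightarrow> 1) at_top"
proof (rule Lim_transform_eventually)
  show "((\<lambda>s::real. exp (- (1 / (s - 1)))) \<longlongrightarrow> 1) at_top"
    using tendsto_exp[OF tendsto_minus[OF inverse_shift_tendsto]] by simp
  show "\<forall>\<^sub>F s in at_top. exp (- (1 / (s - 1))) = flat_exp 1 (s - 1)"
    using eventually_gt_at_top[of "1::real"] by eventually_elim (simp add: flat_exp_def)
qed

lemma truncation_slope_tendsto_1: "(truncation_slope \<longlongrightarrow> 1) at_top"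
proof (rule Lim_transform_eventually)
  let ?a = "\<lambda>s::real. 1 / (s - 1)"
  have "((\<lambda>s. exp (- ?a s) + 2 * ((?a s)\<^sup>2 + ?a s) * exp (- ?a s)) \<longlongrightarrow> exp (- 0) + 2 * (0\<^sup>2 + 0) * exp (- 0)) at_top"
    by (intro tendsto_add tendsto_mult tendsto_exp tendsto_minus tendsto_power tendsto_const inverse_shift_tendsto)
  then show "((\<lambda>s. exp (- ?a s) + 2 * ((?a s)\<^sup>2 + ?a s) * exp (- ?a s)) \<longlongrightarrow> 1) at_top"
    by simp
  show "\<forall>\<^sub>F s in at_top. exp (- ?a s) + 2 * ((?a s)\<^sup>2 + ?a s) * exp (- ?a s) = truncation_slope s"
    using eventually_gt_at_top[of "1::real"]
  proof eventually_elim
    case (elim s)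
    have "s * (?a s)\<^sup>2 = (?a s)\<^sup>2 + ?a s"
    proof -
      have "s = 1 + 1 / ?a s" "?a s \<noteq> 0" using elim by auto
      then have "s * (?a s)\<^sup>2 = (1 + 1 / ?a s) * (?a s)\<^sup>2" by simp
      also have "\<dots> = (?a s)\<^sup>2 + ?a s"
        using \<open>?a s \<noteq> 0\<close> by (simp only: distrib_right power2_eq_square) simp
      finally show ?thesis .
    qed
    then show ?case
      using elim by (simp add: truncation_slope_def flat_exp_def poly_monom mult.assoc[symmetric] del: power_divide)
  qed
qed

text \<open>Differentiating the kernel, the derivative of the mollification is the integral of \<open>g\<close> against
\<open>-\<partial>\<^sub>i\<psi>\<close>, where \<open>\<psi> y = mollifier \<delta> (x - y)\<close>. As the ball around \<open>x\<close> lies in \<open>\<Omega>\<close>, \<open>\<psi>\<close> is a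
test function, and the definition of the weak gradient applies to it.\<close>

lemma partial_deriv_mollify_weak:
  assumes \<Omega>: "open \<Omega>" "bounded \<Omega>" and w: "is_weak_gradient \<Omega> u h"
    and g: "continuous_on UNIV g" "\<And>x. x \<notin> \<Omega> \<Longrightarrow> g x = 0" 
    and L: "u \<in> L2 \<Omega>" and eq: "AE x in lebesgue_on \<Omega>. u x = g x"
    and \<delta>: "\<delta> > 0" "cball x \<delta> \<subseteq> \<Omega>"
  shows "partial_deriv i (mollify \<delta> g) x = mollify \<delta> (\<lambda>y. if y \<in> \<Omega> then h y $ i else 0) x"
proof -
  have Lm: "\<Omega> \<in> lmeasurable" using \<Omega> by (intro lmeasurable_open)
  then have S: "\<Omega> \<in> sets lebesgue" by blast
  define \<psi> where "\<psi> y = mollifier \<delta> (x - y)" for y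
  have \<psi>: "\<psi> \<in> test_functions \<Omega>"
    unfolding \<psi>_def[abs_def]
    by (rule test_functionsI[OF smooth_reflect[OF smooth_mollifier] compact_cball \<delta>(2)])
       (use \<delta> in \<open>auto intro!: mollifier_eq_0 simp: dist_norm\<close>)
  have d\<psi>: "partial_deriv i \<psi> y = - partial_deriv i (mollifier \<delta>) (x - y)" for y
    unfolding \<psi>_def[abs_def] by (simp add: partial_deriv_reflect[OF smooth_mollifier])
  note t = test_function_L2[OF Lm partial_deriv_test_functions[OF \<psi>], of i]
  have gc: "g y = 0" if "y \<notin> closure \<Omega>" for y using that closure_subset g(2) by blast
  have comp: "compact (closure \<Omega>)" using \<Omega> by (simp add: compact_closure)
  have gL: "g \<in> L2 \<Omega>"
  proof -
    obtain B where "\<forall>x. \<bar>g x\<bar> \<le> B"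
      using compact_support_bounded[OF g(1) comp gc] by blast
    then show ?thesis by (intro L2_bounded[OF Lm continuous_lebesgue_measurable[OF g(1)], of B]) simp
  qed
  have "partial_deriv i (mollify \<delta> g) x = (LINT y|lebesgue. g y * partial_deriv i (mollifier \<delta>) (x - y))"
    by (rule mollify_smooth(2)[OF g(1) comp gc])
  also have "\<dots> = - (LINT y|lebesgue. g y * partial_deriv i \<psi> y)"
    by (simp add: d\<psi>)
  also have "(LINT y|lebesgue. g y * partial_deriv i \<psi> y) = l2_inner \<Omega> g (partial_deriv i \<psi>)"
    using lebesgue_on_integral_eq[OF S, of "\<lambda>y. g y * partial_deriv i \<psi> y"] g(2) by (simp add: l2_inner_def)
  also have "\<dots> = l2_inner \<Omega> u (partial_deriv i \<psi>)"
    by (rule l2_inner_cong_AE[OF L gL t t eq, symmetric]) simp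
  also have "\<dots> = - l2_inner \<Omega> (\<lambda>y. h y $ i) \<psi>"
    using w \<psi> by (simp add: is_weak_gradient_def)
  also have "l2_inner \<Omega> (\<lambda>y. h y $ i) \<psi> = (LINT y|lebesgue_on \<Omega>. (if y \<in> \<Omega> then h y $ i else 0) * \<psi> y)"
    unfolding l2_inner_def by (intro Bochner_Integration.integral_cong) auto
  also have "\<dots> = mollify \<delta> (\<lambda>y. if y \<in> \<Omega> then h y $ i else 0) x"
    unfolding mollify_def \<psi>_def[symmetric] by (rule lebesgue_on_integral_eq[OF S]) simp
  finally show ?thesis by simp
qed

text \<open>The function \<open>g\<close> is the continuous representative of \<open>u\<close>, extended by \<open>0\<close>. Mollify \<open>g\<close> so finely that the error stays
below \<open>\<epsilon>/2\<close>, and truncate the values of modulus at most \<open>\<epsilon>\<close>. What survives lives where \<open>\<bar>g\<bar> \<ge> \<epsilon>/2\<close>, a compact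
subset of \<open>\<Omega>\<close> because \<open>g\<close> vanishes on the boundary. There the gradient is the truncation slope times
the mollified weak gradient. As \<open>\<epsilon>\<close> tends to \<open>0\<close>, it converges to \<open>wgrad u\<close> where \<open>g \<noteq> 0\<close> and to \<open>0\<close> where \<open>g = 0\<close>,
boundedly and almost everywhere, hence in \<open>L2\<close>; \<open>H10_sequentialI\<close> accepts this limit.
The last hypothesis, continuity of the weak gradient at almost every point up to null sets, makes the mollified gradients
converge pointwise; it holds for piecewise polynomials.\<close>

lemma H10_zero_boundary_values:
  assumes \<Omega>: "open \<Omega>" "bounded \<Omega>" and u: "u \<in> H1 \<Omega>"
    and g: "continuous_on UNIV g" "\<And>x. x \<notin> \<Omega> \<Longrightarrow> g x = 0" and ug: "AE x in lebesgue_on \<Omega>. u x = g x"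
    and bd: "\<And>i. AE x in lebesgue_on \<Omega>. \<bar>wgrad \<Omega> u x $ i\<bar> \<le> B"
    and cont: "AE x in lebesgue_on \<Omega>. \<forall>i. \<forall>e>0. \<exists>d>0. AE y in lebesgue. dist x y < d \<longrightarrow> y \<in> \<Omega> \<and> \<bar>wgrad \<Omega> u y $ i - wgrad \<Omega> u x $ i\<bar> \<le> e"
  shows "u \<in> H10 \<Omega>"
proof -
  have Lm: "\<Omega> \<in> lmeasurable" using \<Omega> by (intro lmeasurable_open)
  then have S: "\<Omega> \<in> sets lebesgue" by blast
  have gc: "g y = 0" if "y \<notin> closure \<Omega>" for y using that closure_subset g(2) by blast
  have comp: "compact (closure \<Omega>)" using \<Omega> by (simp add: compact_closure)
  define B' where "B' = max B 0"
  have bd': "AE x in lebesgue_on \<Omega>. \<bar>wgrad \<Omega> u x $ i\<bar> \<le> B'" for i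
    using bd[of i] by eventually_elim (simp add: B'_def)
  define Q where "Q i y = (if y \<in> \<Omega> then wgrad \<Omega> u y $ i else 0)" for i y
  have Qm: "Q i \<in> borel_measurable lebesgue" for i
    using borel_measurable_if[OF S, of "\<lambda>y. wgrad \<Omega> u y $ i"] L2_measurable[OF L2_component[OF wgrad_L2[OF u]], of i]
    unfolding Q_def[abs_def] by (simp add: borel_measurable_if)
  have QB: "AE y in lebesgue. \<bar>Q i y - 0\<bar> \<le> B'" for i
  proof -
    have "AE y in lebesgue. y \<in> \<Omega> \<longrightarrow> \<bar>wgrad \<Omega> u y $ i\<bar> \<le> B'"
      using bd'[of i] S by (subst (asm) AE_restrict_space_iff) auto
    then show ?thesis by eventually_elim (simp add: Q_def B'_def)
  qed
  define \<epsilon> where "\<epsilon> n = inverse (real (Suc n))" for n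
  have \<epsilon>: "\<epsilon> n > 0" for n by (simp add: \<epsilon>_def)
  have \<epsilon>0: "\<epsilon> \<longlonglongrightarrow> 0" unfolding \<epsilon>_def by (rule LIMSEQ_inverse_real_of_nat)
  define C where "C n = {x. \<epsilon> n / 2 \<le> \<bar>g x\<bar>}" for n
  have C\<Omega>: "C n \<subseteq> \<Omega>" for n
  proof
    fix x assume "x \<in> C n"
    then have "g x \<noteq> 0" using \<epsilon>[of n] by (auto simp: C_def)
    then show "x \<in> \<Omega>" using g(2) by blast
  qed
  have Cc: "compact (C n)" for n
  proof -
    have "closed (C n)"
      unfolding C_def by (intro closed_Collect_le continuous_intros g(1))
    moreover have "bounded (C n)" using C\<Omega> \<Omega>(2) bounded_subset by blast
    ultimately show ?thesis by (simp add: compact_eq_bounded_closed)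
  qed
  have "\<exists>d>0. d \<le> \<epsilon> n \<and> (\<forall>x\<in>C n. cball x d \<subseteq> \<Omega>) \<and> (\<forall>x y. dist x y < d \<longrightarrow> \<bar>g x - g y\<bar> \<le> \<epsilon> n / 2)" for n
  proof -
    obtain r where r: "r > 0" "(\<Union>x\<in>C n. cball x r) \<subseteq> \<Omega>"
      using compact_subset_open_imp_cball_epsilon_subset[OF Cc \<Omega>(1) C\<Omega>] by blast
    have "\<epsilon> n / 2 > 0" using \<epsilon>[of n] by simp
    then obtain d where d: "d > 0" "\<And>x y. dist x y < d \<Longrightarrow> \<bar>g x - g y\<bar> \<le> \<epsilon> n / 2"
      using compact_support_uniform[OF g(1) comp gc] by metis
    have "cball x (min (\<epsilon> n) (min d r)) \<subseteq> \<Omega>" if "x \<in> C n" for x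
      using r(2) that by fastforce
    then show ?thesis using r(1) d \<epsilon>[of n] by (intro exI[of _ "min (\<epsilon> n) (min d r)"]) auto
  qed
  then obtain \<delta> where \<delta>: "\<And>n. \<delta> n > 0" "\<And>n. \<delta> n \<le> \<epsilon> n" "\<And>n x. x \<in> C n \<Longrightarrow> cball x (\<delta> n) \<subseteq> \<Omega>"
    "\<And>n x y. dist x y < \<delta> n \<Longrightarrow> \<bar>g x - g y\<bar> \<le> \<epsilon> n / 2"
    by metis
  have \<delta>0: "\<delta> \<longlonglongrightarrow> 0"
    by (rule Lim_null_comparison[OF _ \<epsilon>0]) (use \<delta>(1,2) in \<open>simp add: less_imp_le\<close>)
  define w where "w n = mollify (\<delta> n) g" for n
  have sw: "smooth (w n)" for n unfolding w_def by (rule mollify_smooth(1)[OF g(1) comp gc])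
  have gm: "g \<in> borel_measurable lebesgue"
    using continuous_lebesgue_measurable[OF g(1), of UNIV] by (simp add: lebesgue_on_UNIV_eq)
  have wg: "\<bar>w n x - g x\<bar> \<le> \<epsilon> n / 2" for n x
    unfolding w_def
  proof (rule mollify_near(2)[OF \<delta>(1) gm], intro AE_I2 impI)
    fix y assume "dist x y < \<delta> n"
    then show "\<bar>g y - g x\<bar> \<le> \<epsilon> n / 2" using \<delta>(4)[of y x n] by (simp add: dist_commute)
  qed
  have wlim: "(\<lambda>n. w n x) \<longlonglongrightarrow> g x" for x
  proof -
    have "(\<lambda>n. \<epsilon> n / 2) \<longlonglongrightarrow> 0" using tendsto_divide[OF \<epsilon>0 tendsto_const[of 2]] by simp
    then have "(\<lambda>n. w n x - g x) \<longlonglongrightarrow> 0"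
      by (rule Lim_null_comparison[rotated]) (use wg in simp)
    from tendsto_add[OF this tendsto_const[of "g x"]] show ?thesis by simp
  qed
  \<comment> \<open>This is \<open>1 / \<epsilon>\<^sup>2\<close>, so truncation removes exactly the values of modulus at most \<open>\<epsilon> n\<close>.\<close>
  define N where "N n = (real (Suc n))\<^sup>2" for n
  have N: "N n * (\<epsilon> n)\<^sup>2 = 1" "N n > 0" for n by (simp_all add: N_def \<epsilon>_def power_inverse)
  define s where "s n x = N n * (w n x)\<^sup>2" for n x
  have s_le: "s n x \<le> 1" if "x \<notin> C n \<or> g x = 0" for n x
  proof -
    have "\<bar>w n x\<bar> \<le> \<bar>w n x - g x\<bar> + \<bar>g x\<bar>" by linarith
    moreover have "\<bar>g x\<bar> \<le> \<epsilon> n / 2" using that \<epsilon>[of n] by (auto simp: C_def)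
    ultimately have "\<bar>w n x\<bar> \<le> \<epsilon> n" using wg[of n x] by linarith
    then have "(w n x)\<^sup>2 \<le> (\<epsilon> n)\<^sup>2" using \<epsilon>[of n] by (simp add: abs_le_square_iff[symmetric])
    then have "s n x \<le> N n * (\<epsilon> n)\<^sup>2" unfolding s_def using N(2)[of n] by (intro mult_left_mono) auto
    then show ?thesis using N by simp
  qed
  have s_lim: "filterlim (\<lambda>n. s n x) at_top sequentially" if "g x \<noteq> 0" for x
  proof -
    have "(\<lambda>n. (w n x)\<^sup>2) \<longlonglongrightarrow> (g x)\<^sup>2" by (intro tendsto_power wlim)
    moreover have "(g x)\<^sup>2 > 0" using that by simp
    moreover have "filterlim N at_top sequentially"
      unfolding N_def
      by (intro filterlim_pow_at_top filterlim_compose[OF filterlim_real_sequentially filterlim_Suc]) simp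
    ultimately have "filterlim (\<lambda>n. (w n x)\<^sup>2 * N n) at_top sequentially"
      by (rule filterlim_tendsto_pos_mult_at_top)
    then show ?thesis by (simp add: s_def mult.commute)
  qed
  define \<phi> where "\<phi> n x = w n x * flat_exp 1 (N n * (w n x)\<^sup>2 - 1)" for n x
  have s\<phi>: "smooth (\<phi> n)" for n
    unfolding \<phi>_def by (intro smooth_mult sw smooth_flat_exp smooth_diff smooth_const smooth_power)
  have \<phi>test: "\<phi> n \<in> test_functions \<Omega>" for n
  proof (rule test_functionsI[OF s\<phi> Cc C\<Omega>])
    fix x assume "x \<notin> C n"
    then show "\<phi> n x = 0" using s_le[of x n] by (simp add: \<phi>_def s_def flat_exp_def)
  qed
  have d\<phi>: "partial_deriv i (\<phi> n) x = truncation_slope (s n x) * mollify (\<delta> n) (Q i) x" for i n x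
  proof (cases "x \<in> C n")
    case True
    have "partial_deriv i (w n) x = mollify (\<delta> n) (Q i) x"
      unfolding w_def Q_def[abs_def]
      by (rule partial_deriv_mollify_weak[OF \<Omega> wgrad_weak[OF u] g H1_L2[OF u] ug \<delta>(1) \<delta>(3)[OF True]])
    then show ?thesis
      unfolding \<phi>_def[abs_def] s_def by (simp add: partial_deriv_truncation[OF sw])
  next
    case False
    then have "truncation_slope (s n x) = 0" by (intro truncation_slope_eq_0 s_le) simp
    then show ?thesis
      unfolding \<phi>_def[abs_def] using partial_deriv_truncation[OF sw, of i n "N n" x] by (simp add: s_def)
  qed
  have d\<phi>B: "\<bar>partial_deriv i (\<phi> n) x\<bar> \<le> 5 * B'" for i n x
  proof -
    have "AE y in lebesgue. dist x y < \<delta> n \<longrightarrow> \<bar>Q i y - 0\<bar> \<le> B'"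
      using QB[of i] by eventually_elim simp
    from mollify_near(2)[OF \<delta>(1) Qm this] have "\<bar>mollify (\<delta> n) (Q i) x\<bar> \<le> B'" by simp
    then show ?thesis
      unfolding d\<phi> abs_mult by (intro mult_mono truncation_slope_bound) auto
  qed
  have molim: "AE x in lebesgue_on \<Omega>. \<forall>i. (\<lambda>n. mollify (\<delta> n) (Q i) x) \<longlonglongrightarrow> wgrad \<Omega> u x $ i"
    using cont
  proof eventually_elim
    case (elim x)
    show ?case
    proof (intro allI LIMSEQ_I)
      fix i :: 3 and r :: real assume "r > 0"
      then have "r / 2 > 0" by simp
      then obtain d where d: "d > 0" "AE y in lebesgue. dist x y < d \<longrightarrow> y \<in> \<Omega> \<and> \<bar>wgrad \<Omega> u y $ i - wgrad \<Omega> u x $ i\<bar> \<le> r / 2"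
        using elim by blast
      obtain no where no: "\<And>n. n \<ge> no \<Longrightarrow> \<delta> n < d"
        using order_tendstoD(2)[OF \<delta>0 d(1)] by (auto simp: eventually_sequentially)
      have "norm (mollify (\<delta> n) (Q i) x - wgrad \<Omega> u x $ i) < r" if "n \<ge> no" for n
      proof -
        have "AE y in lebesgue. dist x y < \<delta> n \<longrightarrow> \<bar>Q i y - wgrad \<Omega> u x $ i\<bar> \<le> r / 2"
          using d(2) by eventually_elim (use no[OF that] in \<open>auto simp: Q_def\<close>)
        from mollify_near(2)[OF \<delta>(1) Qm this] show ?thesis using \<open>r > 0\<close> by simp
      qed
      then show "\<exists>no. \<forall>n\<ge>no. norm (mollify (\<delta> n) (Q i) x - wgrad \<Omega> u x $ i) < r" by blast
    qed
  qed
  \<comment> \<open>Where \<open>g\<close> vanishes, the mollified value is at most \<open>\<epsilon> n / 2\<close> and every truncation slope is \<open>0\<close>.\<close>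
  define h where "h x = (if g x = 0 then 0 else wgrad \<Omega> u x)" for x
  have hm: "h \<in> borel_measurable (lebesgue_on \<Omega>)"
    unfolding h_def using continuous_lebesgue_measurable[OF g(1), of \<Omega>] L2_measurable[OF wgrad_L2[OF u]]
    by measurable
  have glim: "AE x in lebesgue_on \<Omega>. (\<lambda>n. grad (\<phi> n) x) \<longlonglongrightarrow> h x"
    using molim
  proof eventually_elim
    case (elim x)
    have "(\<lambda>n. partial_deriv i (\<phi> n) x) \<longlonglongrightarrow> h x $ i" for i
    proof (cases "g x = 0")
      case True
      then have "truncation_slope (s n x) = 0" for n by (intro truncation_slope_eq_0 s_le) simp
      then show ?thesis using True by (simp add: d\<phi> h_def)
    next
      case False
      have "(\<lambda>n. truncation_slope (s n x)) \<longlonglongrightarrow> 1"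
        by (rule filterlim_compose[OF truncation_slope_tendsto_1 s_lim[OF False]])
      from tendsto_mult[OF this spec[OF elim, of i]] show ?thesis using False by (simp add: d\<phi> h_def)
    qed
    then show ?case by (intro vec_tendstoI) (simp add: grad_def)
  qed
  have gB: "norm (grad (\<phi> n) x) \<le> 3 * (5 * B')" for n x
  proof -
    have "norm (grad (\<phi> n) x) \<le> (\<Sum>i\<in>UNIV. \<bar>grad (\<phi> n) x $ i\<bar>)" by (rule norm_le_l1_cart)
    also have "\<dots> \<le> (\<Sum>i\<in>(UNIV::3 set). 5 * B')" by (intro sum_mono) (simp add: grad_def d\<phi>B)
    finally show ?thesis by simp
  qed
  note hlim = l2_norm_dominated_limit[OF Lm hm L2_measurable[OF grad_test_function_L2[OF Lm \<phi>test]] AE_I2[OF gB] glim]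
  obtain M where M: "\<And>x. \<bar>g x\<bar> \<le> M" 
    using compact_support_bounded[OF g(1) comp gc] by blast
  have \<phi>B: "norm (\<phi> n x) \<le> M + 1" for n x
  proof -
    have "\<bar>\<phi> n x\<bar> \<le> \<bar>w n x\<bar> * 1"
      unfolding \<phi>_def abs_mult using flat_exp_bounds[of "N n * (w n x)\<^sup>2 - 1"] by (intro mult_left_mono) auto
    also have "\<dots> \<le> M + \<epsilon> n / 2" using wg[of n x] M[of x] by linarith
    also have "\<epsilon> n / 2 \<le> 1" by (simp add: \<epsilon>_def field_simps)
    finally show ?thesis by simp
  qed
  have \<phi>lim: "(\<lambda>n. \<phi> n x) \<longlonglongrightarrow> g x" for x
  proof (cases "g x = 0")
    case True
    then have "\<phi> n x = 0" for n using s_le[of x n] by (simp add: \<phi>_def s_def flat_exp_def)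
    then show ?thesis using True by simp
  next
    case False
    have "(\<lambda>n. flat_exp 1 (s n x - 1)) \<longlonglongrightarrow> 1"
      by (rule filterlim_compose[OF flat_exp_tendsto_1 s_lim[OF False]])
    from tendsto_mult[OF wlim[of x] this] show ?thesis by (simp add: \<phi>_def s_def)
  qed
  have "AE x in lebesgue_on \<Omega>. (\<lambda>n. \<phi> n x) \<longlonglongrightarrow> u x"
    using ug by eventually_elim (simp add: \<phi>lim)
  note ulim = l2_norm_dominated_limit[OF Lm L2_measurable[OF H1_L2[OF u]] L2_measurable[OF test_function_L2[OF Lm \<phi>test]] AE_I2[OF \<phi>B] this]
  show ?thesis
    by (rule H10_sequentialI[OF \<Omega> H1_L2[OF u] hlim(1) \<phi>test ulim(2) hlim(2)])
qed

text \<open>By \<open>wgrad_piecewise_smooth\<close> the weak gradient agrees almost everywhere with the gradients of the finitely many polynomials on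
the closed cells, so it is bounded, and inside a cell it is continuous up to a null set.\<close>

lemma U_h0_subset_H10:
  assumes \<Omega>: "open \<Omega>" "bounded \<Omega>" and mesh: "tetrahedral_mesh \<Omega> \<T>" and u: "u \<in> U_h0 \<Omega> \<T> k"
  shows "u \<in> H10 \<Omega>"
proof -
  have S: "\<Omega> \<in> sets lebesgue" using lmeasurable_open[OF \<Omega>(2,1)] by blast
  have uH: "u \<in> H1 \<Omega>" and uX: "u \<in> X_h \<T> k" using u by (auto simp: U_h0_def U_h_def)
  obtain g where g: "continuous_on (closure \<Omega>) g" "AE x in lebesgue_on \<Omega>. u x = g x" "\<And>x. x \<in> frontier \<Omega> \<Longrightarrow> g x = 0"
    using u by (auto simp: U_h0_def)
  define G where "G x = (if x \<in> \<Omega> then g x else 0)" for x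
  have "continuous_on (closure \<Omega> \<union> - \<Omega>) G"
    unfolding G_def
    by (rule continuous_on_cases) (use \<Omega> g in \<open>auto simp: frontier_def interior_open\<close>)
  moreover have "closure \<Omega> \<union> - \<Omega> = UNIV" using closure_subset by blast
  ultimately have G: "continuous_on UNIV G" by simp
  have uG: "AE x in lebesgue_on \<Omega>. u x = G x"
    using g(2) AE_space[of "lebesgue_on \<Omega>"] by eventually_elim (simp add: G_def)
  have "\<forall>K\<in>\<T>. \<exists>p\<in>polys k. AE x in lebesgue_on K. u x = p x" using uX by (simp add: X_h_def)
  then obtain p where p: "\<And>K. K \<in> \<T> \<Longrightarrow> p K \<in> polys k" "\<And>K. K \<in> \<T> \<Longrightarrow> AE x in lebesgue_on K. u x = p K x"
    by metis
  have sp: "smooth (p K)" if "K \<in> \<T>" for K using smooth_polys[OF p(1)[OF that]] .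
  have Ks: "K \<in> sets lebesgue" if "K \<in> \<T>" for K
    using lmeasurable_compact[OF mesh_cell(1)[OF mesh that]] by blast
  have fin: "finite \<T>" by (rule mesh_finite[OF mesh])
  have wK: "AE x in lebesgue_on \<Omega>. \<forall>K\<in>\<T>. x \<in> interior K \<longrightarrow> wgrad \<Omega> u x = grad (p K) x"
    using fin by (intro AE_finite_allI wgrad_piecewise_smooth[OF \<Omega> uH sp Ks p(2)])
  from wK have wp: "AE x in lebesgue. x \<in> \<Omega> \<longrightarrow> (\<forall>K\<in>\<T>. x \<in> interior K \<longrightarrow> wgrad \<Omega> u x = grad (p K) x)"
    using S by (subst (asm) AE_restrict_space_iff) auto
  have "\<exists>B. \<forall>x\<in>K. \<bar>partial_deriv i (p K) x\<bar> \<le> B" if "K \<in> \<T>" for K i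
  proof -
    have "compact (partial_deriv i (p K) ` K)"
      by (intro compact_continuous_image smooth_continuous smooth_partial_deriv sp that mesh_cell(1)[OF mesh that])
    then show ?thesis using compact_imp_bounded by (force simp: bounded_iff)
  qed
  then obtain b where b: "\<And>K i x. K \<in> \<T> \<Longrightarrow> x \<in> K \<Longrightarrow> \<bar>partial_deriv i (p K) x\<bar> \<le> b K i" by metis
  define B where "B = (\<Sum>K\<in>\<T>. \<Sum>i\<in>UNIV. \<bar>b K i\<bar>)"
  have B: "\<bar>partial_deriv i (p K) x\<bar> \<le> B" if "K \<in> \<T>" "x \<in> K" for K i x
  proof -
    have "\<bar>partial_deriv i (p K) x\<bar> \<le> \<bar>b K i\<bar>" using b[OF that, of i] by simp
    also have "\<dots> \<le> (\<Sum>i\<in>UNIV. \<bar>b K i\<bar>)" by (rule member_le_sum) auto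
    also have "\<dots> \<le> B" unfolding B_def 
      by (rule member_le_sum[OF \<open>K \<in> \<T>\<close>, of "\<lambda>K. \<Sum>i\<in>UNIV. \<bar>b K i\<bar>"]) (auto intro: sum_nonneg fin)
    finally show ?thesis .
  qed
  have wp': "AE x in lebesgue_on \<Omega>. x \<in> \<Omega> \<and> (\<exists>K\<in>\<T>. x \<in> interior K \<and> wgrad \<Omega> u x = grad (p K) x)"
    using AE_mesh_interior[OF \<Omega> mesh] wK AE_space[of "lebesgue_on \<Omega>"]
    by eventually_elim auto
  show ?thesis
  proof (rule H10_zero_boundary_values[OF \<Omega> uH G _ uG])
    show "G x = 0" if "x \<notin> \<Omega>" for x using that by (simp add: G_def)
    show "AE x in lebesgue_on \<Omega>. \<bar>wgrad \<Omega> u x $ i\<bar> \<le> B" for i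
      using wp'
    proof eventually_elim
      case (elim x)
      then obtain K where "K \<in> \<T>" "x \<in> interior K" "wgrad \<Omega> u x = grad (p K) x" by blast
      then show ?case using B[of K x i] interior_subset[of K] by (auto simp: grad_def)
    qed
    show "AE x in lebesgue_on \<Omega>. \<forall>i. \<forall>e>0. \<exists>d>0. AE y in lebesgue. dist x y < d \<longrightarrow> y \<in> \<Omega> \<and> \<bar>wgrad \<Omega> u y $ i - wgrad \<Omega> u x $ i\<bar> \<le> e"
      using wp'
    proof eventually_elim
      case (elim x)
      then obtain K where K: "K \<in> \<T>" "x \<in> interior K" "wgrad \<Omega> u x = grad (p K) x" by blast
      show ?case
      proof (intro allI impI)
        fix i :: 3 and e :: real assume "e > 0"
        have "open (\<Omega> \<inter> interior K)" using \<Omega> by blast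
        then obtain r where r: "r > 0" "ball x r \<subseteq> \<Omega> \<inter> interior K"
          using elim K openE by blast
        have "continuous_on UNIV (partial_deriv i (p K))"
          by (intro smooth_continuous smooth_partial_deriv sp K)
        then obtain d where d: "d > 0" "\<And>y. dist y x < d \<Longrightarrow> dist (partial_deriv i (p K) y) (partial_deriv i (p K) x) < e"
          using \<open>e > 0\<close> unfolding continuous_on_iff by (metis UNIV_I)
        have "AE y in lebesgue. dist x y < min r d \<longrightarrow> y \<in> \<Omega> \<and> \<bar>wgrad \<Omega> u y $ i - wgrad \<Omega> u x $ i\<bar> \<le> e"
          using wp
        proof eventually_elim
          case (elim y)
          show ?case
          proof
            assume y: "dist x y < min r d"
            then have "y \<in> \<Omega>" "y \<in> interior K" using r(2) by auto
            then have "wgrad \<Omega> u y = grad (p K) y" using elim K(1) by blast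
            then show "y \<in> \<Omega> \<and> \<bar>wgrad \<Omega> u y $ i - wgrad \<Omega> u x $ i\<bar> \<le> e"
              using d(2)[of y] y \<open>y \<in> \<Omega>\<close> K(3) by (simp add: grad_def dist_real_def dist_commute less_imp_le)
          qed
        qed
        then show "\<exists>d>0. AE y in lebesgue. dist x y < d \<longrightarrow> y \<in> \<Omega> \<and> \<bar>wgrad \<Omega> u y $ i - wgrad \<Omega> u x $ i\<bar> \<le> e"
          using r(1) d(1) by (intro exI[of _ "min r d"]) auto
      qed
    qed
  qed
qed

lemma V_h_subset_V_space:
  assumes "open \<Omega>" "bounded \<Omega>" "tetrahedral_mesh \<Omega> \<T>"
  shows "V_h \<Omega> \<T> k \<subseteq> V_space \<Omega>"
  using U_h0_subset_H10[OF assms] by (auto simp: V_h_def V_space_def)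

section \<open>Orthogonal projection onto piecewise polynomials\<close>

text \<open>Gram-Schmidt, one function at a time: to include \<open>b j\<close>, correct the residual \<open>r\<close> of \<open>f\<close> by a multiple of the residual \<open>b'\<close>
of \<open>b j\<close>. If \<open>b'\<close> has norm \<open>0\<close>, it is orthogonal to \<open>r\<close> by the Cauchy-Schwarz inequality, and the
quotient \<open>t\<close> takes the value \<open>0\<close> by the convention for division by zero.\<close>

lemma L2_orthogonal_projection:
  assumes "finite I" "\<And>i. i \<in> I \<Longrightarrow> b i \<in> L2 \<Omega>" "f \<in> L2 \<Omega>"
  shows "\<exists>c. \<forall>j\<in>I. l2_inner \<Omega> (\<lambda>x. f x - (\<Sum>i\<in>I. c i *\<^sub>R b i x)) (b j) = 0"
  using assms
proof (induction I arbitrary: f rule: finite_induct)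
  case empty
  then show ?case by simp
next
  case (insert j I)
  have bL: "b i \<in> L2 \<Omega>" if "i \<in> insert j I" for i using insert.prems that by blast
  obtain c where c: "\<And>i. i \<in> I \<Longrightarrow> l2_inner \<Omega> (\<lambda>x. f x - (\<Sum>i\<in>I. c i *\<^sub>R b i x)) (b i) = 0"
    using insert.IH[of f] insert.prems by blast
  obtain d where d: "\<And>i. i \<in> I \<Longrightarrow> l2_inner \<Omega> (\<lambda>x. b j x - (\<Sum>i\<in>I. d i *\<^sub>R b i x)) (b i) = 0"
    using insert.IH[of "b j"] insert.prems by blast
  define r where "r x = f x - (\<Sum>i\<in>I. c i *\<^sub>R b i x)" for x
  define b' where "b' x = b j x - (\<Sum>i\<in>I. d i *\<^sub>R b i x)" for x
  have sL: "(\<lambda>x. \<Sum>i\<in>I. a i *\<^sub>R b i x) \<in> L2 \<Omega>" for a :: "'a \<Rightarrow> real"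
    using insert.hyps(1) bL by (intro L2_sum L2_scale) auto
  have rL: "r \<in> L2 \<Omega>" unfolding r_def using insert.prems sL by (intro L2_diff)
  have b'L: "b' \<in> L2 \<Omega>" unfolding b'_def using bL sL by (intro L2_diff) auto
  define t where "t = l2_inner \<Omega> r b' / l2_inner \<Omega> b' b'"
  define r' where "r' x = r x - t *\<^sub>R b' x" for x
  have r'L: "r' \<in> L2 \<Omega>" unfolding r'_def by (intro L2_diff L2_scale rL b'L)
  have r': "l2_inner \<Omega> r' h = l2_inner \<Omega> r h - t * l2_inner \<Omega> b' h" if "h \<in> L2 \<Omega>" for h
    unfolding r'_def using l2_inner_diff_left[OF rL L2_scale[OF b'L] that, of t] by (simp add: l2_inner_scale_left)
  have orthI: "l2_inner \<Omega> r' (b i) = 0" if "i \<in> I" for i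
    using r'[OF bL, of i] c[OF that] d[OF that] that by (simp add: r_def[abs_def] b'_def[abs_def])
  have "l2_inner \<Omega> r' b' = 0"
  proof (cases "l2_inner \<Omega> b' b' = 0")
    case True
    then have "l2_norm \<Omega> b' = 0" by (simp add: l2_norm_def)
    then have "l2_inner \<Omega> r b' = 0" using l2_inner_Cauchy_Schwarz[OF rL b'L] by simp
    then show ?thesis using r'[OF b'L] True by simp
  next
    case False
    then show ?thesis using r'[OF b'L] by (simp add: t_def)
  qed
  moreover have "l2_inner \<Omega> r' (\<lambda>x. \<Sum>i\<in>I. d i *\<^sub>R b i x) = 0"
  proof -
    have "l2_inner \<Omega> r' (\<lambda>x. \<Sum>i\<in>I. d i *\<^sub>R b i x) = (LINT x|lebesgue_on \<Omega>. (\<Sum>i\<in>I. r' x \<bullet> (d i *\<^sub>R b i x)))"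
      by (simp add: l2_inner_def inner_sum_right)
    also have "\<dots> = (\<Sum>i\<in>I. LINT x|lebesgue_on \<Omega>. r' x \<bullet> (d i *\<^sub>R b i x))"
      using r'L bL by (intro Bochner_Integration.integral_sum integrable_L2_inner L2_scale) auto
    also have "\<dots> = 0"
      using orthI by (simp add: l2_inner_def)
    finally show ?thesis .
  qed
  ultimately have orthj: "l2_inner \<Omega> r' (b j) = 0"
    using l2_inner_diff_right[OF bL[of j] sL r'L, of d] unfolding b'_def[abs_def] by simp
  define c' where "c' i = (if i = j then t else c i - t * d i)" for i
  have "r' = (\<lambda>x. f x - (\<Sum>i\<in>insert j I. c' i *\<^sub>R b i x))"
  proof
    fix x
    have "(\<Sum>i\<in>I. c' i *\<^sub>R b i x) = (\<Sum>i\<in>I. c i *\<^sub>R b i x) - t *\<^sub>R (\<Sum>i\<in>I. d i *\<^sub>R b i x)"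
    proof -
      have "(\<Sum>i\<in>I. c' i *\<^sub>R b i x) = (\<Sum>i\<in>I. c i *\<^sub>R b i x - t *\<^sub>R (d i *\<^sub>R b i x))"
        using insert.hyps(2) by (intro sum.cong) (auto simp: c'_def algebra_simps)
      then show ?thesis by (simp add: sum_subtractf scaleR_sum_right)
    qed
    then show "r' x = f x - (\<Sum>i\<in>insert j I. c' i *\<^sub>R b i x)"
      using insert.hyps by (simp add: r'_def r_def b'_def c'_def algebra_simps)
  qed
  then show ?case using orthI orthj by (intro exI[of _ c']) auto
qed

text \<open>The intersection is a face of both cells and proper in at least one of them, so it has dimension at most two.\<close>

lemma mesh_overlap_negligible:
  assumes mesh: "tetrahedral_mesh \<Omega> \<T>" and K: "K \<in> \<T>" "K' \<in> \<T>" "K \<noteq> K'"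
  shows "negligible (K \<inter> K')"
proof -
  have tri: "triangulation \<T>" using mesh by (simp add: tetrahedral_mesh_def)
  have f: "K \<inter> K' face_of K" using tri K unfolding triangulation_def by blast
  have f': "K' \<inter> K face_of K'" using tri K unfolding triangulation_def by blast
  note c = mesh_cell[OF mesh K(1)] and c' = mesh_cell[OF mesh K(2)]
  have "aff_dim (K \<inter> K') < 3"
  proof (cases "K \<inter> K' = K")
    case False
    then show ?thesis using face_of_aff_dim_lt[OF c(2) f] c(3) by simp
  next
    case True
    then have "K' \<inter> K \<noteq> K'" using K(3) by blast
    then show ?thesis using face_of_aff_dim_lt[OF c'(2) f'] c'(3) by (simp add: Int_commute)
  qed
  then have "interior (K \<inter> K') = {}"
    using aff_dim_nonempty_interior[of "K \<inter> K'"] by fastforce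
  then show ?thesis
    using negligible_convex_interior[OF convex_Int[OF c(2) c'(2)]] by simp
qed

lemma AE_mesh_unique_cell:
  assumes mesh: "tetrahedral_mesh \<Omega> \<T>"
  shows "AE x in lebesgue. \<forall>K\<in>\<T>. \<forall>K'\<in>\<T>. x \<in> K \<longrightarrow> x \<in> K' \<longrightarrow> K = K'"
proof (intro AE_finite_allI mesh_finite[OF mesh])
  fix K K' assume K: "K \<in> \<T>" "K' \<in> \<T>"
  show "AE x in lebesgue. x \<in> K \<longrightarrow> x \<in> K' \<longrightarrow> K = K'"
  proof (cases "K = K'")
    case False
    then have "AE x in lebesgue. x \<notin> K \<inter> K'"
      using mesh_overlap_negligible[OF mesh K False] by (intro AE_not_in) (simp add: negligible_iff_null_sets)
    then show ?thesis by eventually_elim auto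
  qed simp
qed

lemma L2_indicator_mult:
  fixes f :: "real^3 \<Rightarrow> real"
  assumes f: "f \<in> L2 \<Omega>" and K: "K \<in> sets lebesgue"
  shows "(\<lambda>x. indicator K x * f x) \<in> L2 \<Omega>"
proof -
  have m: "(\<lambda>x. indicator K x * f x) \<in> borel_measurable (lebesgue_on \<Omega>)"
    using K by (intro borel_measurable_times L2_measurable[OF f] measurable_restrict_space1) simp
  have "integrable (lebesgue_on \<Omega>) (\<lambda>x. (norm (indicator K x * f x))\<^sup>2)"
  proof (rule Bochner_Integration.integrable_bound)
    show "integrable (lebesgue_on \<Omega>) (\<lambda>x. (norm (f x))\<^sup>2)" using f by (simp add: L2_def)
    show "(\<lambda>x. (norm (indicator K x * f x))\<^sup>2) \<in> borel_measurable (lebesgue_on \<Omega>)"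
      using m by measurable
    show "AE x in lebesgue_on \<Omega>. norm ((norm (indicator K x * f x))\<^sup>2) \<le> norm ((norm (f x))\<^sup>2)"
      by (intro AE_I2) (auto simp: indicator_def)
  qed
  with m show ?thesis by (simp add: L2_def)
qed

text \<open>Up to null sets the piecewise polynomials are spanned by the finitely many fields that are a monomial times a coordinate
vector on one cell and \<open>0\<close> elsewhere: almost every point lies in only one cell.\<close>

lemma L2_projection_exists:
  assumes \<Omega>: "open \<Omega>" "bounded \<Omega>" and mesh: "tetrahedral_mesh \<Omega> \<T>" and f: "f \<in> L2 \<Omega>"
  obtains w where "w \<in> L2 \<Omega>" "is_L2_projection \<Omega> \<T> d f w"
proof -
  have Lm: "\<Omega> \<in> lmeasurable" using \<Omega> by (intro lmeasurable_open)
  then have S: "\<Omega> \<in> sets lebesgue" by blast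
  have fin: "finite \<T>" by (rule mesh_finite[OF mesh])
  have Ks: "K \<in> sets lebesgue" if "K \<in> \<T>" for K
    using lmeasurable_compact[OF mesh_cell(1)[OF mesh that]] by blast
  define A where "A = {\<alpha> :: 3 \<Rightarrow> nat. (\<Sum>i\<in>UNIV. \<alpha> i) \<le> d}"
  define mono where "mono \<alpha> x = (\<Prod>i\<in>UNIV. (x $ i) ^ \<alpha> i)" for \<alpha> and x :: "real^3"
  have finA: "finite A" unfolding A_def by (rule finite_multi_indices)
  have polys: "p \<in> polys d \<longleftrightarrow> (\<exists>c. p = (\<lambda>x. \<Sum>\<alpha>\<in>A. c \<alpha> * mono \<alpha> x))" for p
    by (simp add: polys_def A_def mono_def)
  have smono: "smooth (mono \<alpha>)" for \<alpha>
    unfolding mono_def by (intro smooth_prod smooth_power smooth_coordinate) simp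
  define I where "I = \<T> \<times> A \<times> (UNIV :: 3 set)"
  have finI: "finite I" using fin finA by (simp add: I_def)
  define b :: "(real^3) set \<times> (3 \<Rightarrow> nat) \<times> 3 \<Rightarrow> real^3 \<Rightarrow> real^3"
    where "b = (\<lambda>(K, \<alpha>, i) x. axis i (indicator K x * mono \<alpha> x))"
  have bL: "b j \<in> L2 \<Omega>" if "j \<in> I" for j
    using that unfolding b_def I_def
    by (auto intro!: L2_axis L2_indicator_mult smooth_L2 Lm \<Omega> smono Ks)
  define comb where "comb c x = (\<Sum>j\<in>I. c j *\<^sub>R b j x)" for c x
  have comb_nth: "comb c x $ i = (\<Sum>K\<in>\<T>. indicator K x * (\<Sum>\<alpha>\<in>A. c (K, \<alpha>, i) * mono \<alpha> x))" for c x i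
  proof -
    have "comb c x $ i = (\<Sum>K\<in>\<T>. \<Sum>\<alpha>\<in>A. \<Sum>i'\<in>UNIV. (c (K, \<alpha>, i') *\<^sub>R b (K, \<alpha>, i') x) $ i)"
      by (simp add: comb_def I_def sum.cartesian_product sum_component case_prod_beta)
    also have "\<dots> = (\<Sum>K\<in>\<T>. \<Sum>\<alpha>\<in>A. c (K, \<alpha>, i) * (indicator K x * mono \<alpha> x))"
      by (simp add: b_def axis_def if_distrib[of "\<lambda>z. _ * z"] cong: if_cong)
    finally show ?thesis by (simp add: sum_distrib_left ac_simps)
  qed
  have comb_cell: "comb c x $ i = (\<Sum>\<alpha>\<in>A. c (K, \<alpha>, i) * mono \<alpha> x)"
    if "\<forall>K\<in>\<T>. \<forall>K'\<in>\<T>. x \<in> K \<longrightarrow> x \<in> K' \<longrightarrow> K = K'" "K \<in> \<T>" "x \<in> K" for c x i K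
  proof -
    have "comb c x $ i = (\<Sum>K'\<in>\<T>. if K' = K then (\<Sum>\<alpha>\<in>A. c (K', \<alpha>, i) * mono \<alpha> x) else 0)"
      unfolding comb_nth using that by (intro sum.cong) (auto simp: indicator_def)
    then show ?thesis using fin that by simp
  qed
  obtain c where c: "\<And>j. j \<in> I \<Longrightarrow> l2_inner \<Omega> (\<lambda>x. f x - comb c x) (b j) = 0"
    using L2_orthogonal_projection[where b=b, OF finI bL f] unfolding comb_def by blast
  have combL: "comb c' \<in> L2 \<Omega>" for c'
    unfolding comb_def by (intro L2_sum finI L2_scale bL)
  have rL: "(\<lambda>x. f x - comb c x) \<in> L2 \<Omega>" by (intro L2_diff f combL)
  have orth: "l2_inner \<Omega> (\<lambda>x. f x - comb c x) (comb c') = 0" for c'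
  proof -
    have "l2_inner \<Omega> (\<lambda>x. f x - comb c x) (comb c') = (LINT x|lebesgue_on \<Omega>. (\<Sum>j\<in>I. (f x - comb c x) \<bullet> (c' j *\<^sub>R b j x)))"
      by (simp add: l2_inner_def comb_def[of c'] inner_sum_right)
    also have "\<dots> = (\<Sum>j\<in>I. LINT x|lebesgue_on \<Omega>. (f x - comb c x) \<bullet> (c' j *\<^sub>R b j x))"
      by (intro Bochner_Integration.integral_sum integrable_L2_inner L2_scale rL bL)
    also have "\<dots> = 0" using c by (simp add: l2_inner_def)
    finally show ?thesis .
  qed
  have "comb c \<in> X_h_vec \<T> d"
    unfolding X_h_vec_def X_h_def
  proof (intro CollectI allI ballI)
    fix i K assume K: "K \<in> \<T>"
    show "\<exists>p\<in>polys d. AE x in lebesgue_on K. comb c x $ i = p x"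
    proof (rule bexI)
      show "(\<lambda>x. \<Sum>\<alpha>\<in>A. c (K, \<alpha>, i) * mono \<alpha> x) \<in> polys d" unfolding polys by (rule exI) (rule refl)
      have "AE x in lebesgue. x \<in> K \<longrightarrow> comb c x $ i = (\<Sum>\<alpha>\<in>A. c (K, \<alpha>, i) * mono \<alpha> x)"
        using AE_mesh_unique_cell[OF mesh] by eventually_elim (use comb_cell K in blast)
      then show "AE x in lebesgue_on K. comb c x $ i = (\<Sum>\<alpha>\<in>A. c (K, \<alpha>, i) * mono \<alpha> x)"
        using Ks[OF K] by (subst AE_restrict_space_iff) auto
    qed
  qed
  moreover have "l2_inner \<Omega> (\<lambda>x. f x - comb c x) g = 0" if g: "g \<in> X_h_vec \<T> d" for g
  proof -
    define cg where "cg K i = (SOME c. AE x in lebesgue_on K. g x $ i = (\<Sum>\<alpha>\<in>A. c \<alpha> * mono \<alpha> x))" for K i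
    have cg: "AE x in lebesgue_on K. g x $ i = (\<Sum>\<alpha>\<in>A. cg K i \<alpha> * mono \<alpha> x)" if K: "K \<in> \<T>" for K i
    proof -
      have "(\<lambda>x. g x $ i) \<in> X_h \<T> d" using g by (simp add: X_h_vec_def)
      then obtain p where p: "p \<in> polys d" "AE x in lebesgue_on K. g x $ i = p x"
        using K unfolding X_h_def by blast
      obtain a where "p = (\<lambda>x. \<Sum>\<alpha>\<in>A. a \<alpha> * mono \<alpha> x)" using p(1) unfolding polys by (elim exE)
      then have "AE x in lebesgue_on K. g x $ i = (\<Sum>\<alpha>\<in>A. a \<alpha> * mono \<alpha> x)" using p(2) by simp
      then show ?thesis
        unfolding cg_def by (rule someI[where P="\<lambda>c. AE x in lebesgue_on K. g x $ i = (\<Sum>\<alpha>\<in>A. c \<alpha> * mono \<alpha> x)"])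
    qed
    define c' where "c' = (\<lambda>(K, \<alpha>, i). cg K i \<alpha>)"
    have "AE x in lebesgue. x \<in> K \<longrightarrow> g x $ i = (\<Sum>\<alpha>\<in>A. c' (K, \<alpha>, i) * mono \<alpha> x)" if "K \<in> \<T>" for K i
      using cg[OF that, of i] Ks[OF that] by (subst (asm) AE_restrict_space_iff) (auto simp: c'_def)
    then have "AE x in lebesgue. \<forall>K\<in>\<T>. \<forall>i\<in>UNIV. x \<in> K \<longrightarrow> g x $ i = (\<Sum>\<alpha>\<in>A. c' (K, \<alpha>, i) * mono \<alpha> x)"
      by (intro AE_finite_allI fin) auto
    then have "AE x in lebesgue. x \<in> \<Omega> \<longrightarrow> g x = comb c' x"
      using AE_mesh_unique_cell[OF mesh]
    proof eventually_elim
      case (elim x)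
      show ?case
      proof
        assume "x \<in> \<Omega>"
        then obtain K where K: "K \<in> \<T>" "x \<in> K" using mesh_covers[OF mesh] by blast
        show "g x = comb c' x"
          using elim K comb_cell[OF elim(2) K] by (simp add: vec_eq_iff)
      qed
    qed
    then have eq: "AE x in lebesgue_on \<Omega>. g x = comb c' x"
      using S by (subst AE_restrict_space_iff) auto
    show ?thesis
    \<comment> \<open>Membership of \<open>g\<close> in \<^const>\<open>X_h_vec\<close> does not mention measurability. If the product is not measurable, its integral
      is \<open>0\<close> by convention.\<close>
    proof (cases "(\<lambda>x. (f x - comb c x) \<bullet> g x) \<in> borel_measurable (lebesgue_on \<Omega>)")
      case True
      have "(\<lambda>x. (f x - comb c x) \<bullet> comb c' x) \<in> borel_measurable (lebesgue_on \<Omega>)"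
        by (intro borel_measurable_inner L2_measurable rL combL)
      then have "l2_inner \<Omega> (\<lambda>x. f x - comb c x) g = l2_inner \<Omega> (\<lambda>x. f x - comb c x) (comb c')"
        unfolding l2_inner_def
      proof (rule integral_cong_AE[OF True])
        show "AE x in lebesgue_on \<Omega>. (f x - comb c x) \<bullet> g x = (f x - comb c x) \<bullet> comb c' x"
          using eq by eventually_elim simp
      qed
      then show ?thesis using orth by simp
    next
      case False
      then have "\<not> integrable (lebesgue_on \<Omega>) (\<lambda>x. (f x - comb c x) \<bullet> g x)"
        using borel_measurable_integrable by blast
      then show ?thesis unfolding l2_inner_def by (rule not_integrable_integral_eq)
    qed
  qed
  ultimately show thesis
    by (intro that[OF combL[of c]]) (simp add: is_L2_projection_def)
qed

section \<open>The error estimate\<close>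

lemma RT_h_tensor_row_Hdiv: "p \<in> RT_h_tensor \<Omega> \<T> m \<Longrightarrow> (\<lambda>x. p x $ i) \<in> Hdiv \<Omega>"
  by (simp add: RT_h_tensor_def RT_h_def)

text \<open>Row by row, \<open>(p, \<nabla>e) = -(div p, e) = (\<nabla>\<phi> + f, e)\<close>, and the gradient \<open>\<nabla>\<phi>\<close> is orthogonal to \<open>e\<close>.\<close>

lemma kappa_admissible_duality:
  assumes \<Omega>: "open \<Omega>" "bounded \<Omega>"
    and pv: "(p, v) \<in> kappa_admissible \<Omega> \<T> k m f" and f: "f \<in> L2 \<Omega>" and e: "e \<in> V_space \<Omega>"
  shows "p \<in> L2 \<Omega>" "l2_inner \<Omega> p (vgrad \<Omega> e) = l2_inner \<Omega> f e"
proof -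
  obtain \<phi> where p: "p \<in> RT_h_tensor \<Omega> \<T> m" and \<phi>: "\<phi> \<in> H1 \<Omega>"
    and eq: "AE x in lebesgue_on \<Omega>. tdiv \<Omega> p x + wgrad \<Omega> \<phi> x + f x = 0"
    using pv by (auto simp: kappa_admissible_def U_h_def)
  note H = RT_h_tensor_row_Hdiv[OF p]
  have pL: "(\<lambda>x. p x $ i) \<in> L2 \<Omega>" for i using H by (simp add: Hdiv_def)
  show pL': "p \<in> L2 \<Omega>" by (rule L2_vec[OF pL])
  have tL: "tdiv \<Omega> p \<in> L2 \<Omega>" by (rule L2_vec) (simp add: tdiv_def wdiv_L2[OF H])
  note eL = V_space_L2[OF e]
  have e0: "(\<lambda>x. e x $ i) \<in> H10 \<Omega>" for i using e by (simp add: V_space_def)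
  have "l2_inner \<Omega> p (vgrad \<Omega> e) = (\<Sum>i\<in>UNIV. l2_inner \<Omega> (\<lambda>x. p x $ i) (wgrad \<Omega> (\<lambda>x. e x $ i)))"
    using l2_inner_components[OF pL' vgrad_L2[OF V_space_H1[OF e]]] by (simp add: vgrad_def)
  also have "\<dots> = (\<Sum>i\<in>UNIV. - l2_inner \<Omega> (wdiv \<Omega> (\<lambda>x. p x $ i)) (\<lambda>x. e x $ i))"
    by (simp add: H10_integration_by_parts[OF \<Omega> pL wdiv_L2[OF H] wdiv_weak[OF H] e0])
  also have "\<dots> = - l2_inner \<Omega> (tdiv \<Omega> p) e"
    using l2_inner_components[OF tL eL] by (simp add: tdiv_def sum_negf)
  also have "\<dots> = - l2_inner \<Omega> (\<lambda>x. (-1) *\<^sub>R (wgrad \<Omega> \<phi> x + f x)) e"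
  proof -
    have "AE x in lebesgue_on \<Omega>. tdiv \<Omega> p x = (-1) *\<^sub>R (wgrad \<Omega> \<phi> x + f x)"
      using eq by eventually_elim (simp add: algebra_simps add_eq_0_iff)
    then have "l2_inner \<Omega> (tdiv \<Omega> p) e = l2_inner \<Omega> (\<lambda>x. (-1) *\<^sub>R (wgrad \<Omega> \<phi> x + f x)) e"
      by (intro l2_inner_cong_AE[OF tL _ eL eL] L2_scale L2_add wgrad_L2 \<phi> f) auto
    then show ?thesis by simp
  qed
  also have "\<dots> = l2_inner \<Omega> (wgrad \<Omega> \<phi>) e + l2_inner \<Omega> f e"
    unfolding l2_inner_scale_left by (simp add: l2_inner_add_left[OF wgrad_L2[OF \<phi>] f eL])
  also have "\<dots> = l2_inner \<Omega> f e"
    by (simp add: gradient_orthogonal_V_space[OF \<Omega> \<phi> e])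
  finally show "l2_inner \<Omega> p (vgrad \<Omega> e) = l2_inner \<Omega> f e" .
qed

text \<open>For an admissible pair \<open>(p, v)\<close> duality and the orthogonality hypothesis give \<open>(f, e) = (p - \<nabla>v, \<nabla>e)\<close>. The infimum
over the pairs may not be attained, so pairs within \<open>\<eta>\<close> of it are used.\<close>

lemma kappa_h_bound:
  assumes \<Omega>: "open \<Omega>" "bounded \<Omega>" and mesh: "tetrahedral_mesh \<Omega> \<T>"
    and e: "e \<in> V_space \<Omega>"
    and orth: "\<And>v. v \<in> V_h \<Omega> \<T> k \<Longrightarrow> l2_inner \<Omega> (vgrad \<Omega> e) (vgrad \<Omega> v) = 0"
    and f: "f \<in> L2 \<Omega>" "f \<in> X_h_vec \<T> d"
    and \<kappa>: "kappa_h \<Omega> \<T> k d m = ennreal \<kappa>" "\<kappa> \<ge> 0"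
  shows "\<bar>l2_inner \<Omega> f e\<bar> \<le> \<kappa> * l2_norm \<Omega> f * l2_norm \<Omega> (vgrad \<Omega> e)"
proof (cases "l2_norm \<Omega> f = 0")
  case True
  then show ?thesis using l2_inner_Cauchy_Schwarz[OF f(1) V_space_L2[OF e]] by simp
next
  case False
  then have pos: "l2_norm \<Omega> f > 0" using l2_norm_nonneg[of \<Omega> f] by simp
  have fne: "\<not> (AE x in lebesgue_on \<Omega>. f x = 0)" using False l2_norm_eq_0_iff[OF f(1)] by simp
  note eL = vgrad_L2[OF V_space_H1[OF e]]
  have "\<bar>l2_inner \<Omega> f e\<bar> - \<kappa> * l2_norm \<Omega> f * l2_norm \<Omega> (vgrad \<Omega> e) \<le> (l2_norm \<Omega> f * l2_norm \<Omega> (vgrad \<Omega> e)) * \<eta>"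
    if "\<eta> > 0" for \<eta>
  proof -
    have "(INF (p, v) \<in> kappa_admissible \<Omega> \<T> k m f. ennreal (l2_norm \<Omega> (\<lambda>x. p x - vgrad \<Omega> v x) / l2_norm \<Omega> f)) \<le> kappa_h \<Omega> \<T> k d m"
      unfolding kappa_h_def using f(2) fne by (intro SUP_upper) simp
    also have "\<dots> < ennreal (\<kappa> + \<eta>)"
      using \<kappa> that by (simp add: ennreal_less_iff)
    finally obtain p v where pv: "(p, v) \<in> kappa_admissible \<Omega> \<T> k m f"
      and less: "ennreal (l2_norm \<Omega> (\<lambda>x. p x - vgrad \<Omega> v x) / l2_norm \<Omega> f) < ennreal (\<kappa> + \<eta>)"
      unfolding INF_less_iff by auto
    have "l2_norm \<Omega> (\<lambda>x. p x - vgrad \<Omega> v x) / l2_norm \<Omega> f < \<kappa> + \<eta>"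
      using less by (subst (asm) ennreal_less_iff) (simp_all add: l2_norm_nonneg)
    then have le: "l2_norm \<Omega> (\<lambda>x. p x - vgrad \<Omega> v x) \<le> (\<kappa> + \<eta>) * l2_norm \<Omega> f"
      using pos by (simp add: field_simps)
    have v: "v \<in> V_h \<Omega> \<T> k" using pv by (simp add: kappa_admissible_def)
    then have vL: "vgrad \<Omega> v \<in> L2 \<Omega>"
      using V_h_subset_V_space[OF \<Omega> mesh] by (intro vgrad_L2 V_space_H1) blast
    note p = kappa_admissible_duality[OF \<Omega> pv f(1) e]
    have "l2_inner \<Omega> f e = l2_inner \<Omega> (\<lambda>x. p x - vgrad \<Omega> v x) (vgrad \<Omega> e)"
      using l2_inner_diff_left[OF p(1) vL eL] p(2) orth[OF v] by (simp add: l2_inner_commute)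
    then have "\<bar>l2_inner \<Omega> f e\<bar> \<le> l2_norm \<Omega> (\<lambda>x. p x - vgrad \<Omega> v x) * l2_norm \<Omega> (vgrad \<Omega> e)"
      using l2_inner_Cauchy_Schwarz[OF L2_diff[OF p(1) vL] eL] by simp
    also have "\<dots> \<le> (\<kappa> + \<eta>) * l2_norm \<Omega> f * l2_norm \<Omega> (vgrad \<Omega> e)"
      by (intro mult_right_mono le l2_norm_nonneg)
    finally show ?thesis by (simp add: algebra_simps)
  qed
  then have "\<bar>l2_inner \<Omega> f e\<bar> - \<kappa> * l2_norm \<Omega> f * l2_norm \<Omega> (vgrad \<Omega> e) \<le> 0"
    by (rule nonpos_if_le_mult_eps) (simp_all add: mult_nonneg_nonneg l2_norm_nonneg)
  then show ?thesis by simp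
qed

lemma Cauchy_Schwarz_pairs:
  fixes a b c d :: real
  shows "a * b + c * d \<le> sqrt (a\<^sup>2 + c\<^sup>2) * sqrt (b\<^sup>2 + d\<^sup>2)"
proof -
  have "(a * b + c * d)\<^sup>2 \<le> (a\<^sup>2 + c\<^sup>2) * (b\<^sup>2 + d\<^sup>2)"
    using zero_le_power2[of "a * d - c * b"] by (simp add: power2_eq_square algebra_simps)
  then show ?thesis by (simp add: real_le_rsqrt flip: real_sqrt_mult)
qed

text \<open>The first two steps insert the projections of \<open>g\<close> and of \<open>e\<close>; the splitting is orthogonal in both arguments, which
lets \<open>C\<^sub>0\<close> and \<open>\<kappa>\<close> enter as the two components of a vector in the plane.\<close>

lemma duality_estimate:
  assumes \<Omega>: "open \<Omega>" "bounded \<Omega>" and mesh: "tetrahedral_mesh \<Omega> \<T>"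
    and C0: "\<And>w \<pi>w. w \<in> V_space \<Omega> \<Longrightarrow> is_L2_projection \<Omega> \<T> d w \<pi>w \<Longrightarrow>
               l2_norm \<Omega> (\<lambda>x. w x - \<pi>w x) \<le> C\<^sub>0 * l2_norm \<Omega> (vgrad \<Omega> w)"
    and e: "e \<in> V_space \<Omega>"
    and orth: "\<And>v. v \<in> V_h \<Omega> \<T> k \<Longrightarrow> l2_inner \<Omega> (vgrad \<Omega> e) (vgrad \<Omega> v) = 0"
    and g: "g \<in> L2 \<Omega>"
    and \<kappa>: "kappa_h \<Omega> \<T> k d m = ennreal \<kappa>" "\<kappa> \<ge> 0"
  shows "l2_inner \<Omega> g e \<le> sqrt (C\<^sub>0\<^sup>2 + \<kappa>\<^sup>2) * l2_norm \<Omega> g * l2_norm \<Omega> (vgrad \<Omega> e)"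
proof -
  note eL = V_space_L2[OF e]
  obtain \<pi>g where \<pi>g: "\<pi>g \<in> L2 \<Omega>" "is_L2_projection \<Omega> \<T> d g \<pi>g"
    using L2_projection_exists[OF \<Omega> mesh g] by blast
  obtain \<pi>e where \<pi>e: "\<pi>e \<in> L2 \<Omega>" "is_L2_projection \<Omega> \<T> d e \<pi>e"
    using L2_projection_exists[OF \<Omega> mesh eL] by blast
  note rL = L2_diff[OF g \<pi>g(1)] and rL' = L2_diff[OF eL \<pi>e(1)]
  have "l2_inner \<Omega> g e = l2_inner \<Omega> (\<lambda>x. g x - \<pi>g x) e + l2_inner \<Omega> \<pi>g e"
    using l2_inner_diff_left[OF g \<pi>g(1) eL] by simp
  also have "l2_inner \<Omega> (\<lambda>x. g x - \<pi>g x) e = l2_inner \<Omega> (\<lambda>x. g x - \<pi>g x) (\<lambda>x. e x - \<pi>e x)"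
    using l2_inner_diff_right[OF eL \<pi>e(1) rL] \<pi>g(2) \<pi>e(2) by (simp add: is_L2_projection_def)
  also have "\<dots> \<le> l2_norm \<Omega> (\<lambda>x. g x - \<pi>g x) * l2_norm \<Omega> (\<lambda>x. e x - \<pi>e x)"
    using l2_inner_Cauchy_Schwarz[OF rL rL'] by simp
  also have "\<dots> \<le> l2_norm \<Omega> (\<lambda>x. g x - \<pi>g x) * (C\<^sub>0 * l2_norm \<Omega> (vgrad \<Omega> e))"
    by (intro mult_left_mono C0 e \<pi>e l2_norm_nonneg)
  also have "l2_inner \<Omega> \<pi>g e \<le> \<kappa> * l2_norm \<Omega> \<pi>g * l2_norm \<Omega> (vgrad \<Omega> e)"
    using kappa_h_bound[OF \<Omega> mesh e orth \<pi>g(1) _ \<kappa>] \<pi>g(2) by (force simp: is_L2_projection_def)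
  finally have "l2_inner \<Omega> g e \<le> (C\<^sub>0 * l2_norm \<Omega> (\<lambda>x. g x - \<pi>g x) + \<kappa> * l2_norm \<Omega> \<pi>g) * l2_norm \<Omega> (vgrad \<Omega> e)"
    by (simp add: algebra_simps)
  also have "\<dots> \<le> (sqrt (C\<^sub>0\<^sup>2 + \<kappa>\<^sup>2) * sqrt ((l2_norm \<Omega> (\<lambda>x. g x - \<pi>g x))\<^sup>2 + (l2_norm \<Omega> \<pi>g)\<^sup>2)) * l2_norm \<Omega> (vgrad \<Omega> e)"
    by (intro mult_right_mono Cauchy_Schwarz_pairs l2_norm_nonneg)
  also have "(l2_norm \<Omega> (\<lambda>x. g x - \<pi>g x))\<^sup>2 + (l2_norm \<Omega> \<pi>g)\<^sup>2 = (l2_norm \<Omega> g)\<^sup>2"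
  proof -
    have "l2_inner \<Omega> (\<lambda>x. g x - \<pi>g x) \<pi>g = 0" using \<pi>g(2) by (simp add: is_L2_projection_def)
    then show ?thesis
      using l2_inner_diff_left[OF g \<pi>g(1) g] l2_inner_diff_left[OF g \<pi>g(1) \<pi>g(1)]
        l2_inner_diff_right[OF g \<pi>g(1) rL]
      by (simp add: l2_norm_square l2_inner_commute)
  qed
  finally show ?thesis by (simp add: l2_norm_nonneg)
qed

theorem theorem2:
  fixes \<Omega> :: "(real^3) set" and \<T> :: "(real^3) set set"
    and k d m :: nat and C\<^sub>0 :: real
    and f u u\<^sub>h :: "real^3 \<Rightarrow> real^3"
  assumes "lipschitz_polyhedral_domain \<Omega>"
    and "tetrahedral_mesh \<Omega> \<T>"
    and "k \<ge> 3" and "d = k - 1" and "m = k - 1"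
    and C0: "\<And>w \<pi>w. w \<in> V_space \<Omega> \<Longrightarrow> is_L2_projection \<Omega> \<T> d w \<pi>w \<Longrightarrow>
               l2_norm \<Omega> (\<lambda>x. w x - \<pi>w x) \<le> C\<^sub>0 * l2_norm \<Omega> (vgrad \<Omega> w)"
    and "f \<in> L2 \<Omega>"
    and "is_stokes_solution \<Omega> f u"
    and "is_V_projection \<Omega> \<T> k u u\<^sub>h"
  shows "ennreal (l2_norm \<Omega> (\<lambda>x. u x - u\<^sub>h x)) \<le>
           C_h \<Omega> \<T> k d m C\<^sub>0 * ennreal (l2_norm \<Omega> (\<lambda>x. vgrad \<Omega> u x - vgrad \<Omega> u\<^sub>h x)) \<and>
         ennreal (l2_norm \<Omega> (\<lambda>x. vgrad \<Omega> u x - vgrad \<Omega> u\<^sub>h x)) \<le>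
           C_h \<Omega> \<T> k d m C\<^sub>0 * ennreal (l2_norm \<Omega> f)"
proof -
  have \<Omega>: "open \<Omega>" "bounded \<Omega>" using assms(1) by (auto simp: lipschitz_polyhedral_domain_def)
  note mesh = assms(2) and f = \<open>f \<in> L2 \<Omega>\<close>
  have u: "u \<in> V_space \<Omega>" and stokes: "\<And>v. v \<in> V_space \<Omega> \<Longrightarrow> l2_inner \<Omega> (vgrad \<Omega> u) (vgrad \<Omega> v) = l2_inner \<Omega> f v"
    using assms(8) by (auto simp: is_stokes_solution_def)
  define e where "e x = u x - u\<^sub>h x" for x
  have uh: "u\<^sub>h \<in> V_h \<Omega> \<T> k" and orth: "\<And>v. v \<in> V_h \<Omega> \<T> k \<Longrightarrow> l2_inner \<Omega> (vgrad \<Omega> e) (vgrad \<Omega> v) = 0"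
    using assms(9) by (auto simp: is_V_projection_def e_def[abs_def])
  have uhV: "u\<^sub>h \<in> V_space \<Omega>" using uh V_h_subset_V_space[OF \<Omega> mesh] by blast
  have eV: "e \<in> V_space \<Omega>" unfolding e_def[abs_def] by (rule V_space_diff[OF \<Omega> u uhV])
  note gL = vgrad_L2[OF V_space_H1[OF u]] vgrad_L2[OF V_space_H1[OF uhV]] vgrad_L2[OF V_space_H1[OF eV]]
  note eL = V_space_L2[OF eV]
  have ge: "AE x in lebesgue_on \<Omega>. vgrad \<Omega> e x = vgrad \<Omega> u x - vgrad \<Omega> u\<^sub>h x"
    unfolding e_def[abs_def] by (rule vgrad_diff[OF \<Omega> u uhV])
  define G where "G = l2_norm \<Omega> (vgrad \<Omega> e)"
  have G: "l2_norm \<Omega> (\<lambda>x. vgrad \<Omega> u x - vgrad \<Omega> u\<^sub>h x) = G"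
    unfolding G_def by (rule l2_norm_cong_AE[OF gL(3) L2_diff[OF gL(1,2)] ge, symmetric])
  have "l2_inner \<Omega> (vgrad \<Omega> e) (vgrad \<Omega> e) = l2_inner \<Omega> (\<lambda>x. vgrad \<Omega> u x - vgrad \<Omega> u\<^sub>h x) (vgrad \<Omega> e)"
    by (rule l2_inner_cong_AE[OF gL(3) L2_diff[OF gL(1,2)] gL(3,3) ge]) simp
  also have "\<dots> = l2_inner \<Omega> f e"
    using l2_inner_diff_left[OF gL] stokes[OF eV] orth[OF uh] by (simp add: l2_inner_commute)
  finally have energy: "G\<^sup>2 = l2_inner \<Omega> f e"
    by (simp add: G_def l2_norm_square)
  have G0: "0 \<le> G" by (simp add: G_def l2_norm_nonneg)
  show ?thesis
  proof (cases "kappa_h \<Omega> \<T> k d m")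
    case (real \<kappa>)
    define C where "C = sqrt (C\<^sub>0\<^sup>2 + \<kappa>\<^sup>2)"
    have sum: "ennreal (C\<^sub>0\<^sup>2) + (kappa_h \<Omega> \<T> k d m)\<^sup>2 = ennreal (C\<^sub>0\<^sup>2 + \<kappa>\<^sup>2)"
      using real by (simp add: ennreal_power)
    have Ch: "C_h \<Omega> \<T> k d m C\<^sub>0 = ennreal C"
      unfolding C_h_def sum by (simp add: sqrt_ennreal_def C_def del: ennreal_plus)
    have C: "0 \<le> C" by (simp add: C_def)
    have est: "l2_inner \<Omega> g e \<le> C * l2_norm \<Omega> g * G" if "g \<in> L2 \<Omega>" for g
      unfolding C_def G_def by (rule duality_estimate[OF \<Omega> mesh C0 eV orth that real(2,1)])
    have cancel: "a \<le> b" if "a * a \<le> a * b" "0 \<le> a" "0 \<le> b" for a b :: real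
      using that by (cases "a = 0") (simp_all add: mult_le_cancel_left)
    have "l2_norm \<Omega> e * l2_norm \<Omega> e \<le> l2_norm \<Omega> e * (C * G)"
      using est[OF eL] by (simp add: ac_simps flip: l2_norm_square power2_eq_square)
    then have "l2_norm \<Omega> e \<le> C * G"
      by (rule cancel) (simp_all add: C G0 l2_norm_nonneg)
    moreover have "G * G \<le> G * (C * l2_norm \<Omega> f)"
      using est[OF f] energy by (simp add: power2_eq_square ac_simps)
    then have "G \<le> C * l2_norm \<Omega> f"
      by (rule cancel) (simp_all add: C G0 l2_norm_nonneg)
    ultimately show ?thesis
      unfolding G Ch e_def[abs_def] by (simp add: C ennreal_leI flip: ennreal_mult')
  next
    case top
    then have Ch: "C_h \<Omega> \<T> k d m C\<^sub>0 = \<infinity>"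
      by (simp add: C_h_def sqrt_ennreal_def)
    have "l2_norm \<Omega> e = 0" if "G = 0"
      by (rule V_space_norm_eq_0[OF \<Omega> eV]) (use that in \<open>simp add: G_def\<close>)
    moreover have "G = 0" if "l2_norm \<Omega> f = 0"
      using energy l2_inner_Cauchy_Schwarz[OF f eL] that by simp
    ultimately show ?thesis
      unfolding G Ch e_def[abs_def]
      using G0 l2_norm_nonneg[of \<Omega> f] 
      by (cases "G = 0"; cases "l2_norm \<Omega> f = 0") (simp_all add: ennreal_top_mult)
  qed
qed

end
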